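(* (1) Let $S$ be a restriction semigroup with local units, with projection semilattice $P(S)$ and character space $\widehat{P(S)}$. For $s\in S$ let $\beta_s$ be the partial self-map of $\widehat{P(S)}$ with domain $D_{s^*}=\{\varphi\in\widehat{P(S)}:\varphi(s^* )=1\}$ given by $\beta_s(\varphi)(e)=\varphi((es)^* )$ for $e\in P(S)$. Then $s\mapsto\beta_s$ is an action of $S$ on $\widehat{P(S)}$. The category of germs $\mathscr C(S)=S\ltimes_\beta\widehat{P(S)}$ of this action is an ample topological category, its set $\mathscr C(S)^a$ of compact slices is a Boolean restriction semigroup, and the map $$\iota\colon S\to\mathscr C(S)^a,\qquad s\mapsto (s,D_{s^*})=\{[s,\varphi]:\varphi\in D_{s^*}\}$$ is an injective $(\cdot,{}^* )$-morphism. Furthermore, $\mathscr C(S)^a$ has the following universal property: for every Boolean restriction semigroup $T$ with local units and every $(\cdot,{}^* )$-morphism $\alpha\colon S\to T$ such that $\alpha|_{P(S)}\colon P(S)\to P(T)$ is non-degenerate, there is a morphism of Boolean restriction semigroups $\psi\colon\mathscr C(S)^a\to T$ such that $\alpha=\psi\iota$. (2) Let $S$ be an arbitrary restriction semigroup. Then $S$ embeds, as a $(\cdot,{}^* )$-algebra, into the Boolean restriction semigroup $\mathscr C(S^1)^a$. Consequently, every restriction semigroup is isomorphic to a restriction semigroup of compact slices of an ample category, that is, to a $(\cdot,{}^* )$-subalgebra of $\mathcal C^a$ for some ample category $\mathcal C$.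
   Context: **Restriction semigroups.** A restriction semigroup is an algebra $(S;\cdot,{}^* )$ where $(S;\cdot)$ is a semigroup and ${}^*$ is a unary operation with $xx^*=x$, $x^*y^*=y^*x^*=(x^*y^* )^*$, $(xy)^*=(x^*y)^*$, $x^*y=y(xy)^*$. The set of projections $P(S)=\{s^*:s\in S\}$ is a commutative idempotent semigroup, i.e. a meet-semilattice with $e\le f\Leftrightarrow e=ef$. The natural partial order on $S$ is $s\le t\Leftrightarrow s=ts^*$. $S$ has local units if for every $s\in S$ there are $e,f\in P(S)$ with $es=sf=s$. $S^1=S$ if $S$ has an identity; otherwise $S^1=S\cup\{1\}$ with an external identity $1$ and $1^*=1$. **Boolean restriction semigroups.** Elements $s,t$ are compatible, $s\smile t$, if $st^*=ts^*$. A generalized Boolean algebra is a relatively complemented distributive lattice with bottom $0$. A restriction semigroup with a zero that is a projection is Boolean if: any compatible $s,t$ have a join $s\vee t$ with respect to $\le$; $(P(S),\le)$ is a generalized Boolean algebra; and $(s\vee t)u=su\vee tu$ whenever $s\vee t$ exists. A morphism of generalized Boolean algebras preserves $0,\wedge,\vee$ and is always assumed non-degenerate: the ideal (down-set closed under finite joins) generated by its image is the whole codomain. A meet-semilattice morphism from a semilattice to a generalized Boolean algebra is non-degenerate if the ideal generated by its image is the whole codomain. A morphism of Boolean restriction semigroups is a $(\cdot,{}^* )$-morphism whose restriction to projections is a morphism of generalized Boolean algebras. **Topological categories.** A (small) category is identified with its set $\mathcal C$ of arrows; $\mathcal C^{(0)}\subseteq\mathcal C$ is the set of units (identity arrows),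 $\mathbf d,\mathbf r\colon\mathcal C\to\mathcal C^{(0)}$ are domain and range maps, and $xy$ is defined iff $\mathbf r(y)=\mathbf d(x)$. It is topological if $\mathbf d,\mathbf r$ and multiplication are continuous. It is étale if $\mathcal C^{(0)}$ is locally compact Hausdorff in the relative topology and $\mathbf d$ is a local homeomorphism onto its image in $\mathcal C^{(0)}$. A slice is an open $U\subseteq\mathcal C$ such that $\mathbf d|_U$ is a homeomorphism onto an open subset of $\mathcal C^{(0)}$. An étale category is ample if its compact slices form a basis of the topology; $\mathcal C^a$ denotes the set of compact slices, with $UV=\{xy:x\in U,y\in V,\mathbf r(y)=\mathbf d(x)\}$ and $U^*=\mathbf d(U)$. **Actions and germs.** For a locally compact Hausdorff space $X$, $\mathcal{PT}(X)$ is the restriction monoid of continuous partial self-maps of $X$ with open domains, under composition of partial maps (right to left), with $f^*=\mathrm{id}_{\mathrm{dom}(f)}$. An action of a restriction semigroup $S$ on $X$ is a $(\cdot,{}^* )$-morphism $\theta\colon S\to\mathcal{PT}(X)$ which is non-degenerate: $\bigcup_{e\in P(S)}X_e=X$, where $X_e=\mathrm{dom}(\theta_e)$; one has $\mathrm{dom}(\theta_s)=X_{s^*}$. On $\Omega=\{(s,x)\in S\times X: x\in X_{s^*}\}$ put $(s,x)\sim(t,y)$ iff $x=y$ and there is $u\le s,t$ with $x\in X_{u^*}$; the class of $(s,x)$ is the germ $[s,x]$. The category of germs $S\ltimes_\theta X=\Omega/{\sim}$ has $\mathbf d([s,x])=[s^*,x]$, $\mathbf r([s,x])=[e,\theta_s(x)]$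 for any $e\in P(S)$ with $\theta_s(x)\in X_e$, product $[s,\theta_t(y)][t,y]=[st,y]$, and topology with basis the sets $(s,U)=\{[s,x]:x\in U\}$, $s\in S$, $U\subseteq X_{s^*}$ open. **Character space.** For a semilattice $E$, $\widehat E$ is the set of non-zero semilattice morphisms $E\to\{0,1\}$, with the topology whose basis consists of the sets $D_e=\{\varphi:\varphi(e)=1\}$ and $D_e\setminus(D_{f_1}\cup\dots\cup D_{f_k})$ with $k\ge1$, $f_i\le e$. *)

theory Defs
  imports "HOL-Algebra.Lattice" "HOL-Analysis.Analysis"
begin

section \<open>Restriction semigroups\<close>

record 'a rsgrp = "'a partial_object" +
  rmult :: "'a \<Rightarrow> 'a \<Rightarrow> 'a" (infixl "\<cdot>\<index>" 70)
  rstar :: "'a \<Rightarrow> 'a" ("_\<star>\<index>" [1000] 999)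

locale restriction_semigroup =
  fixes S :: "'a rsgrp" (structure)
  assumes mult_closed: "\<lbrakk>x \<in> carrier S; y \<in> carrier S\<rbrakk> \<Longrightarrow> x \<cdot> y \<in> carrier S"
    and star_closed: "x \<in> carrier S \<Longrightarrow> x\<star> \<in> carrier S"
    and mult_assoc:
      "\<lbrakk>x \<in> carrier S; y \<in> carrier S; z \<in> carrier S\<rbrakk> \<Longrightarrow> (x \<cdot> y) \<cdot> z = x \<cdot> (y \<cdot> z)"
    and mult_star: "x \<in> carrier S \<Longrightarrow> x \<cdot> x\<star> = x"
    and star_commute: "\<lbrakk>x \<in> carrier S; y \<in> carrier S\<rbrakk> \<Longrightarrow> x\<star> \<cdot> y\<star> = y\<star> \<cdot> x\<star>"
    and star_mult_star: "\<lbrakk>x \<in> carrier S; y \<in> carrier S\<rbrakk> \<Longrightarrow> (x\<star> \<cdot> y\<star>)\<star> = x\<star> \<cdot> y\<star>"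
    and star_mult: "\<lbrakk>x \<in> carrier S; y \<in> carrier S\<rbrakk> \<Longrightarrow> (x \<cdot> y)\<star> = (x\<star> \<cdot> y)\<star>"
    and star_ample: "\<lbrakk>x \<in> carrier S; y \<in> carrier S\<rbrakk> \<Longrightarrow> x\<star> \<cdot> y = y \<cdot> (x \<cdot> y)\<star>"

definition projections :: "'a rsgrp \<Rightarrow> 'a set" where
  "projections S = rstar S ` carrier S"

definition natural_order :: "'a rsgrp \<Rightarrow> 'a gorder" where
  "natural_order S = \<lparr>carrier = carrier S, eq = (=), le = (\<lambda>s t. s = t \<cdot>\<^bsub>S\<^esub> s\<star>\<^bsub>S\<^esub>)\<rparr>"

definition projection_order :: "'a rsgrp \<Rightarrow> 'a gorder" where
  "projection_order S = \<lparr>carrier = projections S, eq = (=), le = (\<lambda>e f. e = e \<cdot>\<^bsub>S\<^esub> f)\<rparr>"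

definition has_local_units :: "'a rsgrp \<Rightarrow> bool" where
  "has_local_units S \<longleftrightarrow>
    (\<forall>s\<in>carrier S. \<exists>e\<in>projections S. \<exists>f\<in>projections S. e \<cdot>\<^bsub>S\<^esub> s = s \<and> s \<cdot>\<^bsub>S\<^esub> f = s)"

definition has_identity :: "'a rsgrp \<Rightarrow> bool" where
  "has_identity S \<longleftrightarrow>
    (\<exists>i\<in>carrier S. \<forall>s\<in>carrier S. i \<cdot>\<^bsub>S\<^esub> s = s \<and> s \<cdot>\<^bsub>S\<^esub> i = s)"

text \<open>The semigroup \<open>S\<^sup>1\<close>. The elements of \<open>S\<close> are tagged with \<^const>\<open>Some\<close>; \<^const>\<open>None\<close> is the
  external identity, which belongs to the carrier only if \<open>S\<close> has no identity.\<close>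

definition adjoin_identity :: "'a rsgrp \<Rightarrow> 'a option rsgrp" where
  "adjoin_identity S =
    \<lparr>carrier = Some ` carrier S \<union> (if has_identity S then {} else {None}),
     rmult = (\<lambda>x y. case x of None \<Rightarrow> y
                    | Some a \<Rightarrow> (case y of None \<Rightarrow> x | Some b \<Rightarrow> Some (a \<cdot>\<^bsub>S\<^esub> b))),
     rstar = map_option (rstar S)\<rparr>"

definition rsgrp_hom :: "'a rsgrp \<Rightarrow> 'b rsgrp \<Rightarrow> ('a \<Rightarrow> 'b) set" where
  "rsgrp_hom S T = {h. h ` carrier S \<subseteq> carrier T \<and>
     (\<forall>x\<in>carrier S. \<forall>y\<in>carrier S. h (x \<cdot>\<^bsub>S\<^esub> y) = h x \<cdot>\<^bsub>T\<^esub> h y) \<and>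
     (\<forall>x\<in>carrier S. h (x\<star>\<^bsub>S\<^esub>) = (h x)\<star>\<^bsub>T\<^esub>)}"

definition rsgrp_iso :: "'a rsgrp \<Rightarrow> 'b rsgrp \<Rightarrow> ('a \<Rightarrow> 'b) set" where
  "rsgrp_iso S T = {h \<in> rsgrp_hom S T. bij_betw h (carrier S) (carrier T)}"

definition subalgebra :: "'a set \<Rightarrow> 'a rsgrp \<Rightarrow> bool" where
  "subalgebra A S \<longleftrightarrow> A \<subseteq> carrier S \<and>
     (\<forall>x\<in>A. \<forall>y\<in>A. x \<cdot>\<^bsub>S\<^esub> y \<in> A) \<and> (\<forall>x\<in>A. x\<star>\<^bsub>S\<^esub> \<in> A)"


section \<open>Boolean restriction semigroups\<close>

locale generalized_boolean_algebra = Lattice.lattice L for L (structure) +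
  assumes bottom_exists: "\<exists>b. least L b (carrier L)"
    and distributive:
      "\<lbrakk>x \<in> carrier L; y \<in> carrier L; z \<in> carrier L\<rbrakk>
        \<Longrightarrow> x \<sqinter> (y \<squnion> z) = (x \<sqinter> y) \<squnion> (x \<sqinter> z)"
    and relatively_complemented:
      "\<lbrakk>a \<in> carrier L; x \<in> carrier L; b \<in> carrier L; a \<sqsubseteq> x; x \<sqsubseteq> b\<rbrakk>
        \<Longrightarrow> \<exists>y\<in>carrier L. x \<sqinter> y = a \<and> x \<squnion> y = b"

text \<open>Ideals are closed under all finite joins; the empty join is the bottom element.\<close>

definition order_ideal :: "'a gorder \<Rightarrow> 'a set \<Rightarrow> bool" where
  "order_ideal L I \<longleftrightarrow> I \<subseteq> carrier L \<and> \<bottom>\<^bsub>L\<^esub> \<in> I \<and>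
     (\<forall>x\<in>I. \<forall>y\<in>carrier L. y \<sqsubseteq>\<^bsub>L\<^esub> x \<longrightarrow> y \<in> I) \<and>
     (\<forall>x\<in>I. \<forall>y\<in>I. x \<squnion>\<^bsub>L\<^esub> y \<in> I)"

definition ideal_generated :: "'a gorder \<Rightarrow> 'a set \<Rightarrow> 'a set" where
  "ideal_generated L A = \<Inter>{I. order_ideal L I \<and> A \<subseteq> I}"

definition nondegenerate :: "'a set \<Rightarrow> 'b gorder \<Rightarrow> ('a \<Rightarrow> 'b) \<Rightarrow> bool" where
  "nondegenerate E L f \<longleftrightarrow> ideal_generated L (f ` E) = carrier L"

definition gba_hom :: "'a gorder \<Rightarrow> 'b gorder \<Rightarrow> ('a \<Rightarrow> 'b) set" where
  "gba_hom K L = {f. f ` carrier K \<subseteq> carrier L \<and> f \<bottom>\<^bsub>K\<^esub> = \<bottom>\<^bsub>L\<^esub> \<and>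
     (\<forall>x\<in>carrier K. \<forall>y\<in>carrier K.
        f (x \<sqinter>\<^bsub>K\<^esub> y) = f x \<sqinter>\<^bsub>L\<^esub> f y \<and> f (x \<squnion>\<^bsub>K\<^esub> y) = f x \<squnion>\<^bsub>L\<^esub> f y) \<and>
     nondegenerate (carrier K) L f}"

definition compatible :: "'a rsgrp \<Rightarrow> 'a \<Rightarrow> 'a \<Rightarrow> bool" where
  "compatible S s t \<longleftrightarrow> s \<cdot>\<^bsub>S\<^esub> t\<star>\<^bsub>S\<^esub> = t \<cdot>\<^bsub>S\<^esub> s\<star>\<^bsub>S\<^esub>"

definition is_join :: "'a rsgrp \<Rightarrow> 'a \<Rightarrow> 'a \<Rightarrow> 'a \<Rightarrow> bool" where
  "is_join S s t j \<longleftrightarrow> least (natural_order S) j (Upper (natural_order S) {s, t})"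

locale boolean_restriction_semigroup = restriction_semigroup S for S :: "'a rsgrp" (structure) +
  assumes zero_exists: "\<exists>z\<in>projections S. \<forall>s\<in>carrier S. z \<cdot> s = z \<and> s \<cdot> z = z"
    and join_exists:
      "\<lbrakk>s \<in> carrier S; t \<in> carrier S; compatible S s t\<rbrakk> \<Longrightarrow> \<exists>j. is_join S s t j"
    and projections_gba: "generalized_boolean_algebra (projection_order S)"
    and join_mult:
      "\<lbrakk>s \<in> carrier S; t \<in> carrier S; u \<in> carrier S; is_join S s t j\<rbrakk>
        \<Longrightarrow> is_join S (s \<cdot> u) (t \<cdot> u) (j \<cdot> u)"

definition boolean_rsgrp_hom :: "'a rsgrp \<Rightarrow> 'b rsgrp \<Rightarrow> ('a \<Rightarrow> 'b) set" where
  "boolean_rsgrp_hom S T = rsgrp_hom S T \<inter> gba_hom (projection_order S) (projection_order T)"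


section \<open>Topological categories\<close>

text \<open>A small category is given by its arrows only, the objects being identified with the identity
  arrows \<open>units\<close>; \<open>ccomp x y\<close> is meaningful only if \<open>rmap y = dmap x\<close>.\<close>

record 'c top_category =
  arrows :: "'c set"
  units :: "'c set"
  dmap :: "'c \<Rightarrow> 'c"
  rmap :: "'c \<Rightarrow> 'c"
  ccomp :: "'c \<Rightarrow> 'c \<Rightarrow> 'c"
  ctop :: "'c topology"

locale small_category =
  fixes C :: "'c top_category"
  assumes units_subset: "units C \<subseteq> arrows C"
    and dmap_closed: "x \<in> arrows C \<Longrightarrow> dmap C x \<in> units C"
    and rmap_closed: "x \<in> arrows C \<Longrightarrow> rmap C x \<in> units C"
    and dmap_unit: "e \<in> units C \<Longrightarrow> dmap C e = e"
    and rmap_unit: "e \<in> units C \<Longrightarrow> rmap C e = e"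
    and comp_closed:
      "\<lbrakk>x \<in> arrows C; y \<in> arrows C; rmap C y = dmap C x\<rbrakk> \<Longrightarrow> ccomp C x y \<in> arrows C"
    and dmap_comp:
      "\<lbrakk>x \<in> arrows C; y \<in> arrows C; rmap C y = dmap C x\<rbrakk> \<Longrightarrow> dmap C (ccomp C x y) = dmap C y"
    and rmap_comp:
      "\<lbrakk>x \<in> arrows C; y \<in> arrows C; rmap C y = dmap C x\<rbrakk> \<Longrightarrow> rmap C (ccomp C x y) = rmap C x"
    and comp_assoc:
      "\<lbrakk>x \<in> arrows C; y \<in> arrows C; z \<in> arrows C; rmap C y = dmap C x; rmap C z = dmap C y\<rbrakk>
        \<Longrightarrow> ccomp C (ccomp C x y) z = ccomp C x (ccomp C y z)"
    and comp_dmap: "x \<in> arrows C \<Longrightarrow> ccomp C x (dmap C x) = x"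
    and rmap_comp_left: "x \<in> arrows C \<Longrightarrow> ccomp C (rmap C x) x = x"

definition unit_space :: "'c top_category \<Rightarrow> 'c topology" where
  "unit_space C = subtopology (ctop C) (units C)"

definition composable :: "'c top_category \<Rightarrow> ('c \<times> 'c) set" where
  "composable C = {(x, y). x \<in> arrows C \<and> y \<in> arrows C \<and> rmap C y = dmap C x}"

locale topological_category = small_category C for C :: "'c top_category" +
  assumes topspace_arrows: "topspace (ctop C) = arrows C"
    and continuous_dmap: "continuous_map (ctop C) (unit_space C) (dmap C)"
    and continuous_rmap: "continuous_map (ctop C) (unit_space C) (rmap C)"
    and continuous_comp:
      "continuous_map (subtopology (prod_topology (ctop C) (ctop C)) (composable C)) (ctop C)
         (\<lambda>(x, y). ccomp C x y)"

definition local_homeomorphism :: "'x topology \<Rightarrow> 'y topology \<Rightarrow> ('x \<Rightarrow> 'y) \<Rightarrow> bool" where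
  "local_homeomorphism X Y f \<longleftrightarrow>
     (\<forall>x\<in>topspace X. \<exists>U. openin X U \<and> x \<in> U \<and> openin Y (f ` U) \<and>
        homeomorphic_map (subtopology X U) (subtopology Y (f ` U)) f)"

locale etale_category = topological_category C for C :: "'c top_category" +
  assumes locally_compact_units: "locally_compact_space (unit_space C)"
    and Hausdorff_units: "Hausdorff_space (unit_space C)"
    and dmap_local_homeomorphism:
      "local_homeomorphism (ctop C) (subtopology (unit_space C) (dmap C ` arrows C)) (dmap C)"

definition slice :: "'c top_category \<Rightarrow> 'c set \<Rightarrow> bool" where
  "slice C U \<longleftrightarrow> openin (ctop C) U \<and> openin (unit_space C) (dmap C ` U) \<and>
     homeomorphic_map (subtopology (ctop C) U) (subtopology (unit_space C) (dmap C ` U)) (dmap C)"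

definition compact_slice :: "'c top_category \<Rightarrow> 'c set \<Rightarrow> bool" where
  "compact_slice C U \<longleftrightarrow> slice C U \<and> compactin (ctop C) U"

locale ample_category = etale_category C for C :: "'c top_category" +
  assumes compact_slice_base: "openin (ctop C) = arbitrary union_of (compact_slice C)"

definition compact_slices :: "'c top_category \<Rightarrow> 'c set rsgrp" where
  "compact_slices C =
    \<lparr>carrier = {U. compact_slice C U},
     rmult = (\<lambda>U V. {ccomp C x y | x y. x \<in> U \<and> y \<in> V \<and> rmap C y = dmap C x}),
     rstar = (\<lambda>U. dmap C ` U)\<rparr>"


section \<open>Actions and categories of germs\<close>

definition partial_maps :: "'x topology \<Rightarrow> ('x \<rightharpoonup> 'x) rsgrp" where
  "partial_maps X =
    \<lparr>carrier = {f. openin X (dom f) \<and>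
       continuous_map (subtopology X (dom f)) X (\<lambda>x. the (f x))},
     rmult = (\<lambda>f g. f \<circ>\<^sub>m g),
     rstar = (\<lambda>f. Some |` dom f)\<rparr>"

locale rsgrp_action = restriction_semigroup S for S :: "'a rsgrp" (structure) +
  fixes X :: "'x topology" and \<theta> :: "'a \<Rightarrow> ('x \<rightharpoonup> 'x)"
  assumes locally_compact: "locally_compact_space X"
    and Hausdorff: "Hausdorff_space X"
    and action_hom: "\<theta> \<in> rsgrp_hom S (partial_maps X)"
    and action_nondegenerate: "(\<Union>e\<in>projections S. dom (\<theta> e)) = topspace X"

definition germ_domain :: "'a rsgrp \<Rightarrow> 'x topology \<Rightarrow> ('a \<Rightarrow> ('x \<rightharpoonup> 'x)) \<Rightarrow> ('a \<times> 'x) set" where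
  "germ_domain S X \<theta> = {(s, x). s \<in> carrier S \<and> x \<in> topspace X \<and> x \<in> dom (\<theta> (s\<star>\<^bsub>S\<^esub>))}"

definition germ_rel ::
  "'a rsgrp \<Rightarrow> 'x topology \<Rightarrow> ('a \<Rightarrow> ('x \<rightharpoonup> 'x)) \<Rightarrow> (('a \<times> 'x) \<times> ('a \<times> 'x)) set" where
  "germ_rel S X \<theta> = {((s, x), (t, y)).
     (s, x) \<in> germ_domain S X \<theta> \<and> (t, y) \<in> germ_domain S X \<theta> \<and> x = y \<and>
     (\<exists>u\<in>carrier S. u \<sqsubseteq>\<^bsub>natural_order S\<^esub> s \<and> u \<sqsubseteq>\<^bsub>natural_order S\<^esub> t \<and> x \<in> dom (\<theta> (u\<star>\<^bsub>S\<^esub>)))}"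

definition germ ::
  "'a rsgrp \<Rightarrow> 'x topology \<Rightarrow> ('a \<Rightarrow> ('x \<rightharpoonup> 'x)) \<Rightarrow> 'a \<Rightarrow> 'x \<Rightarrow> ('a \<times> 'x) set" where
  "germ S X \<theta> s x = germ_rel S X \<theta> `` {(s, x)}"

text \<open>The structure maps are defined on equivalence classes as unions over all representatives,
  as usual for quotients: all sets in such a union coincide. In \<open>dmap\<close>, for example, every
  representative \<open>(s, x)\<close> of \<open>g\<close> yields the same class \<open>[s\<star>, x]\<close>.\<close>

definition germ_category ::
  "'a rsgrp \<Rightarrow> 'x topology \<Rightarrow> ('a \<Rightarrow> ('x \<rightharpoonup> 'x)) \<Rightarrow> ('a \<times> 'x) set top_category" where
  "germ_category S X \<theta> =
    \<lparr>arrows = germ_domain S X \<theta> // germ_rel S X \<theta>,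
     units = {germ S X \<theta> e x | e x. e \<in> projections S \<and> x \<in> dom (\<theta> e)},
     dmap = (\<lambda>g. \<Union>(s, x)\<in>g. germ S X \<theta> (s\<star>\<^bsub>S\<^esub>) x),
     rmap = (\<lambda>g. \<Union>{germ S X \<theta> e y | s x e y.
               (s, x) \<in> g \<and> \<theta> s x = Some y \<and> e \<in> projections S \<and> y \<in> dom (\<theta> e)}),
     ccomp = (\<lambda>g h. \<Union>{germ S X \<theta> (s \<cdot>\<^bsub>S\<^esub> t) y | s t y z.
               (s, z) \<in> g \<and> (t, y) \<in> h \<and> \<theta> t y = Some z}),
     ctop = topology (arbitrary union_of (\<lambda>W. \<exists>s\<in>carrier S. \<exists>U.
               openin X U \<and> U \<subseteq> dom (\<theta> (s\<star>\<^bsub>S\<^esub>)) \<and> W = germ S X \<theta> s ` U))\<rparr>"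


section \<open>The character space of a semilattice\<close>

text \<open>A semilattice is given by its carrier \<open>E\<close> and meet operation \<open>m\<close>. The two-element semilattice
  is \<^typ>\<open>bool\<close> with conjunction; characters are normalised to be \<^const>\<open>False\<close> outside \<open>E\<close>.\<close>

definition characters :: "'a set \<Rightarrow> ('a \<Rightarrow> 'a \<Rightarrow> 'a) \<Rightarrow> ('a \<Rightarrow> bool) set" where
  "characters E m = {\<phi>. (\<forall>e. e \<notin> E \<longrightarrow> \<not> \<phi> e) \<and>
     (\<forall>e\<in>E. \<forall>f\<in>E. \<phi> (m e f) \<longleftrightarrow> \<phi> e \<and> \<phi> f) \<and> (\<exists>e\<in>E. \<phi> e)}"

definition char_set :: "'a set \<Rightarrow> ('a \<Rightarrow> 'a \<Rightarrow> 'a) \<Rightarrow> 'a \<Rightarrow> ('a \<Rightarrow> bool) set" where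
  "char_set E m e = {\<phi> \<in> characters E m. \<phi> e}"

text \<open>In the base below, \<open>F = {}\<close> gives the sets \<open>D\<^sub>e\<close> themselves.\<close>

definition char_topology :: "'a set \<Rightarrow> ('a \<Rightarrow> 'a \<Rightarrow> 'a) \<Rightarrow> ('a \<Rightarrow> bool) topology" where
  "char_topology E m = topology (arbitrary union_of (\<lambda>W. \<exists>e\<in>E. \<exists>F.
     finite F \<and> F \<subseteq> {f \<in> E. f = m f e} \<and> W = char_set E m e - (\<Union>f\<in>F. char_set E m f)))"

definition projection_space :: "'a rsgrp \<Rightarrow> ('a \<Rightarrow> bool) topology" where
  "projection_space S = char_topology (projections S) (rmult S)"

definition projection_char_set :: "'a rsgrp \<Rightarrow> 'a \<Rightarrow> ('a \<Rightarrow> bool) set" where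
  "projection_char_set S e = char_set (projections S) (rmult S) e"

definition char_action :: "'a rsgrp \<Rightarrow> 'a \<Rightarrow> (('a \<Rightarrow> bool) \<rightharpoonup> ('a \<Rightarrow> bool))" where
  "char_action S s = (\<lambda>\<phi>. if \<phi> \<in> projection_char_set S (s\<star>\<^bsub>S\<^esub>)
     then Some (\<lambda>e. e \<in> projections S \<and> \<phi> ((e \<cdot>\<^bsub>S\<^esub> s)\<star>\<^bsub>S\<^esub>)) else None)"

definition char_category :: "'a rsgrp \<Rightarrow> ('a \<times> ('a \<Rightarrow> bool)) set top_category" where
  "char_category S = germ_category S (projection_space S) (char_action S)"

definition slice_embedding :: "'a rsgrp \<Rightarrow> 'a \<Rightarrow> ('a \<times> ('a \<Rightarrow> bool)) set set" where
  "slice_embedding S s =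
     germ S (projection_space S) (char_action S) s ` projection_char_set S (s\<star>\<^bsub>S\<^esub>)"

end

theory Submission
  imports Defs
begin

text \<open>
  The category of germs is etale because the germ topology is the final topology for the maps
  \<open>x \<mapsto> [s, x]\<close>; for the character space it is ample because the basic sets \<open>D\<^sub>e\<close> are compact by
  Tychonoff. Injectivity of the embedding is seen at the principal character of \<open>s\<star>\<close>.

  For the universal property, elements of \<open>T\<close> are compared through their germs at the prime
  characters \<open>\<omega>\<close> of \<open>P(T)\<close>, which separate elements by the prime ideal theorem. A compact slice \<open>U\<close>
  is sent to the unique element of \<open>T\<close> whose germ at each \<open>\<omega>\<close> is that of \<open>\<alpha> s\<close> if \<open>[s, \<omega> \<circ> \<alpha>] \<in> U\<close>, and
  which is zero at \<open>\<omega>\<close> if there is no such \<open>s\<close>. Such an element exists for basic slices by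
  relative complements, and in general by compactness and joins of compatible elements; since the
  characterisation is pointwise, compatibility with the operations is checked germ by germ.
\<close>

section \<open>Restriction semigroups and their projections\<close>

text \<open>Defining \<psi> by a formula on basic slices would meet an obstacle: a compact slice
  splits into basic ones in many ways, and independence of the splitting would have to be checked.
  Prescribing the value by its germs makes it unique in advance, so that a splitting is chosen only
  for existence. On the side of S all characters serve as points, since P(S) is merely a
  semilattice; on the side of T they are prime, so that a join is non-zero at
  \<open>\<omega>\<close> exactly when one of its parts is. Non-degeneracy of
  \<open>\<alpha>\<close> guarantees that \<open>\<omega> \<circ> \<alpha>\<close> is not the zero
  map, hence a point of the character space. Multiplication is the operation that moves the base
  point: the left factor is read at the translate of \<open>\<omega>\<close> by the right factor,
  again a prime character because T has local units and joins distribute over right multiplication.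
  Distributivity over left multiplication is not an axiom; it is derived by comparing stars, and it
  makes the projections on which two elements agree an ideal.\<close>

context restriction_semigroup
begin

lemma star_mult_self: "x \<in> carrier S \<Longrightarrow> x\<star> \<cdot> x\<star> = x\<star>"
  by (metis mult_star star_closed star_mult star_mult_star)

lemma star_star: "x \<in> carrier S \<Longrightarrow> (x\<star>)\<star> = x\<star>"
  by (metis star_mult_self star_mult_star)

lemma projection_closed: "e \<in> projections S \<Longrightarrow> e \<in> carrier S"
  by (auto simp: projections_def star_closed)

lemma projection_star: "e \<in> projections S \<Longrightarrow> e\<star> = e"
  by (auto simp: projections_def star_star)

lemma star_projection: "x \<in> carrier S \<Longrightarrow> x\<star> \<in> projections S"
  by (auto simp: projections_def)

lemma projection_mult_closed: "\<lbrakk>e \<in> projections S; f \<in> projections S\<rbrakk> \<Longrightarrow> e \<cdot> f \<in> projections S"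
  by (metis mult_closed projection_closed projection_star star_mult_star star_projection)

lemma projection_idem: "e \<in> projections S \<Longrightarrow> e \<cdot> e = e"
  by (metis projection_closed projection_star mult_star)

lemma projection_commute: "\<lbrakk>e \<in> projections S; f \<in> projections S\<rbrakk> \<Longrightarrow> e \<cdot> f = f \<cdot> e"
  by (metis projection_closed projection_star star_commute)

lemma projection_left_commute:
  "\<lbrakk>e \<in> projections S; f \<in> projections S; g \<in> projections S\<rbrakk> \<Longrightarrow> e \<cdot> (f \<cdot> g) = f \<cdot> (e \<cdot> g)"
  by (metis mult_assoc projection_closed projection_commute)

lemma projection_left_idem:
  "\<lbrakk>e \<in> projections S; f \<in> projections S\<rbrakk> \<Longrightarrow> e \<cdot> (e \<cdot> f) = e \<cdot> f"
  by (metis mult_assoc projection_closed projection_idem)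

lemma projection_assoc:
  "\<lbrakk>e \<in> projections S; f \<in> projections S; g \<in> projections S\<rbrakk> \<Longrightarrow> e \<cdot> f \<cdot> g = e \<cdot> (f \<cdot> g)"
  by (simp add: mult_assoc projection_closed)

lemmas projection_aci = projection_assoc projection_commute projection_left_commute
  projection_idem projection_left_idem projection_mult_closed

lemma star_mult_projection:
  "\<lbrakk>x \<in> carrier S; e \<in> projections S\<rbrakk> \<Longrightarrow> (x \<cdot> e)\<star> = x\<star> \<cdot> e"
  by (metis projection_closed projection_star star_mult star_mult_star)

lemma star_mult_le: "\<lbrakk>x \<in> carrier S; y \<in> carrier S\<rbrakk> \<Longrightarrow> (x \<cdot> y)\<star> \<cdot> y\<star> = (x \<cdot> y)\<star>"
  by (metis mult_assoc mult_closed mult_star star_closed star_mult_projection star_projection)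

lemma projection_mult_shift:
  "\<lbrakk>e \<in> projections S; y \<in> carrier S\<rbrakk> \<Longrightarrow> e \<cdot> y = y \<cdot> (e \<cdot> y)\<star>"
  by (metis projection_closed projection_star star_ample)

text \<open>The ample identity inside a product: a projection to the left of y reappears to its
  right as \<open>(e \<cdot> y)\<star>\<close>. It drives the multiplicativity of characters, the
  product of germs and the product of represented elements.\<close>

lemma mult_projection_left_shift:
  "\<lbrakk>x \<in> carrier S; e \<in> projections S; y \<in> carrier S\<rbrakk> \<Longrightarrow> x \<cdot> y \<cdot> (e \<cdot> y)\<star> = x \<cdot> e \<cdot> y"
  by (metis mult_assoc mult_closed projection_closed projection_mult_shift star_closed)

lemma star_mult_in: "\<lbrakk>e \<in> projections S; s \<in> carrier S\<rbrakk> \<Longrightarrow> (e \<cdot> s)\<star> \<in> projections S"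
  by (simp add: mult_closed projection_closed star_projection)

text \<open>This is what makes the translate of a character along s multiplicative again.\<close>

lemma star_mult_mult:
  assumes "e \<in> projections S" "f \<in> projections S" "s \<in> carrier S"
  shows "(e \<cdot> f \<cdot> s)\<star> = (e \<cdot> s)\<star> \<cdot> (f \<cdot> s)\<star>"
proof -
  have "(e \<cdot> f \<cdot> s)\<star> = (e \<cdot> s \<cdot> (f \<cdot> s)\<star>)\<star>"
    using assms by (simp add: mult_projection_left_shift projection_closed)
  also have "\<dots> = (e \<cdot> s)\<star> \<cdot> (f \<cdot> s)\<star>"
    using assms by (intro star_mult_projection) (auto intro: mult_closed projection_closed star_mult_in)
  finally show ?thesis .
qed

section \<open>Natural partial order and its joins\<close>

lemma natural_order_simps:
  "carrier (natural_order S) = carrier S" "le (natural_order S) s t \<longleftrightarrow> s = t \<cdot> s\<star>"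
  by (simp_all add: natural_order_def)

text \<open>Frees the order from its canonical witness: cutting t by any projection e gives an
  element below t, because \<open>s\<star> = t\<star> \<cdot> e\<close>.\<close>

lemma natural_orderI:
  "\<lbrakk>t \<in> carrier S; e \<in> projections S; s = t \<cdot> e\<rbrakk> \<Longrightarrow> s = t \<cdot> s\<star>"
  by (metis mult_assoc mult_star projection_closed star_closed star_mult_projection)

lemma natural_order_antisym:
  assumes "s \<in> carrier S" "t \<in> carrier S" "s = t \<cdot> s\<star>" "t = s \<cdot> t\<star>"
  shows "s = t"
proof -
  have "t \<cdot> s\<star> = s \<cdot> t\<star> \<cdot> s\<star>" using assms by simp
  also have "\<dots> = s \<cdot> (s\<star> \<cdot> t\<star>)"
    using assms(1,2) by (simp add: mult_assoc star_closed star_commute)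
  also have "\<dots> = s \<cdot> t\<star>"
    using assms(1,2) by (metis mult_assoc mult_star star_closed)
  finally show ?thesis using assms by simp
qed

lemma natural_order_star:
  "\<lbrakk>s \<in> carrier S; t \<in> carrier S; s = t \<cdot> s\<star>\<rbrakk> \<Longrightarrow> s\<star> = s\<star> \<cdot> t\<star>"
  by (metis star_commute star_mult_projection star_projection)

lemma is_join_iff:
  assumes "s \<in> carrier S" "t \<in> carrier S"
  shows "is_join S s t j \<longleftrightarrow> j \<in> carrier S \<and> s = j \<cdot> s\<star> \<and> t = j \<cdot> t\<star> \<and>
    (\<forall>k\<in>carrier S. s = k \<cdot> s\<star> \<and> t = k \<cdot> t\<star> \<longrightarrow> j = k \<cdot> j\<star>)"
  using assms by (auto simp: is_join_def least_def Upper_def natural_order_simps)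

lemma is_join_unique:
  "\<lbrakk>s \<in> carrier S; t \<in> carrier S; is_join S s t j; is_join S s t k\<rbrakk> \<Longrightarrow> j = k"
  using natural_order_antisym[of j k] by (simp add: is_join_iff)

end

lemma projection_order_simps [simp]:
  "carrier (projection_order S) = projections S"
  "le (projection_order S) e f \<longleftrightarrow> e = e \<cdot>\<^bsub>S\<^esub> f"
  "eq (projection_order S) = (=)"
  by (simp_all add: projection_order_def)

lemma rsgrp_homD:
  assumes "h \<in> rsgrp_hom S T"
  shows "x \<in> carrier S \<Longrightarrow> h x \<in> carrier T"
    and "\<lbrakk>x \<in> carrier S; y \<in> carrier S\<rbrakk> \<Longrightarrow> h (x \<cdot>\<^bsub>S\<^esub> y) = h x \<cdot>\<^bsub>T\<^esub> h y"
    and "x \<in> carrier S \<Longrightarrow> h (x\<star>\<^bsub>S\<^esub>) = (h x)\<star>\<^bsub>T\<^esub>"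
  using assms by (auto simp: rsgrp_hom_def)

section \<open>Prime ideals in generalized Boolean algebras\<close>

text \<open>\<^const>\<open>order_ideal\<close> is not polymorphic in the record extension, hence this instance.\<close>

locale gba = generalized_boolean_algebra L for L :: "'a gorder" (structure)
begin

lemma bottom_least: "least L \<bottom> (carrier L)"
  unfolding bottom_def using bottom_exists by (rule someI_ex)

lemma order_ideal_Union:
  assumes "\<C> \<noteq> {}" "subset.chain {I. order_ideal L I} \<C>"
  shows "order_ideal L (\<Union>\<C>)"
proof -
  have I: "order_ideal L I" if "I \<in> \<C>" for I using assms(2) that by (auto simp: subset.chain_def)
  have lin: "X \<subseteq> Y \<or> Y \<subseteq> X" if "X \<in> \<C>" "Y \<in> \<C>" for X Y
    using assms(2) that by (simp add: subset_chain_def)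
  have "x \<squnion> y \<in> \<Union>\<C>" if x: "x \<in> X" "X \<in> \<C>" and y: "y \<in> Y" "Y \<in> \<C>" for x y X Y
    using lin[OF x(2) y(2)]
  proof
    assume "X \<subseteq> Y"
    then have "x \<squnion> y \<in> Y" using I[OF y(2)] x y by (auto simp: order_ideal_def)
    then show ?thesis using y by blast
  next
    assume "Y \<subseteq> X"
    then have "x \<squnion> y \<in> X" using I[OF x(2)] x y by (auto simp: order_ideal_def)
    then show ?thesis using x by blast
  qed
  moreover have "\<bottom> \<in> \<Union>\<C>" using assms(1) I by (auto simp: order_ideal_def)
  moreover have "\<Union>\<C> \<subseteq> carrier L"
    using I by (intro Union_least) (simp add: order_ideal_def)
  moreover have "y \<in> \<Union>\<C>" if "x \<in> \<Union>\<C>" "y \<in> carrier L" "y \<sqsubseteq> x" for x y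
    using that I unfolding order_ideal_def by (metis Union_iff)
  ultimately show ?thesis by (simp add: order_ideal_def)
qed

text \<open>Explicit form of the ideal generated by M and one further element; it supplies the
  enlargement to which maximality is applied in the prime ideal theorem.\<close>

lemma order_ideal_adjoin:
  assumes "order_ideal L M" and e: "e \<in> carrier L"
  shows "order_ideal L {x \<in> carrier L. \<exists>i\<in>M. x \<sqsubseteq> i \<squnion> e}"
proof -
  have M: "M \<subseteq> carrier L" "\<bottom> \<in> M" "\<And>x y. \<lbrakk>x \<in> M; y \<in> M\<rbrakk> \<Longrightarrow> x \<squnion> y \<in> M"
    using assms by (auto simp: order_ideal_def)
  have bot: "\<bottom> \<in> carrier L" "\<And>x. x \<in> carrier L \<Longrightarrow> \<bottom> \<sqsubseteq> x"
    using bottom_least by (auto simp: least_def)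
  have "\<exists>i\<in>M. x \<squnion> y \<sqsubseteq> i \<squnion> e"
    if "x \<in> carrier L" "i \<in> M" "x \<sqsubseteq> i \<squnion> e" "y \<in> carrier L" "j \<in> M" "y \<sqsubseteq> j \<squnion> e" for x y i j
  proof -
    have c: "i \<in> carrier L" "j \<in> carrier L" using that M by auto
    have "i \<sqsubseteq> i \<squnion> j \<squnion> e" "j \<sqsubseteq> i \<squnion> j \<squnion> e" "e \<sqsubseteq> i \<squnion> j \<squnion> e"
      using c e by (meson join_closed join_left join_right le_trans)+
    then have "i \<squnion> e \<sqsubseteq> i \<squnion> j \<squnion> e" "j \<squnion> e \<sqsubseteq> i \<squnion> j \<squnion> e"
      using c e by (simp_all add: join_le)
    then have "x \<sqsubseteq> i \<squnion> j \<squnion> e" "y \<sqsubseteq> i \<squnion> j \<squnion> e"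
      using that c e by (meson join_closed le_trans)+
    then have "x \<squnion> y \<sqsubseteq> i \<squnion> j \<squnion> e" using that c e by (simp add: join_le)
    then show ?thesis using M(3) that by blast
  qed
  moreover have "\<exists>i\<in>M. y \<sqsubseteq> i \<squnion> e"
    if "x \<in> carrier L" "i \<in> M" "x \<sqsubseteq> i \<squnion> e" "y \<in> carrier L" "y \<sqsubseteq> x" for x y i
    using that M e by (meson join_closed le_trans subsetD)
  moreover have "\<exists>i\<in>M. \<bottom> \<sqsubseteq> i \<squnion> e"
    using M(2) bot e by (auto intro!: bexI[of _ \<bottom>])
  ultimately show ?thesis unfolding order_ideal_def
    using bot(1) by (intro conjI ballI impI) (auto simp: join_closed)
qed

text \<open>An ideal maximal among those that contain I and avoid m is prime: if x and y were both
  outside it, m would lie below \<open>i \<squnion> x\<close> and \<open>j \<squnion> y\<close> with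
  i, j inside, and distributivity would put m below an element of the ideal.\<close>

lemma prime_ideal_separation:
  assumes I: "order_ideal L I" and m: "m \<in> carrier L" "m \<notin> I"
  obtains M where "order_ideal L M" "I \<subseteq> M" "m \<notin> M"
    and "\<And>x y. \<lbrakk>x \<in> carrier L; y \<in> carrier L; x \<sqinter> y \<in> M\<rbrakk> \<Longrightarrow> x \<in> M \<or> y \<in> M"
proof -
  let ?A = "{J. order_ideal L J \<and> I \<subseteq> J \<and> m \<notin> J}"
  have "\<exists>M\<in>?A. \<forall>X\<in>?A. M \<subseteq> X \<longrightarrow> X = M"
  proof (rule subset_Zorn_nonempty)
    show "?A \<noteq> {}" using I m by blast
  next
    fix \<C> assume C: "\<C> \<noteq> {}" "subset.chain ?A \<C>"
    then have "subset.chain {J. order_ideal L J} \<C>" by (auto simp: subset.chain_def)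
    with C(1) have "order_ideal L (\<Union>\<C>)" by (rule order_ideal_Union)
    then show "\<Union>\<C> \<in> ?A" using C by (auto simp: subset.chain_def)
  qed
  then obtain M where M: "order_ideal L M" "I \<subseteq> M" "m \<notin> M"
    and max: "\<And>J. \<lbrakk>order_ideal L J; I \<subseteq> J; m \<notin> J; M \<subseteq> J\<rbrakk> \<Longrightarrow> J = M"
    by auto
  have Mc: "M \<subseteq> carrier L" using M(1) by (simp add: order_ideal_def)
  \<comment> \<open>By maximality, adjoining an element outside M must capture m.\<close>
  have above: "\<exists>i\<in>M. m \<sqsubseteq> i \<squnion> e" if e: "e \<in> carrier L" "e \<notin> M" for e
  proof (rule ccontr)
    let ?J = "{x \<in> carrier L. \<exists>i\<in>M. x \<sqsubseteq> i \<squnion> e}"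
    assume "\<not> (\<exists>i\<in>M. m \<sqsubseteq> i \<squnion> e)"
    moreover have sub: "M \<subseteq> ?J" using Mc e by (auto intro!: bexI join_left)
    ultimately have "?J = M"
      using order_ideal_adjoin[OF M(1) e(1)] M(2) by (intro max) auto
    moreover have "e \<in> ?J"
      using M(1) Mc e by (auto intro!: bexI[of _ \<bottom>] join_right simp: order_ideal_def)
    ultimately show False using e by blast
  qed
  have "x \<in> M \<or> y \<in> M" if xy: "x \<in> carrier L" "y \<in> carrier L" "x \<sqinter> y \<in> M" for x y
  proof (rule ccontr)
    assume "\<not> (x \<in> M \<or> y \<in> M)"
    with above xy obtain i j where i: "i \<in> M" "m \<sqsubseteq> i \<squnion> x" and j: "j \<in> M" "m \<sqsubseteq> j \<squnion> y" by meson
    have ij: "i \<in> carrier L" "j \<in> carrier L" using i j Mc by auto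
    \<comment> \<open>One ideal element serving both bounds, so that
      \<open>(k \<squnion> x) \<sqinter> (k \<squnion> y)\<close> can be estimated by
      \<open>k \<squnion> (x \<sqinter> y)\<close>.\<close>
    define k where "k = i \<squnion> j"
    have k: "k \<in> M" "k \<in> carrier L"
      using i j M(1) ij by (auto simp: k_def order_ideal_def)
    have "i \<sqsubseteq> k \<squnion> x" "x \<sqsubseteq> k \<squnion> x" "j \<sqsubseteq> k \<squnion> y" "y \<sqsubseteq> k \<squnion> y"
      unfolding k_def using ij xy by (meson join_closed join_left join_right le_trans)+
    then have "i \<squnion> x \<sqsubseteq> k \<squnion> x" "j \<squnion> y \<sqsubseteq> k \<squnion> y"
      using ij k xy by (simp_all add: join_le)
    then have "m \<sqsubseteq> k \<squnion> x" "m \<sqsubseteq> k \<squnion> y" using i j ij k xy m by (meson join_closed le_trans)+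
    then have 1: "m \<sqsubseteq> (k \<squnion> x) \<sqinter> (k \<squnion> y)" using k xy m by (simp add: meet_le)
    have "(k \<squnion> x) \<sqinter> (k \<squnion> y) = ((k \<squnion> x) \<sqinter> k) \<squnion> ((k \<squnion> x) \<sqinter> y)"
      using k xy by (simp add: distributive)
    also have "(k \<squnion> x) \<sqinter> y = (k \<sqinter> y) \<squnion> (x \<sqinter> y)"
      using k xy by (metis distributive join_closed meet_comm)
    finally have 2: "(k \<squnion> x) \<sqinter> (k \<squnion> y) = ((k \<squnion> x) \<sqinter> k) \<squnion> ((k \<sqinter> y) \<squnion> (x \<sqinter> y))" .
    have "(k \<squnion> x) \<sqinter> k \<sqsubseteq> k \<squnion> (x \<sqinter> y)" "k \<sqinter> y \<sqsubseteq> k \<squnion> (x \<sqinter> y)" "x \<sqinter> y \<sqsubseteq> k \<squnion> (x \<sqinter> y)"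
      using k xy by (meson join_closed join_left join_right le_trans meet_closed meet_left meet_right)+
    then have "(k \<squnion> x) \<sqinter> (k \<squnion> y) \<sqsubseteq> k \<squnion> (x \<sqinter> y)"
      unfolding 2 using k xy by (simp add: join_le)
    with 1 have "m \<sqsubseteq> k \<squnion> (x \<sqinter> y)" using m k xy by (meson join_closed le_trans meet_closed)
    moreover have "k \<squnion> (x \<sqinter> y) \<in> M" using k xy M(1) by (auto simp: order_ideal_def)
    ultimately show False using M m by (auto simp: order_ideal_def)
  qed
  with M show ?thesis using that by blast
qed

end

section \<open>Prime characters of Boolean restriction semigroups\<close>

text \<open>Indicator functions of prime filters, that is, the points of the Stone space of P(T).
  They are kept as a subset of the characters so that both sides of the universal property share one
  encoding of points.\<close>

definition prime_characters :: "'a rsgrp \<Rightarrow> ('a \<Rightarrow> bool) set" where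
  "prime_characters T = {\<omega> \<in> characters (projections T) (rmult T).
     \<not> \<omega> (\<bottom>\<^bsub>projection_order T\<^esub>) \<and>
     (\<forall>e\<in>projections T. \<forall>f\<in>projections T. \<omega> (e \<squnion>\<^bsub>projection_order T\<^esub> f) \<longrightarrow> \<omega> e \<or> \<omega> f)}"

lemma charactersD:
  assumes "\<phi> \<in> characters E m"
  shows "\<phi> e \<Longrightarrow> e \<in> E" and "\<lbrakk>e \<in> E; f \<in> E\<rbrakk> \<Longrightarrow> \<phi> (m e f) \<longleftrightarrow> \<phi> e \<and> \<phi> f"
    and "\<exists>e\<in>E. \<phi> e"
  using assms by (auto simp: characters_def)

context boolean_restriction_semigroup
begin

sublocale P: gba "projection_order S"
  using projections_gba by (rule gba.intro)

abbreviation zero ("\<zero>") where "zero \<equiv> \<bottom>\<^bsub>projection_order S\<^esub>"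
abbreviation pjoin (infixl "\<oplus>" 65) where "e \<oplus> f \<equiv> e \<squnion>\<^bsub>projection_order S\<^esub> f"

lemma zero_projection: "\<zero> \<in> projections S"
  using P.bottom_least by (auto simp: least_def)

text \<open>The absorbing projection z of \<open>zero_exists\<close> and the lattice bottom are the
  same element: the bottom lies below z, and z absorbs it.\<close>

lemma zero_mult:
  assumes "s \<in> carrier S"
  shows "\<zero> \<cdot> s = \<zero>" "s \<cdot> \<zero> = \<zero>"
proof -
  obtain z where z: "z \<in> projections S" "\<And>s. s \<in> carrier S \<Longrightarrow> z \<cdot> s = z \<and> s \<cdot> z = z"
    using zero_exists by blast
  have "\<zero> = \<zero> \<cdot> z" using P.bottom_least z(1) by (simp add: least_def)
  also have "\<dots> = z" using z(2) zero_projection projection_closed by blast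
  finally show "\<zero> \<cdot> s = \<zero>" "s \<cdot> \<zero> = \<zero>" using z(2)[OF assms] by auto
qed

lemma pjoin_closed: "\<lbrakk>e \<in> projections S; f \<in> projections S\<rbrakk> \<Longrightarrow> e \<oplus> f \<in> projections S"
  using P.join_closed by simp

lemma pjoin_upper:
  assumes "e \<in> projections S" "f \<in> projections S"
  shows "e \<cdot> (e \<oplus> f) = e" "f \<cdot> (e \<oplus> f) = f"
  using P.join_left[of e f] P.join_right[of e f] assms by simp_all

lemma pjoin_least:
  "\<lbrakk>e \<in> projections S; f \<in> projections S; g \<in> projections S; e = e \<cdot> g; f = f \<cdot> g\<rbrakk>
    \<Longrightarrow> e \<oplus> f = (e \<oplus> f) \<cdot> g"
  using P.join_le[of e g f] by simp

lemma projection_le_antisym: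
  "\<lbrakk>e \<in> projections S; f \<in> projections S; e = e \<cdot> f; f = f \<cdot> e\<rbrakk> \<Longrightarrow> e = f"
  by (metis projection_commute)

lemma pmeet_eq:
  assumes "e \<in> projections S" "f \<in> projections S"
  shows "e \<sqinter>\<^bsub>projection_order S\<^esub> f = e \<cdot> f"
proof (rule projection_le_antisym)
  let ?m = "e \<sqinter>\<^bsub>projection_order S\<^esub> f"
  show m: "?m \<in> projections S" "e \<cdot> f \<in> projections S"
    using P.meet_closed[of e f] assms by (simp_all add: projection_mult_closed)
  have "?m = ?m \<cdot> e" "?m = ?m \<cdot> f"
    using P.meet_left[of e f] P.meet_right[of e f] assms by simp_all
  then show "?m = ?m \<cdot> (e \<cdot> f)" using m assms by (metis projection_assoc)
  have "e \<cdot> f = e \<cdot> f \<cdot> e" "e \<cdot> f = e \<cdot> f \<cdot> f" using assms by (simp_all add: projection_aci)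
  then show "e \<cdot> f = e \<cdot> f \<cdot> ?m"
    using P.meet_le[of "e \<cdot> f" e f] assms m by simp
qed

lemma mult_pjoin_distrib:
  assumes "e \<in> projections S" "f \<in> projections S" "g \<in> projections S"
  shows "e \<cdot> (f \<oplus> g) = (e \<cdot> f) \<oplus> (e \<cdot> g)"
  using P.distributive[of e f g] assms by (simp add: pmeet_eq pjoin_closed)

text \<open>A join in the natural order of S could a priori fail to be a projection. As
  \<open>e \<oplus> f\<close> is an upper bound in S, the join lies below it, hence is a projection,
  and then the two joins bound each other.\<close>

lemma is_join_pjoin:
  assumes e: "e \<in> projections S" and f: "f \<in> projections S"
  shows "is_join S e f (e \<oplus> f)"
proof -
  have j: "e \<oplus> f \<in> projections S" using assms by (rule pjoin_closed)
  have "compatible S e f"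
    using assms by (simp add: compatible_def projection_star projection_commute)
  then obtain k where k: "is_join S e f k" using join_exists e f projection_closed by blast
  then have kc: "k \<in> carrier S" "e = k \<cdot> e\<star>" "f = k \<cdot> f\<star>"
    and least: "\<And>l. \<lbrakk>l \<in> carrier S; e = l \<cdot> e\<star>; f = l \<cdot> f\<star>\<rbrakk> \<Longrightarrow> k = l \<cdot> k\<star>"
    using e f by (simp_all add: is_join_iff projection_closed)
  have "k = (e \<oplus> f) \<cdot> k\<star>"
    using e f j pjoin_upper[OF e f]
    by (intro least) (simp_all add: projection_closed projection_star projection_commute[of "e \<oplus> f"])
  then have kp: "k \<in> projections S" and kj: "k = k \<cdot> (e \<oplus> f)"
    using kc(1) j by (metis projection_mult_closed star_projection,
      metis projection_commute projection_mult_closed projection_star star_projection)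
  have "e \<oplus> f = (e \<oplus> f) \<cdot> k"
    using kc e f kp by (intro pjoin_least) (simp_all add: projection_star projection_commute[of k])
  then show ?thesis using k kp kj j projection_le_antisym by metis
qed

text \<open>Cutting j by \<open>s\<star> \<oplus> t\<star>\<close> still gives an upper bound of s
  and t, so minimality of j forces \<open>j\<star>\<close> below that projection.\<close>

lemma is_join_star:
  assumes s: "s \<in> carrier S" and t: "t \<in> carrier S" and j: "is_join S s t j"
  shows "j\<star> = s\<star> \<oplus> t\<star>"
proof -
  let ?g = "s\<star> \<oplus> t\<star>"
  have p: "s\<star> \<in> projections S" "t\<star> \<in> projections S" using s t by (simp_all add: star_projection)
  have g: "?g \<in> projections S" "?g \<in> carrier S"
    using p by (simp_all add: pjoin_closed projection_closed)
  have jc: "j \<in> carrier S" "s = j \<cdot> s\<star>" "t = j \<cdot> t\<star>"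
    and least: "\<And>k. \<lbrakk>k \<in> carrier S; s = k \<cdot> s\<star>; t = k \<cdot> t\<star>\<rbrakk> \<Longrightarrow> j = k \<cdot> j\<star>"
    using j s t by (simp_all add: is_join_iff)
  have jp: "j\<star> \<in> projections S" using jc by (simp add: star_projection)
  have "s\<star> = s\<star> \<cdot> j\<star>" "t\<star> = t\<star> \<cdot> j\<star>" using jc s t natural_order_star by blast+
  then have 1: "?g = ?g \<cdot> j\<star>" using p jp by (intro pjoin_least)
  have "?g \<cdot> s\<star> = s\<star>" "?g \<cdot> t\<star> = t\<star>"
    using pjoin_upper[OF p] p g by (simp_all add: projection_commute[of ?g])
  then have "s = j \<cdot> ?g \<cdot> s\<star>" "t = j \<cdot> ?g \<cdot> t\<star>"
    using jc s t g by (simp_all add: mult_assoc star_closed)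
  then have "j = j \<cdot> ?g \<cdot> j\<star>" using g jc by (intro least) (simp_all add: mult_closed)
  then have "j\<star> = (j \<cdot> (?g \<cdot> j\<star>))\<star>" using g jc by (metis mult_assoc star_closed)
  also have "\<dots> = j\<star> \<cdot> (?g \<cdot> j\<star>)"
    using g jc jp by (intro star_mult_projection) (auto intro: projection_mult_closed)
  finally have "j\<star> = j\<star> \<cdot> ?g" using g jp by (simp add: projection_aci)
  with 1 show ?thesis using g jp projection_le_antisym by metis
qed

text \<open>The axiom covers only right multiplication. Here both products are restrictions of
  \<open>u \<cdot> j\<close>, hence compatible, and their join is a restriction of it too; computing
  its star by distributivity in P(S) shows that nothing has been cut off.\<close>

lemma is_join_mult_left:
  assumes s: "s \<in> carrier S" and t: "t \<in> carrier S" and j: "is_join S s t j"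
    and u: "u \<in> carrier S"
  shows "is_join S (u \<cdot> s) (u \<cdot> t) (u \<cdot> j)"
proof -
  have jc: "j \<in> carrier S" "s = j \<cdot> s\<star>" "t = j \<cdot> t\<star>" using j s t by (simp_all add: is_join_iff)
  define a b c where "a = u \<cdot> s" "b = u \<cdot> t" "c = u \<cdot> j"
  have abc: "a \<in> carrier S" "b \<in> carrier S" "c \<in> carrier S"
    using s t u jc by (simp_all add: a_b_c_def mult_closed)
  have ac: "a = c \<cdot> s\<star>" "b = c \<cdot> t\<star>"
    using jc s t u by (metis a_b_c_def mult_assoc star_closed)+
  have a: "a = c \<cdot> a\<star>" and b: "b = c \<cdot> b\<star>"
    using ac abc s t by (metis natural_orderI star_projection)+
  have "a \<cdot> b\<star> = c \<cdot> (a\<star> \<cdot> b\<star>)" "b \<cdot> a\<star> = c \<cdot> (b\<star> \<cdot> a\<star>)"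
    using a b abc by (metis mult_assoc star_closed)+
  then have "compatible S a b" using abc by (simp add: compatible_def star_commute)
  then obtain m where m: "is_join S a b m" using join_exists abc by blast
  have "m = c \<cdot> m\<star>" using m a b abc by (simp add: is_join_iff)
  also have "m\<star> = a\<star> \<oplus> b\<star>" using m abc by (simp add: is_join_star)
  also have "\<dots> = c\<star> \<cdot> s\<star> \<oplus> c\<star> \<cdot> t\<star>"
    using ac abc s t by (metis star_mult_projection star_projection)
  also have "\<dots> = c\<star> \<cdot> j\<star>"
    using abc s t j by (simp add: mult_pjoin_distrib is_join_star star_projection)
  also have "\<dots> = c\<star>" unfolding a_b_c_def(3) using u jc by (simp add: star_mult_le)
  also have "c \<cdot> c\<star> = c" using abc by (simp add: mult_star)
  finally show ?thesis using m by (simp add: a_b_c_def)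
qed

section \<open>Evaluation and separation by prime characters\<close>

lemma prime_charactersD:
  assumes "\<omega> \<in> prime_characters S"
  shows "\<omega> e \<Longrightarrow> e \<in> projections S"
    and "\<lbrakk>e \<in> projections S; f \<in> projections S\<rbrakk> \<Longrightarrow> \<omega> (e \<cdot> f) \<longleftrightarrow> \<omega> e \<and> \<omega> f"
    and "\<exists>e\<in>projections S. \<omega> e" and "\<not> \<omega> \<zero>"
    and "\<lbrakk>e \<in> projections S; f \<in> projections S\<rbrakk> \<Longrightarrow> \<omega> (e \<oplus> f) \<longleftrightarrow> \<omega> e \<or> \<omega> f"
proof -
  have c: "\<omega> \<in> characters (projections S) (rmult S)" using assms by (simp add: prime_characters_def)
  show "\<omega> e \<Longrightarrow> e \<in> projections S" "\<exists>e\<in>projections S. \<omega> e" "\<not> \<omega> \<zero>"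
    using charactersD[OF c] assms by (auto simp: prime_characters_def)
  show m: "\<lbrakk>e \<in> projections S; f \<in> projections S\<rbrakk> \<Longrightarrow> \<omega> (e \<cdot> f) \<longleftrightarrow> \<omega> e \<and> \<omega> f" for e f
    using charactersD[OF c] by blast
  show "\<omega> (e \<oplus> f) \<longleftrightarrow> \<omega> e \<or> \<omega> f" if "e \<in> projections S" "f \<in> projections S"
    using that assms m[of e "e \<oplus> f"] m[of f "e \<oplus> f"] pjoin_upper[OF that] pjoin_closed[OF that]
    by (auto simp: prime_characters_def)
qed

lemma prime_character_separation:
  assumes I: "order_ideal (projection_order S) I" and m: "m \<in> projections S" "m \<notin> I"
  obtains \<omega> where "\<omega> \<in> prime_characters S" "\<omega> m" "\<And>c. c \<in> I \<Longrightarrow> \<not> \<omega> c"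
proof -
  from m have m': "m \<in> carrier (projection_order S)" by simp
  obtain M where M: "order_ideal (projection_order S) M" "I \<subseteq> M" "m \<notin> M"
    and prime: "\<And>x y. \<lbrakk>x \<in> carrier (projection_order S); y \<in> carrier (projection_order S);
      x \<sqinter>\<^bsub>projection_order S\<^esub> y \<in> M\<rbrakk> \<Longrightarrow> x \<in> M \<or> y \<in> M"
    using P.prime_ideal_separation[OF I m' m(2)] by metis
  have prime: "x \<in> M \<or> y \<in> M" if "x \<in> projections S" "y \<in> projections S" "x \<cdot> y \<in> M" for x y
    using prime that by (simp add: pmeet_eq)
  have down: "y \<in> M" if "x \<in> M" "y \<in> projections S" "y = y \<cdot> x" for x y
    using M(1) that by (auto simp: order_ideal_def)
  define \<omega> where "\<omega> e \<longleftrightarrow> e \<in> projections S \<and> e \<notin> M" for e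
  have "\<omega> (e \<cdot> f) \<longleftrightarrow> \<omega> e \<and> \<omega> f" if "e \<in> projections S" "f \<in> projections S" for e f
  proof -
    have "e \<cdot> f = e \<cdot> f \<cdot> e" "e \<cdot> f = e \<cdot> f \<cdot> f" using that by (simp_all add: projection_aci)
    then show ?thesis using that prime[of e f] down projection_mult_closed[of e f] unfolding \<omega>_def
      by metis
  qed
  then have "\<omega> \<in> prime_characters S"
    using M(1,3) m by (auto simp: prime_characters_def characters_def \<omega>_def order_ideal_def)
  then show ?thesis by (rule that) (use m M in \<open>auto simp: \<omega>_def\<close>)
qed

text \<open>The projections on which b and b' agree form an ideal, closed under joins because left
  multiplication preserves them. If \<open>b\<star> \<oplus> b'\<star>\<close> were outside, a prime
  character would be 1 there and 0 on the ideal, and by primeness it would be 1 at one of the two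
  stars, where the hypothesis yields a member of the ideal with value 1.\<close>

lemma eq_if_prime_germs_eq:
  assumes b: "b \<in> carrier S" and b': "b' \<in> carrier S"
    and germ: "\<And>\<omega>. \<lbrakk>\<omega> \<in> prime_characters S; \<omega> (b\<star>) \<or> \<omega> (b'\<star>)\<rbrakk> \<Longrightarrow> \<exists>c. \<omega> c \<and> b \<cdot> c = b' \<cdot> c"
  shows "b = b'"
proof -
  define I where "I = {c \<in> projections S. b \<cdot> c = b' \<cdot> c}"
  have p: "b\<star> \<in> projections S" "b'\<star> \<in> projections S" using b b' by (simp_all add: star_projection)
  define m where "m = b\<star> \<oplus> b'\<star>"
  have m: "m \<in> projections S" using p by (simp add: m_def pjoin_closed)
  have "c \<oplus> d \<in> I" if "c \<in> I" "d \<in> I" for c d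
  proof -
    have cd: "c \<in> projections S" "d \<in> projections S" "b \<cdot> c = b' \<cdot> c" "b \<cdot> d = b' \<cdot> d"
      using that by (auto simp: I_def)
    have "is_join S (a \<cdot> c) (a \<cdot> d) (a \<cdot> (c \<oplus> d))" if "a \<in> carrier S" for a
      using cd that by (intro is_join_mult_left is_join_pjoin) (auto intro: projection_closed)
    from this[OF b] this[OF b'] have "b \<cdot> (c \<oplus> d) = b' \<cdot> (c \<oplus> d)"
      using cd b b' is_join_unique by (metis mult_closed projection_closed)
    then show ?thesis using cd by (simp add: I_def pjoin_closed)
  qed
  moreover have "d \<in> I" if "c \<in> I" "d \<in> projections S" "d = d \<cdot> c" for c d
  proof -
    have c: "c \<in> projections S" "b \<cdot> c = b' \<cdot> c" using that by (auto simp: I_def)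
    then have "d = c \<cdot> d" using that projection_commute by metis
    then have "b \<cdot> d = b' \<cdot> d"
      using c that(2) b b' by (metis mult_assoc projection_closed)
    then show ?thesis using that by (simp add: I_def)
  qed
  ultimately have ideal: "order_ideal (projection_order S) I"
    using b b' by (auto simp: order_ideal_def I_def zero_projection zero_mult)
  have "m \<in> I"
  proof (rule ccontr)
    assume "m \<notin> I"
    with ideal m obtain \<omega> where \<omega>: "\<omega> \<in> prime_characters S" "\<omega> m" "\<And>c. c \<in> I \<Longrightarrow> \<not> \<omega> c"
      using prime_character_separation by metis
    then have "\<omega> (b\<star>) \<or> \<omega> (b'\<star>)" using p by (simp add: m_def prime_charactersD)
    then obtain c where "\<omega> c" "b \<cdot> c = b' \<cdot> c" using germ \<omega>(1) by blast
    then have "c \<in> I" using prime_charactersD(1)[OF \<omega>(1)] by (simp add: I_def)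
    then show False using \<omega>(3) \<open>\<omega> c\<close> by blast
  qed
  then have "b \<cdot> m = b' \<cdot> m" by (simp add: I_def)
  moreover have "b \<cdot> m = b" "b' \<cdot> m = b'"
    using pjoin_upper[OF p] b b' m unfolding m_def
    by (metis mult_assoc mult_star projection_closed star_closed)+
  ultimately show ?thesis by simp
qed

text \<open>The formula of \<open>char_action\<close>, now for a Boolean S. Local units give e with
  \<open>e \<cdot> b = b\<close>, so the translate is not zero; it stays prime because
  \<open>join_mult\<close> and \<open>is_join_star\<close> turn the star of
  \<open>(e \<oplus> f) \<cdot> b\<close> into a join of stars.\<close>

lemma prime_character_translate:
  assumes \<omega>: "\<omega> \<in> prime_characters S" and b: "b \<in> carrier S" "\<omega> (b\<star>)"
    and units: "has_local_units S"
  shows "(\<lambda>e. e \<in> projections S \<and> \<omega> ((e \<cdot> b)\<star>)) \<in> prime_characters S"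
proof -
  note \<omega>D = prime_charactersD[OF \<omega>]
  have star: "(e \<cdot> b)\<star> \<in> projections S" if "e \<in> projections S" for e
    using that b by (simp add: star_mult_in)
  have "\<omega> ((e \<cdot> f \<cdot> b)\<star>) \<longleftrightarrow> \<omega> ((e \<cdot> b)\<star>) \<and> \<omega> ((f \<cdot> b)\<star>)"
    if "e \<in> projections S" "f \<in> projections S" for e f
    using that b star \<omega>D(2) by (simp add: star_mult_mult)
  moreover have "\<omega> ((e \<cdot> b)\<star>) \<or> \<omega> ((f \<cdot> b)\<star>)"
    if "e \<in> projections S" "f \<in> projections S" "\<omega> (((e \<oplus> f) \<cdot> b)\<star>)" for e f
  proof -
    have "is_join S (e \<cdot> b) (f \<cdot> b) ((e \<oplus> f) \<cdot> b)"
      using that b by (intro join_mult is_join_pjoin) (auto intro: projection_closed)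
    then have "((e \<oplus> f) \<cdot> b)\<star> = (e \<cdot> b)\<star> \<oplus> (f \<cdot> b)\<star>"
      using that b by (intro is_join_star) (auto intro: mult_closed projection_closed)
    then show ?thesis using that star \<omega>D(5) by simp
  qed
  moreover have "\<exists>e\<in>projections S. \<omega> ((e \<cdot> b)\<star>)"
    using units b unfolding has_local_units_def by metis
  moreover have "\<not> \<omega> ((\<zero> \<cdot> b)\<star>)"
    using b \<omega>D(4) zero_projection by (simp add: zero_mult projection_star)
  ultimately show ?thesis
    by (auto simp: prime_characters_def characters_def projection_mult_closed)
qed

text \<open>Plays the part of e minus the join of F. Only its values at prime characters are
  recorded, which allows the members of F to be removed one at a time.\<close>

lemma relative_complement_prime:
  assumes "e \<in> projections S" "finite F" "F \<subseteq> projections S"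
  shows "\<exists>c\<in>projections S. \<forall>\<omega>\<in>prime_characters S. \<omega> c \<longleftrightarrow> \<omega> e \<and> (\<forall>f\<in>F. \<not> \<omega> f)"
  using assms(2,3)
proof (induction F rule: finite_induct)
  case empty
  then show ?case using assms(1) by auto
next
  case (insert f F)
  then obtain c where c: "c \<in> projections S"
    "\<And>\<omega>. \<omega> \<in> prime_characters S \<Longrightarrow> \<omega> c \<longleftrightarrow> \<omega> e \<and> (\<forall>f\<in>F. \<not> \<omega> f)" by auto
  have f: "f \<in> projections S" using insert by auto
  have cf: "c \<cdot> f \<in> projections S" using c f by (simp add: projection_mult_closed)
  moreover have "\<zero> = \<zero> \<cdot> (c \<cdot> f)" using cf by (simp add: zero_mult projection_closed)
  moreover have "c \<cdot> f = c \<cdot> f \<cdot> c" using c f by (simp add: projection_aci)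
  \<comment> \<open>The next complement is taken of \<open>c \<cdot> f\<close> inside c, since f
    itself need not lie below c.\<close>
  ultimately obtain g where g: "g \<in> projections S" "c \<cdot> f \<cdot> g = \<zero>" "c \<cdot> f \<oplus> g = c"
    using P.relatively_complemented[of \<zero> "c \<cdot> f" c] c(1) zero_projection by (auto simp: pmeet_eq)
  have "\<omega> g \<longleftrightarrow> \<omega> e \<and> (\<forall>f\<in>insert f F. \<not> \<omega> f)" if \<omega>: "\<omega> \<in> prime_characters S" for \<omega>
  proof -
    note \<omega>D = prime_charactersD[OF \<omega>]
    have "\<not> (\<omega> c \<and> \<omega> f \<and> \<omega> g)" using \<omega>D(2)[OF cf g(1)] \<omega>D(2)[OF c(1) f] \<omega>D(4) g(2) by simp
    moreover have "\<omega> c \<longleftrightarrow> \<omega> c \<and> \<omega> f \<or> \<omega> g"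
      using \<omega>D(5)[OF cf g(1)] \<omega>D(2)[OF c(1) f] g(3) by simp
    ultimately show ?thesis using c(2)[OF \<omega>] by blast
  qed
  then show ?case using g(1) by blast
qed

end

section \<open>Compact slices of an etale category\<close>

lemma compact_slices_simps:
  "U \<in> carrier (compact_slices C) \<longleftrightarrow> compact_slice C U"
  "U \<cdot>\<^bsub>compact_slices C\<^esub> V = {ccomp C x y | x y. x \<in> U \<and> y \<in> V \<and> rmap C y = dmap C x}"
  "U\<star>\<^bsub>compact_slices C\<^esub> = dmap C ` U"
  by (simp_all add: compact_slices_def)

text \<open>Used twice for the domain map: to recognise slices in an etale category, and to show
  that the category of germs is etale.\<close>

lemma homeomorphic_map_open_inj:
  assumes f: "continuous_map X Y f" and op: "\<And>V. openin X V \<Longrightarrow> openin Y (f ` V)"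
    and U: "openin X U" "inj_on f U"
  shows "homeomorphic_map (subtopology X U) (subtopology Y (f ` U)) f"
proof (rule bijective_open_imp_homeomorphic_map)
  show "continuous_map (subtopology X U) (subtopology Y (f ` U)) f"
    using f by (simp add: continuous_map_in_subtopology continuous_map_from_subtopology Pi_iff)
  show "open_map (subtopology X U) (subtopology Y (f ` U)) f"
    unfolding open_map_def
  proof (intro allI impI)
    fix V assume "openin (subtopology X U) V"
    then have "openin X V" "V \<subseteq> U" using U openin_open_subtopology by blast+
    then show "openin (subtopology Y (f ` U)) (f ` V)"
      using op by (metis image_mono inf.absorb1 openin_subtopology_Int)
  qed
  show "f ` topspace (subtopology X U) = topspace (subtopology Y (f ` U))"
    using openin_subset[OF U(1)] openin_subset[OF op[OF U(1)]] by auto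
qed (use U in \<open>auto intro: inj_on_subset\<close>)

context etale_category
begin

abbreviation slice_mult (infixl "\<diamondop>" 70) where "slice_mult \<equiv> rmult (compact_slices C)"

section \<open>Slices and local sections of the domain map\<close>

lemma topspace_unit_space: "topspace (unit_space C) = units C"
  using units_subset by (auto simp: unit_space_def topspace_arrows)

lemma dmap_arrow: "x \<in> arrows C \<Longrightarrow> dmap C x \<in> arrows C"
  using dmap_closed units_subset by blast

text \<open>Every unit is its own domain, so the image of \<open>dmap\<close> is the whole unit
  space and the local homeomorphism of the etale condition already has slices as its
  neighbourhoods.\<close>

lemma local_slice:
  assumes "x \<in> arrows C"
  obtains W where "slice C W" "x \<in> W"
proof -
  have "dmap C ` arrows C = units C"
    using dmap_closed dmap_unit units_subset by force
  then have "subtopology (unit_space C) (dmap C ` arrows C) = unit_space C"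
    by (metis subtopology_topspace topspace_unit_space)
  then show ?thesis
    using dmap_local_homeomorphism assms that
    by (auto simp: local_homeomorphism_def slice_def topspace_arrows)
qed

lemma slice_subset: "slice C U \<Longrightarrow> U \<subseteq> arrows C"
  using openin_subset topspace_arrows by (auto simp: slice_def)

lemma slice_inj: "slice C U \<Longrightarrow> inj_on (dmap C) U"
  using slice_subset homeomorphic_imp_injective_map
  by (fastforce simp: slice_def topspace_arrows Int_absorb1)

lemma continuous_dmap_arrows: "continuous_map (ctop C) (ctop C) (dmap C)"
  using continuous_dmap continuous_map_into_fulltopology by (auto simp: unit_space_def)

lemma dmap_open:
  assumes V: "openin (ctop C) V"
  shows "openin (unit_space C) (dmap C ` V)"
proof (subst openin_subopen, safe)
  fix x assume x: "x \<in> V"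
  then have "x \<in> arrows C" using openin_subset[OF V] by (auto simp: topspace_arrows)
  then obtain W where W: "slice C W" "x \<in> W" by (rule local_slice)
  have "openin (subtopology (ctop C) W) (V \<inter> W)" using V by (rule openin_subtopology_Int)
  then have "openin (subtopology (unit_space C) (dmap C ` W)) (dmap C ` (V \<inter> W))"
    using W(1) homeomorphic_imp_open_map unfolding slice_def open_map_def by blast
  then have "openin (unit_space C) (dmap C ` (V \<inter> W))"
    using W(1) openin_trans_full unfolding slice_def by blast
  then show "\<exists>T. openin (unit_space C) T \<and> dmap C x \<in> T \<and> T \<subseteq> dmap C ` V"
    using x W by blast
qed

text \<open>Since \<open>dmap\<close> is continuous and open, the homeomorphism condition reduces to
  injectivity. All later slice proofs go through this form.\<close>

lemma slice_iff: "slice C U \<longleftrightarrow> openin (ctop C) U \<and> inj_on (dmap C) U"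
proof
  assume "slice C U"
  then show "openin (ctop C) U \<and> inj_on (dmap C) U"
    using slice_inj by (simp add: slice_def)
next
  assume U: "openin (ctop C) U \<and> inj_on (dmap C) U"
  then have "homeomorphic_map (subtopology (ctop C) U) (subtopology (unit_space C) (dmap C ` U)) (dmap C)"
    using continuous_dmap dmap_open by (intro homeomorphic_map_open_inj) auto
  then show "slice C U" using U dmap_open by (simp add: slice_def)
qed

text \<open>Around a value of \<sigma> take a slice W. An arrow y of W over the open set where
  \<sigma> lands in W has the same domain as \<open>\<sigma> (dmap C y)\<close>, and injectivity on
  W identifies the two, so the image contains a neighbourhood.\<close>

lemma open_section:
  assumes A: "openin (unit_space C) A"
    and \<sigma>: "continuous_map (subtopology (unit_space C) A) (ctop C) \<sigma>"
    and section_eq: "\<And>p. p \<in> A \<Longrightarrow> dmap C (\<sigma> p) = p"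
  shows "openin (ctop C) (\<sigma> ` A)"
proof (subst openin_subopen, safe)
  have Asub: "A \<subseteq> units C" using openin_subset[OF A] by (simp add: topspace_unit_space)
  fix p assume p: "p \<in> A"
  then have "\<sigma> p \<in> arrows C"
    using \<sigma> Asub by (auto simp: continuous_map_def topspace_unit_space topspace_arrows)
  then obtain W where W: "slice C W" "\<sigma> p \<in> W" by (rule local_slice)
  have Wopen: "openin (ctop C) W" using W by (simp add: slice_def)
  have "topspace (subtopology (unit_space C) A) = A" using Asub by (auto simp: topspace_unit_space)
  with openin_continuous_map_preimage[OF \<sigma> Wopen]
  have "openin (subtopology (unit_space C) A) {q \<in> A. \<sigma> q \<in> W}" by (simp only:)
  then have B: "openin (unit_space C) {q \<in> A. \<sigma> q \<in> W}" using A openin_trans_full by blast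
  let ?O = "{y \<in> W. dmap C y \<in> {q \<in> A. \<sigma> q \<in> W}}"
  have "openin (ctop C) ?O" by (rule openin_continuous_map_preimage_gen[OF continuous_dmap Wopen B])
  moreover have "\<sigma> p \<in> ?O" using W p section_eq by simp
  moreover have "?O \<subseteq> \<sigma> ` A"
  proof
    fix y assume y: "y \<in> ?O"
    then have "dmap C (\<sigma> (dmap C y)) = dmap C y" using section_eq by simp
    then have "\<sigma> (dmap C y) = y" using y slice_inj[OF W(1)] by (auto dest: inj_onD)
    then show "y \<in> \<sigma> ` A" using y by (metis (mono_tags, lifting) mem_Collect_eq imageI)
  qed
  ultimately show "\<exists>T. openin (ctop C) T \<and> \<sigma> p \<in> T \<and> T \<subseteq> \<sigma> ` A" by blast
qed

text \<open>The units are the image of the identity, a continuous section of \<open>dmap\<close>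
  over the whole unit space.\<close>

lemma units_open: "openin (ctop C) (units C)"
proof -
  have "continuous_map (subtopology (unit_space C) (units C)) (ctop C) id"
    by (simp add: unit_space_def continuous_map_from_subtopology)
  then have "openin (ctop C) (id ` units C)"
    using open_section[of "units C" id] dmap_unit topspace_unit_space openin_topspace
    by (metis id_apply)
  then show ?thesis by simp
qed

lemma unit_space_open_iff: "openin (unit_space C) K \<longleftrightarrow> openin (ctop C) K \<and> K \<subseteq> units C"
  unfolding unit_space_def by (rule openin_open_subtopology[OF units_open])

lemma unit_space_compact_iff: "compactin (unit_space C) K \<longleftrightarrow> compactin (ctop C) K \<and> K \<subseteq> units C"
  by (auto simp: unit_space_def compactin_subtopology)

lemma compact_slice_iff:
  "compact_slice C U \<longleftrightarrow> openin (ctop C) U \<and> inj_on (dmap C) U \<and> compactin (ctop C) U"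
  by (auto simp: compact_slice_def slice_iff)

lemma compact_slice_subset: "compact_slice C U \<Longrightarrow> U \<subseteq> arrows C"
  by (simp add: compact_slice_def slice_subset)

lemma compact_open_units_slice:
  "\<lbrakk>openin (ctop C) K; compactin (ctop C) K; K \<subseteq> units C\<rbrakk> \<Longrightarrow> compact_slice C K"
  by (auto simp: compact_slice_iff inj_on_def dmap_unit subset_iff)

lemma compact_slice_empty: "compact_slice C {}"
  by (simp add: compact_open_units_slice)

lemma compact_slice_dmap:
  assumes "compact_slice C U"
  shows "compact_slice C (dmap C ` U)" "dmap C ` U \<subseteq> units C"
proof -
  show u: "dmap C ` U \<subseteq> units C" using compact_slice_subset[OF assms] dmap_closed by auto
  have "openin (ctop C) (dmap C ` U)"
    using assms dmap_open unit_space_open_iff by (simp add: compact_slice_iff)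
  moreover have "compactin (ctop C) (dmap C ` U)"
    using assms image_compactin continuous_dmap_arrows by (auto simp: compact_slice_iff)
  ultimately show "compact_slice C (dmap C ` U)" using u by (rule compact_open_units_slice)
qed

lemma compact_slice_Un:
  "\<lbrakk>compact_slice C U; compact_slice C V; inj_on (dmap C) (U \<union> V)\<rbrakk> \<Longrightarrow> compact_slice C (U \<union> V)"
  by (auto simp: compact_slice_iff compactin_Un)

lemma slice_inverse:
  assumes "slice C U"
  obtains g where "continuous_map (subtopology (unit_space C) (dmap C ` U)) (ctop C) g"
    and "\<And>x. x \<in> U \<Longrightarrow> g (dmap C x) = x"
proof -
  obtain g where "homeomorphic_maps (subtopology (ctop C) U) (subtopology (unit_space C) (dmap C ` U)) (dmap C) g"
    using assms by (auto simp: slice_def homeomorphic_map_maps)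
  then show ?thesis
    using slice_subset[OF assms]
    by (intro that[of g]) (auto simp: homeomorphic_maps_def continuous_map_in_subtopology topspace_arrows)
qed

text \<open>The product is the image of a continuous section of \<open>dmap\<close> over a compact
  open set of units; openness then comes from \<open>open_section\<close> and compactness from
  continuity.\<close>

lemma compact_slice_mult:
  assumes U: "compact_slice C U" and V: "compact_slice C V"
  shows "compact_slice C (U \<diamondop> V)"
proof -
  have sU: "slice C U" and sV: "slice C V" using U V by (simp_all add: compact_slice_def)
  have sub: "U \<subseteq> arrows C" "V \<subseteq> arrows C" using U V by (simp_all add: compact_slice_subset)
  obtain g where g: "continuous_map (subtopology (unit_space C) (dmap C ` U)) (ctop C) g"
    and gU: "\<And>x. x \<in> U \<Longrightarrow> g (dmap C x) = x" using slice_inverse[OF sU] by blast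
  obtain h where h: "continuous_map (subtopology (unit_space C) (dmap C ` V)) (ctop C) h"
    and hV: "\<And>x. x \<in> V \<Longrightarrow> h (dmap C x) = x" using slice_inverse[OF sV] by blast
  define D where "D = {y \<in> V. rmap C y \<in> dmap C ` U}"
  define A where "A = dmap C ` D"
  \<comment> \<open>Over p the product has one candidate: h picks the arrow of V with domain p, and
    g the arrow of U whose domain is the range of that arrow.\<close>
  define \<sigma> where "\<sigma> p = ccomp C (g (rmap C (h p))) (h p)" for p
  have dU: "openin (unit_space C) (dmap C ` U)" "closedin (unit_space C) (dmap C ` U)"
  proof -
    show "openin (unit_space C) (dmap C ` U)" using U by (simp add: compact_slice_iff dmap_open)
    have "compactin (unit_space C) (dmap C ` U)"
      using compact_slice_dmap[OF U] by (simp add: compact_slice_iff unit_space_compact_iff)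
    then show "closedin (unit_space C) (dmap C ` U)"
      using Hausdorff_units compactin_imp_closedin by blast
  qed
  have "openin (ctop C) D" unfolding D_def
    using V by (intro openin_continuous_map_preimage_gen[OF continuous_rmap _ dU(1)]) (simp add: compact_slice_iff)
  then have A: "openin (unit_space C) A" unfolding A_def by (rule dmap_open)
  \<comment> \<open>D is also the trace on V of a closed set, because the compact set of domains of
    U is closed in the Hausdorff unit space; this is where compactness of D comes from.\<close>
  have "D = {y \<in> topspace (ctop C). rmap C y \<in> dmap C ` U} \<inter> V"
    using sub by (auto simp: D_def topspace_arrows)
  then have "compactin (ctop C) D"
    using closedin_continuous_map_preimage[OF continuous_rmap dU(2)] V
    by (simp add: compact_slice_iff closed_Int_compactin)
  then have Ac: "compactin (unit_space C) A"
    unfolding A_def using continuous_dmap image_compactin by blast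
  have AV: "A \<subseteq> dmap C ` V" by (auto simp: A_def D_def)
  have topA: "topspace (subtopology (unit_space C) A) = A"
    using openin_subset[OF A] by auto
  have rh: "rmap C (h p) \<in> dmap C ` U" "h p \<in> V" "dmap C (h p) = p" if "p \<in> A" for p
    using that hV by (auto simp: A_def D_def)
  have g': "g q \<in> U" "dmap C (g q) = q" if "q \<in> dmap C ` U" for q using that gU by auto
  have \<sigma>: "continuous_map (subtopology (unit_space C) A) (ctop C) \<sigma>"
  proof -
    let ?A = "subtopology (unit_space C) A"
    have h': "continuous_map ?A (ctop C) h"
      using h AV by (rule continuous_map_from_subtopology_mono)
    have "continuous_map ?A (unit_space C) (rmap C \<circ> h)"
      using h' continuous_rmap by (rule continuous_map_compose)
    then have "continuous_map ?A (subtopology (unit_space C) (dmap C ` U)) (rmap C \<circ> h)"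
      by (rule continuous_map_into_subtopology) (use rh topA in auto)
    then have "continuous_map ?A (ctop C) (g \<circ> (rmap C \<circ> h))"
      using g by (rule continuous_map_compose)
    then have "continuous_map ?A (prod_topology (ctop C) (ctop C)) (\<lambda>p. (g (rmap C (h p)), h p))"
      using h' by (simp add: continuous_map_pairwise o_def)
    then have "continuous_map ?A (subtopology (prod_topology (ctop C) (ctop C)) (composable C))
        (\<lambda>p. (g (rmap C (h p)), h p))"
      by (rule continuous_map_into_subtopology) (use rh g' topA sub in \<open>force simp: composable_def\<close>)
    from continuous_map_compose[OF this continuous_comp] show ?thesis
      by (simp add: o_def \<sigma>_def[abs_def])
  qed
  have d\<sigma>: "dmap C (\<sigma> p) = p" if "p \<in> A" for p
    using that rh[OF that] g'[OF rh(1)[OF that]] sub by (auto simp: \<sigma>_def dmap_comp subset_iff)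
  have eq: "\<sigma> ` A = U \<diamondop> V"
  proof
    show "\<sigma> ` A \<subseteq> U \<diamondop> V"
    proof
      fix z assume "z \<in> \<sigma> ` A"
      then obtain p where p: "p \<in> A" "z = \<sigma> p" by blast
      have "g (rmap C (h p)) \<in> U" "h p \<in> V" "rmap C (h p) = dmap C (g (rmap C (h p)))"
        using rh[OF p(1)] g'[OF rh(1)[OF p(1)]] by simp_all
      then show "z \<in> U \<diamondop> V" unfolding compact_slices_simps p(2) \<sigma>_def by blast
    qed
    show "U \<diamondop> V \<subseteq> \<sigma> ` A"
    proof
      fix z assume "z \<in> U \<diamondop> V"
      then obtain x y where xy: "z = ccomp C x y" "x \<in> U" "y \<in> V" "rmap C y = dmap C x"
        by (auto simp: compact_slices_simps)
      then have "dmap C y \<in> A" "\<sigma> (dmap C y) = z" using hV gU by (auto simp: A_def D_def \<sigma>_def)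
      then show "z \<in> \<sigma> ` A" by blast
    qed
  qed
  have "openin (ctop C) (\<sigma> ` A)" using A \<sigma> d\<sigma> by (rule open_section)
  moreover have "inj_on (dmap C) (\<sigma> ` A)" using d\<sigma> by (auto simp: inj_on_def)
  moreover have "compactin (ctop C) (\<sigma> ` A)"
    using \<sigma> Ac by (intro image_compactin[where X = "subtopology (unit_space C) A"])
      (simp_all add: compactin_subtopology)
  ultimately show ?thesis by (simp add: compact_slice_iff eq)
qed

section \<open>Algebra of compact slices\<close>

lemma mult_unit_slice:
  assumes "U \<subseteq> arrows C" "K \<subseteq> units C"
  shows "U \<diamondop> K = {x \<in> U. dmap C x \<in> K}"
    and "K \<diamondop> U = {x \<in> U. rmap C x \<in> K}"
proof -
  show "U \<diamondop> K = {x \<in> U. dmap C x \<in> K}"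
  proof
    show "U \<diamondop> K \<subseteq> {x \<in> U. dmap C x \<in> K}"
      using assms by (auto simp: compact_slices_simps rmap_unit comp_dmap subset_iff)
    show "{x \<in> U. dmap C x \<in> K} \<subseteq> U \<diamondop> K"
      using assms by (force simp: compact_slices_simps rmap_unit dmap_closed comp_dmap subset_iff)
  qed
  show "K \<diamondop> U = {x \<in> U. rmap C x \<in> K}"
  proof
    show "K \<diamondop> U \<subseteq> {x \<in> U. rmap C x \<in> K}"
      using assms by (auto simp: compact_slices_simps dmap_unit subset_iff) (metis dmap_unit rmap_comp_left)+
    show "{x \<in> U. rmap C x \<in> K} \<subseteq> K \<diamondop> U"
      using assms by (force simp: compact_slices_simps dmap_unit rmap_closed rmap_comp_left subset_iff)
  qed
qed

lemma dmap_image_units: "K \<subseteq> units C \<Longrightarrow> dmap C ` K = K"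
  using dmap_unit by (simp add: subset_iff cong: image_cong_simp)

lemma dmap_dmap: "x \<in> arrows C \<Longrightarrow> dmap C (dmap C x) = dmap C x"
  by (simp add: dmap_closed dmap_unit)

lemma dmap_mult:
  assumes "U \<subseteq> arrows C" "V \<subseteq> arrows C"
  shows "dmap C ` (U \<diamondop> V) = dmap C ` {y \<in> V. rmap C y \<in> dmap C ` U}"
proof (rule Set.set_eqI)
  fix p
  have d: "dmap C (ccomp C x y) = dmap C y" if "x \<in> U" "y \<in> V" "rmap C y = dmap C x" for x y
    using that assms by (intro dmap_comp) auto
  have "p \<in> dmap C ` (U \<diamondop> V)
      \<longleftrightarrow> (\<exists>x y. x \<in> U \<and> y \<in> V \<and> rmap C y = dmap C x \<and> p = dmap C (ccomp C x y))"
    by (auto simp: compact_slices_simps image_iff)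
  also have "\<dots> \<longleftrightarrow> (\<exists>x y. x \<in> U \<and> y \<in> V \<and> rmap C y = dmap C x \<and> p = dmap C y)"
    using d by (intro ex_cong1 conj_cong refl) simp
  also have "\<dots> \<longleftrightarrow> p \<in> dmap C ` {y \<in> V. rmap C y \<in> dmap C ` U}" by auto
  finally show "p \<in> dmap C ` (U \<diamondop> V)
      \<longleftrightarrow> p \<in> dmap C ` {y \<in> V. rmap C y \<in> dmap C ` U}" .
qed

lemma restriction_semigroup_compact_slices: "restriction_semigroup (compact_slices C)"
proof
  fix U V W
  assume "U \<in> carrier (compact_slices C)"
  then have U: "compact_slice C U" "U \<subseteq> arrows C"
    by (simp_all add: compact_slices_simps compact_slice_subset)
  note dU = compact_slice_dmap[OF U(1)]
  show "U\<star>\<^bsub>compact_slices C\<^esub> \<in> carrier (compact_slices C)"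
    using dU by (simp add: compact_slices_simps)
  show "U \<diamondop> U\<star>\<^bsub>compact_slices C\<^esub> = U"
    using mult_unit_slice(1)[OF U(2) dU(2)] by (simp only: compact_slices_simps(3)) auto
  assume "V \<in> carrier (compact_slices C)"
  then have V: "compact_slice C V" "V \<subseteq> arrows C"
    by (simp_all add: compact_slices_simps compact_slice_subset)
  note dV = compact_slice_dmap[OF V(1)]
  have dd: "dmap C ` dmap C ` U = dmap C ` U"
    using U by (force simp: dmap_dmap subset_iff image_image)
  have UV: "U \<diamondop> V \<subseteq> arrows C"
    using U V by (auto simp: compact_slices_simps comp_closed subset_iff)
  show "U \<diamondop> V \<in> carrier (compact_slices C)"
    using U V by (simp add: compact_slices_simps(1) compact_slice_mult)
  have int: "dmap C ` U \<diamondop> dmap C ` V = dmap C ` U \<inter> dmap C ` V"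
    if "U \<subseteq> arrows C" "V \<subseteq> arrows C" for U V
  proof -
    have "dmap C ` U \<subseteq> arrows C" "dmap C ` V \<subseteq> units C"
      using that dmap_arrow dmap_closed by auto
    from mult_unit_slice(1)[OF this] show ?thesis using that by (auto simp: dmap_dmap subset_iff)
  qed
  show "U\<star>\<^bsub>compact_slices C\<^esub> \<diamondop> V\<star>\<^bsub>compact_slices C\<^esub>
      = V\<star>\<^bsub>compact_slices C\<^esub> \<diamondop> U\<star>\<^bsub>compact_slices C\<^esub>"
    using U V by (simp add: compact_slices_simps(3) int Int_commute)
  show "(U\<star>\<^bsub>compact_slices C\<^esub> \<diamondop> V\<star>\<^bsub>compact_slices C\<^esub>)\<star>\<^bsub>compact_slices C\<^esub>
      = U\<star>\<^bsub>compact_slices C\<^esub> \<diamondop> V\<star>\<^bsub>compact_slices C\<^esub>"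
    unfolding compact_slices_simps(3) int[OF U(2) V(2)]
    using dU(2) by (intro dmap_image_units) auto
  show "(U \<diamondop> V)\<star>\<^bsub>compact_slices C\<^esub>
      = (U\<star>\<^bsub>compact_slices C\<^esub> \<diamondop> V)\<star>\<^bsub>compact_slices C\<^esub>"
    using U V dU compact_slice_subset[OF dU(1)]
    by (simp add: compact_slices_simps(3) dmap_mult dd)
  show "U\<star>\<^bsub>compact_slices C\<^esub> \<diamondop> V
      = V \<diamondop> (U \<diamondop> V)\<star>\<^bsub>compact_slices C\<^esub>"
  proof -
    have "dmap C ` (U \<diamondop> V) \<subseteq> units C" using UV dmap_closed by auto
    then have "V \<diamondop> (U \<diamondop> V)\<star>\<^bsub>compact_slices C\<^esub>
        = {y \<in> V. dmap C y \<in> dmap C ` {y \<in> V. rmap C y \<in> dmap C ` U}}"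
      unfolding compact_slices_simps(3) using V U by (simp add: mult_unit_slice dmap_mult)
    \<comment> \<open>Distinct arrows of the slice V have distinct domains, so the condition on
      \<open>dmap C y\<close> can be tested on y itself.\<close>
    also have "\<dots> = {y \<in> V. rmap C y \<in> dmap C ` U}"
      using V by (auto simp: compact_slice_iff inj_on_def)
    also have "\<dots> = U\<star>\<^bsub>compact_slices C\<^esub> \<diamondop> V"
      using mult_unit_slice(2)[OF V(2) dU(2)] by (simp add: compact_slices_simps(3))
    finally show ?thesis by simp
  qed
  assume "W \<in> carrier (compact_slices C)"
  then have W: "compact_slice C W" "W \<subseteq> arrows C"
    by (simp_all add: compact_slices_simps compact_slice_subset)
  show "U \<diamondop> V \<diamondop> W
      = U \<diamondop> (V \<diamondop> W)"
  proof (rule Set.set_eqI)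
    fix a
    have d: "dmap C (ccomp C x y) = dmap C y" if "x \<in> U" "y \<in> V" "rmap C y = dmap C x" for x y
      using that U V by (intro dmap_comp) auto
    have r: "rmap C (ccomp C y z) = rmap C y" if "y \<in> V" "z \<in> W" "rmap C z = dmap C y" for y z
      using that V W by (intro rmap_comp) auto
    have assoc: "ccomp C (ccomp C x y) z = ccomp C x (ccomp C y z)"
      if "x \<in> U" "y \<in> V" "z \<in> W" "rmap C y = dmap C x" "rmap C z = dmap C y" for x y z
      using that U V W by (intro comp_assoc) auto
    let ?P = "\<lambda>x y z. x \<in> U \<and> y \<in> V \<and> z \<in> W \<and> rmap C y = dmap C x \<and> rmap C z = dmap C y"
    have "a \<in> U \<diamondop> V \<diamondop> W \<longleftrightarrow>
        (\<exists>x y z. a = ccomp C (ccomp C x y) z \<and> x \<in> U \<and> y \<in> V \<and> z \<in> W \<and> rmap C y = dmap C x \<and>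
          rmap C z = dmap C (ccomp C x y))"
      unfolding compact_slices_simps by blast
    also have "\<dots> \<longleftrightarrow> (\<exists>x y z. a = ccomp C (ccomp C x y) z \<and> ?P x y z)"
      by (intro ex_cong1) (auto simp: d)
    also have "\<dots> \<longleftrightarrow> (\<exists>x y z. a = ccomp C x (ccomp C y z) \<and> ?P x y z)"
      by (intro ex_cong1) (auto simp: assoc)
    also have "\<dots> \<longleftrightarrow> (\<exists>x y z. a = ccomp C x (ccomp C y z) \<and> x \<in> U \<and> y \<in> V \<and> z \<in> W \<and>
        rmap C (ccomp C y z) = dmap C x \<and> rmap C z = dmap C y)"
      by (intro ex_cong1) (auto simp: r)
    also have "\<dots> \<longleftrightarrow> a \<in> U \<diamondop> (V \<diamondop> W)"
      unfolding compact_slices_simps by blast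
    finally show "a \<in> U \<diamondop> V \<diamondop> W \<longleftrightarrow>
      a \<in> U \<diamondop> (V \<diamondop> W)" .
  qed
qed

sublocale CS: restriction_semigroup "compact_slices C"
  by (rule restriction_semigroup_compact_slices)

section \<open>Projections, order and joins of compact slices\<close>

lemma projections_compact_slices:
  "projections (compact_slices C) = {K. openin (ctop C) K \<and> compactin (ctop C) K \<and> K \<subseteq> units C}"
proof (intro Set.set_eqI iffI)
  fix K assume "K \<in> projections (compact_slices C)"
  then obtain U where "compact_slice C U" "K = dmap C ` U"
    by (auto simp: projections_def compact_slices_simps)
  then show "K \<in> {K. openin (ctop C) K \<and> compactin (ctop C) K \<and> K \<subseteq> units C}"
    using compact_slice_dmap[of U] by (simp add: compact_slice_iff)
next
  fix K assume K: "K \<in> {K. openin (ctop C) K \<and> compactin (ctop C) K \<and> K \<subseteq> units C}"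
  then have "dmap C ` K = K" using dmap_unit by force
  then show "K \<in> projections (compact_slices C)"
    using K compact_open_units_slice[of K] 
    by (auto simp: projections_def compact_slices_simps intro!: image_eqI[of _ _ K])
qed

text \<open>Multiplying V by the star of U selects the arrows of V over the domains of U; when U is
  contained in V, injectivity of \<open>dmap\<close> on V leaves exactly U.\<close>

lemma compact_slices_order:
  assumes "compact_slice C U" "compact_slice C V"
  shows "U = V \<diamondop> U\<star>\<^bsub>compact_slices C\<^esub> \<longleftrightarrow> U \<subseteq> V"
proof -
  have "V \<diamondop> U\<star>\<^bsub>compact_slices C\<^esub> = {x \<in> V. dmap C x \<in> dmap C ` U}"
    unfolding compact_slices_simps(3)
    using assms by (simp add: mult_unit_slice compact_slice_subset compact_slice_dmap)
  moreover have "{x \<in> V. dmap C x \<in> dmap C ` U} = U" if "U \<subseteq> V"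
    using that assms by (auto simp: compact_slice_iff inj_on_def subset_iff)
  ultimately show ?thesis by auto
qed

lemma is_join_Un:
  assumes "compact_slice C U" "compact_slice C V" "inj_on (dmap C) (U \<union> V)"
  shows "is_join (compact_slices C) U V (U \<union> V)"
proof -
  have "compact_slice C (U \<union> V)" using assms by (rule compact_slice_Un)
  then show ?thesis using assms
    by (auto simp: CS.is_join_iff compact_slices_order compact_slices_simps(1))
qed

text \<open>Compatibility says that U and V have the same arrows over their common domains. Two
  arrows with equal domain, one from each, therefore both lie in V, where \<open>dmap\<close> is
  injective.\<close>

lemma compatible_inj:
  assumes U: "compact_slice C U" and V: "compact_slice C V" and c: "compatible (compact_slices C) U V"
  shows "inj_on (dmap C) (U \<union> V)"
proof -
  have eq: "{x \<in> U. dmap C x \<in> dmap C ` V} = {x \<in> V. dmap C x \<in> dmap C ` U}"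
    using c U V
    by (simp add: compatible_def compact_slices_simps(3) mult_unit_slice compact_slice_subset compact_slice_dmap)
  have inj: "inj_on (dmap C) U" "inj_on (dmap C) V" using U V by (simp_all add: compact_slice_iff)
  have "x = y" if "x \<in> U" "y \<in> V" "dmap C x = dmap C y" for x y
  proof -
    have "x \<in> V" using eq that by (metis (mono_tags, lifting) imageI mem_Collect_eq)
    then show ?thesis using that inj by (auto dest: inj_onD)
  qed
  then show ?thesis using inj by (auto simp: inj_on_Un)
qed

lemma projections_mult_Int:
  "\<lbrakk>K \<in> projections (compact_slices C); L \<in> projections (compact_slices C)\<rbrakk>
    \<Longrightarrow> K \<diamondop> L = K \<inter> L"
  using units_subset
  by (subst mult_unit_slice) (auto simp: projections_compact_slices dmap_unit subset_iff)

text \<open>For the difference the Hausdorff property is used: the compact L is closed, so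
  \<open>K - L\<close> is open, and it is compact as the part of K in the closed complement of the
  open L.\<close>

lemma projections_Un_Int_Diff:
  assumes "K \<in> projections (compact_slices C)" "L \<in> projections (compact_slices C)"
  shows "K \<union> L \<in> projections (compact_slices C)" "K \<inter> L \<in> projections (compact_slices C)"
    "K - L \<in> projections (compact_slices C)"
proof -
  have KL: "openin (unit_space C) K" "openin (unit_space C) L" "compactin (unit_space C) K" "compactin (unit_space C) L"
    using assms by (auto simp: projections_compact_slices unit_space_open_iff unit_space_compact_iff)
  have cl: "closedin (unit_space C) L" using KL Hausdorff_units compactin_imp_closedin by blast
  have "K - L = K \<inter> (topspace (unit_space C) - L)" using openin_subset[OF KL(1)] by auto
  moreover have "closedin (unit_space C) (topspace (unit_space C) - L)" using KL by blast
  ultimately have "compactin (unit_space C) (K - L)" using KL by (simp add: compact_Int_closedin)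
  moreover have "openin (unit_space C) (K - L)" using KL cl by (simp add: openin_diff)
  ultimately show "K - L \<in> projections (compact_slices C)"
    by (simp add: projections_compact_slices unit_space_open_iff unit_space_compact_iff)
  show "K \<union> L \<in> projections (compact_slices C)" using assms
    by (auto simp: projections_compact_slices compactin_Un)
  show "K \<inter> L \<in> projections (compact_slices C)"
    using assms CS.projection_mult_closed projections_mult_Int by metis
qed

lemma gba_compact_slices: "generalized_boolean_algebra (projection_order (compact_slices C))"
proof -
  let ?L = "projection_order (compact_slices C)"
  let ?P = "projections (compact_slices C)"
  have le: "le ?L K L \<longleftrightarrow> K \<subseteq> L" if "K \<in> ?P" "L \<in> ?P" for K L
    using that by (auto simp: projections_mult_Int)
  have lub: "least ?L (K \<union> L) (Upper ?L {K, L})" if KL: "K \<in> ?P" "L \<in> ?P" for K L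
  proof (rule least_UpperI)
    fix y assume "y \<in> Upper ?L {K, L}"
    then have "y \<in> ?P" "le ?L K y" "le ?L L y" using KL by (auto simp: Upper_def simp del: projection_order_simps(2))
    then show "le ?L (K \<union> L) y" using KL le projections_Un_Int_Diff(1)[OF KL] by simp
  qed (use KL projections_Un_Int_Diff(1)[OF KL] le in \<open>auto simp del: projection_order_simps(2)\<close>)
  have glb: "greatest ?L (K \<inter> L) (Lower ?L {K, L})" if KL: "K \<in> ?P" "L \<in> ?P" for K L
  proof (rule greatest_LowerI)
    fix y assume "y \<in> Lower ?L {K, L}"
    then have "y \<in> ?P" "le ?L y K" "le ?L y L" using KL by (auto simp: Lower_def simp del: projection_order_simps(2))
    then show "le ?L y (K \<inter> L)" using KL le projections_Un_Int_Diff(2)[OF KL] by simp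
  qed (use KL projections_Un_Int_Diff(2)[OF KL] le in \<open>auto simp del: projection_order_simps(2)\<close>)
  interpret L: Lattice.lattice ?L
  proof
    fix K L assume "K \<in> carrier ?L" "L \<in> carrier ?L"
    then show "\<exists>s. least ?L s (Upper ?L {K, L})" "\<exists>s. greatest ?L s (Lower ?L {K, L})"
      using lub glb by (metis projection_order_simps(1))+
  qed (auto simp: le simp del: projection_order_simps(2))
  have join: "K \<squnion>\<^bsub>?L\<^esub> L = K \<union> L" if "K \<in> ?P" "L \<in> ?P" for K L
  proof (rule L.joinI)
    fix l assume "least ?L l (Upper ?L {K, L})"
    then show "l = K \<union> L" using lub[OF that] by (rule L.least_unique)
  qed (use that in simp_all)
  have meet: "K \<sqinter>\<^bsub>?L\<^esub> L = K \<inter> L" if "K \<in> ?P" "L \<in> ?P" for K L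
  proof (rule L.meetI)
    fix l assume "greatest ?L l (Lower ?L {K, L})"
    then show "l = K \<inter> L" using glb[OF that] by (rule L.greatest_unique)
  qed (use that in simp_all)
  show ?thesis
  proof
    show "\<exists>b. least ?L b (carrier ?L)"
      by (intro exI[of _ "{}"]) (auto simp: least_def projections_compact_slices compact_slices_simps)
  next
    fix x y z assume "x \<in> carrier ?L" "y \<in> carrier ?L" "z \<in> carrier ?L"
    then show "x \<sqinter>\<^bsub>?L\<^esub> (y \<squnion>\<^bsub>?L\<^esub> z) = x \<sqinter>\<^bsub>?L\<^esub> y \<squnion>\<^bsub>?L\<^esub> (x \<sqinter>\<^bsub>?L\<^esub> z)"
      using projections_Un_Int_Diff by (simp add: join meet Int_Un_distrib)
  next
    fix a x b
    assume P: "a \<in> carrier ?L" "x \<in> carrier ?L" "b \<in> carrier ?L" and "le ?L a x" "le ?L x b"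
    then have sub: "a \<subseteq> x" "x \<subseteq> b" using le by (metis projection_order_simps(1))+
    \<comment> \<open>The relative complement of x in the interval from a to b, computed on
      sets.\<close>
    define y where "y = a \<union> (b - x)"
    have "y \<in> ?P" using P projections_Un_Int_Diff by (simp add: y_def)
    moreover have "x \<inter> y = a" "x \<union> y = b" using sub by (auto simp: y_def)
    ultimately show "\<exists>y\<in>carrier ?L. x \<sqinter>\<^bsub>?L\<^esub> y = a \<and> x \<squnion>\<^bsub>?L\<^esub> y = b"
      using P join meet by (metis projection_order_simps(1))
  qed
qed

theorem boolean_compact_slices: "boolean_restriction_semigroup (compact_slices C)"
proof (intro boolean_restriction_semigroup.intro boolean_restriction_semigroup_axioms.intro
    CS.restriction_semigroup_axioms)
  show "\<exists>z\<in>projections (compact_slices C). \<forall>s\<in>carrier (compact_slices C).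
      z \<diamondop> s = z \<and> s \<diamondop> z = z"
    by (intro bexI[of _ "{}"]) (auto simp: projections_compact_slices compact_slices_simps)
next
  fix U V assume "U \<in> carrier (compact_slices C)" "V \<in> carrier (compact_slices C)"
    "compatible (compact_slices C) U V"
  then show "\<exists>j. is_join (compact_slices C) U V j"
    using is_join_Un compatible_inj by (metis compact_slices_simps(1))
next
  show "generalized_boolean_algebra (projection_order (compact_slices C))"
    by (rule gba_compact_slices)
next
  fix U V W J assume c: "U \<in> carrier (compact_slices C)" "V \<in> carrier (compact_slices C)"
    "W \<in> carrier (compact_slices C)" and J: "is_join (compact_slices C) U V J"
  then have U: "compact_slice C U" and V: "compact_slice C V" and W: "compact_slice C W"
    by (simp_all add: compact_slices_simps)
  have Jc: "compact_slice C J" "U \<subseteq> J" "V \<subseteq> J"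
    using J c compact_slices_order by (auto simp: CS.is_join_iff compact_slices_simps(1))
  \<comment> \<open>J is given only as a least upper bound. Being a slice above U and V, it makes
    their union a slice, which is then itself the join; so J is a union and multiplication
    distributes setwise.\<close>
  then have "inj_on (dmap C) (U \<union> V)"
    by (meson compact_slice_iff inj_on_subset Un_least)
  then have "J = U \<union> V" using J U V c is_join_Un CS.is_join_unique by metis
  then have eq: "J \<diamondop> W = (U \<diamondop> W) \<union> (V \<diamondop> W)"
    by (auto simp: compact_slices_simps)
  have "compact_slice C (J \<diamondop> W)" using Jc W by (simp add: compact_slice_mult)
  then show "is_join (compact_slices C) (U \<diamondop> W) (V \<diamondop> W)
      (J \<diamondop> W)"
    using U V W unfolding eq by (intro is_join_Un compact_slice_mult) (simp_all add: compact_slice_iff)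
qed

end

section \<open>The category of germs of an action\<close>

context rsgrp_action
begin

abbreviation G where "G \<equiv> germ S X \<theta>"
abbreviation \<G> where "\<G> \<equiv> germ_category S X \<theta>"
abbreviation act where "act s x \<equiv> the (\<theta> s x)"

section \<open>Actions and equality of germs\<close>

lemma action_mult: "\<lbrakk>s \<in> carrier S; t \<in> carrier S\<rbrakk> \<Longrightarrow> \<theta> (s \<cdot> t) = \<theta> s \<circ>\<^sub>m \<theta> t"
  using rsgrp_homD(2)[OF action_hom] by (simp add: partial_maps_def)

lemma action_star: "s \<in> carrier S \<Longrightarrow> \<theta> (s\<star>) = Some |` dom (\<theta> s)"
  using rsgrp_homD(3)[OF action_hom] by (simp add: partial_maps_def)

lemma dom_action_star: "s \<in> carrier S \<Longrightarrow> dom (\<theta> (s\<star>)) = dom (\<theta> s)"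
  by (auto simp: action_star restrict_map_def split: if_splits)

lemma action_projection: "\<lbrakk>e \<in> projections S; x \<in> dom (\<theta> e)\<rbrakk> \<Longrightarrow> \<theta> e x = Some x"
  by (metis action_star projection_closed projection_star restrict_in)

lemma open_dom_action: "s \<in> carrier S \<Longrightarrow> openin X (dom (\<theta> s))"
  using rsgrp_homD(1)[OF action_hom] by (simp add: partial_maps_def)

lemma dom_action_topspace: "s \<in> carrier S \<Longrightarrow> dom (\<theta> s) \<subseteq> topspace X"
  by (rule openin_subset[OF open_dom_action])

lemma continuous_action: "s \<in> carrier S \<Longrightarrow> continuous_map (subtopology X (dom (\<theta> s))) X (act s)"
  using rsgrp_homD(1)[OF action_hom] by (simp add: partial_maps_def)

lemma act_topspace: "\<lbrakk>s \<in> carrier S; x \<in> dom (\<theta> s)\<rbrakk> \<Longrightarrow> act s x \<in> topspace X"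
  using continuous_action[of s] dom_action_topspace[of s] by (auto simp: continuous_map_def Pi_iff)

lemma dom_action_mult:
  "\<lbrakk>s \<in> carrier S; t \<in> carrier S\<rbrakk> \<Longrightarrow> x \<in> dom (\<theta> (s \<cdot> t)) \<longleftrightarrow> x \<in> dom (\<theta> t) \<and> act t x \<in> dom (\<theta> s)"
  by (auto simp: action_mult map_comp_def split: option.splits)

lemma act_mult:
  "\<lbrakk>s \<in> carrier S; t \<in> carrier S; x \<in> dom (\<theta> t)\<rbrakk> \<Longrightarrow> act (s \<cdot> t) x = act s (act t x)"
  by (auto simp: action_mult)

text \<open>Keeps domain conditions in the form \<open>x \<in> dom f\<close> in which the rewrite
  rules below are stated.\<close>

declare domIff [iff del]

lemma dom_action_mult_projection:
  "\<lbrakk>s \<in> carrier S; e \<in> projections S\<rbrakk> \<Longrightarrow> x \<in> dom (\<theta> (s \<cdot> e)) \<longleftrightarrow> x \<in> dom (\<theta> e) \<and> x \<in> dom (\<theta> s)"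
  by (cases "x \<in> dom (\<theta> e)") (simp_all add: dom_action_mult projection_closed action_projection)

lemma act_mult_projection:
  "\<lbrakk>s \<in> carrier S; e \<in> projections S; x \<in> dom (\<theta> e)\<rbrakk> \<Longrightarrow> act (s \<cdot> e) x = act s x"
  using action_projection[of e x] by (simp add: act_mult projection_closed)

lemma projection_at:
  assumes "x \<in> topspace X" obtains e where "e \<in> projections S" "x \<in> dom (\<theta> e)"
  using assms action_nondegenerate by blast

lemma germ_domain_iff: "(s, x) \<in> germ_domain S X \<theta> \<longleftrightarrow> s \<in> carrier S \<and> x \<in> dom (\<theta> s)"
  using dom_action_topspace by (auto simp: germ_domain_def dom_action_star)

text \<open>Replaces the common lower bound u by a projection: e is \<open>u\<star>\<close> in one
  direction, and u is \<open>s \<cdot> e\<close> in the other. Germ equality becomes the equation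
  \<open>s \<cdot> e = t \<cdot> e\<close>, which holds at once over all of
  \<open>dom (\<theta> e)\<close>.\<close>

lemma germ_rel_iff:
  "((s, x), (t, y)) \<in> germ_rel S X \<theta> \<longleftrightarrow>
     s \<in> carrier S \<and> t \<in> carrier S \<and> x \<in> dom (\<theta> s) \<and> x \<in> dom (\<theta> t) \<and> x = y \<and>
     (\<exists>e\<in>projections S. x \<in> dom (\<theta> e) \<and> s \<cdot> e = t \<cdot> e)" (is "?L \<longleftrightarrow> ?R")
proof
  assume ?L
  then obtain u where u: "u \<in> carrier S" "u = s \<cdot> u\<star>" "u = t \<cdot> u\<star>" "x \<in> dom (\<theta> (u\<star>))"
    and "s \<in> carrier S" "t \<in> carrier S" "x \<in> dom (\<theta> s)" "x \<in> dom (\<theta> t)" "x = y"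
    by (auto simp: germ_rel_def germ_domain_iff natural_order_simps)
  then show ?R using star_projection[OF u(1)] by (metis u(2,3))
next
  assume R: ?R
  then obtain e where e: "e \<in> projections S" "x \<in> dom (\<theta> e)" "s \<cdot> e = t \<cdot> e" by blast
  define u where "u = s \<cdot> e"
  have u: "u \<in> carrier S" using R e by (simp add: u_def mult_closed projection_closed)
  have "s \<in> carrier S" "x \<in> dom (\<theta> s)" using R by blast+
  then have "x \<in> dom (\<theta> u)" using e(1,2) by (simp add: u_def dom_action_mult_projection)
  have "u = s \<cdot> u\<star>" "u = t \<cdot> u\<star>" using R e u_def natural_orderI by metis+
  moreover have "x \<in> dom (\<theta> (u\<star>))"
    using \<open>x \<in> dom (\<theta> u)\<close> u by (simp add: dom_action_star)
  moreover have "s \<in> carrier S" "t \<in> carrier S" "x \<in> dom (\<theta> s)" "x \<in> dom (\<theta> t)" "x = y"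
    using R by blast+
  ultimately show ?L using u
    by (simp add: germ_rel_def germ_domain_iff natural_order_simps) blast
qed

lemma equiv_germ_rel: "equiv (germ_domain S X \<theta>) (germ_rel S X \<theta>)"
proof (rule equivI)
  show "germ_rel S X \<theta> \<subseteq> germ_domain S X \<theta> \<times> germ_domain S X \<theta>"
    by (auto simp: germ_rel_iff germ_domain_iff)
  show "refl_on (germ_domain S X \<theta>) (germ_rel S X \<theta>)"
  proof (rule refl_onI)
    fix p assume "p \<in> germ_domain S X \<theta>"
    then obtain s x where "p = (s, x)" "s \<in> carrier S" "x \<in> dom (\<theta> s)"
      by (metis germ_domain_iff surj_pair)
    then show "(p, p) \<in> germ_rel S X \<theta>"
      using star_projection[of s] dom_action_star[of s] by (auto simp: germ_rel_iff)
  qed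
  show "sym (germ_rel S X \<theta>)" by (rule symI) (clarsimp simp: germ_rel_iff, metis)
  show "trans (germ_rel S X \<theta>)"
  proof (rule transI)
    fix p q r assume "(p, q) \<in> germ_rel S X \<theta>" "(q, r) \<in> germ_rel S X \<theta>"
    moreover obtain s x t y u z where pqr: "p = (s, x)" "q = (t, y)" "r = (u, z)"
      by (metis surj_pair)
    ultimately obtain e f where *: "s \<in> carrier S" "t \<in> carrier S" "u \<in> carrier S"
      "e \<in> projections S" "f \<in> projections S" and x: "x = y" "y = z"
      and e: "s \<cdot> e = t \<cdot> e" "t \<cdot> f = u \<cdot> f" and d: "x \<in> dom (\<theta> e)" "x \<in> dom (\<theta> f)"
      and du: "x \<in> dom (\<theta> s)" "x \<in> dom (\<theta> u)"
      by (auto simp: germ_rel_iff)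
    have "s \<cdot> (e \<cdot> f) = t \<cdot> (e \<cdot> f)" using e * by (metis mult_assoc projection_closed)
    also have "\<dots> = u \<cdot> (e \<cdot> f)" using e * by (metis mult_assoc projection_closed projection_commute)
    finally have "s \<cdot> (e \<cdot> f) = u \<cdot> (e \<cdot> f)" .
    moreover have "x \<in> dom (\<theta> (e \<cdot> f))"
      using * d by (subst dom_action_mult_projection) (auto simp: projection_closed)
    moreover have "e \<cdot> f \<in> projections S" using * by (simp add: projection_mult_closed)
    ultimately show "(p, r) \<in> germ_rel S X \<theta>"
      using * x du unfolding pqr germ_rel_iff by blast
  qed
qed

lemma germ_eq_iff:
  assumes "s \<in> carrier S" "t \<in> carrier S" "x \<in> dom (\<theta> s)" "y \<in> dom (\<theta> t)"
  shows "G s x = G t y \<longleftrightarrow> x = y \<and> (\<exists>e\<in>projections S. x \<in> dom (\<theta> e) \<and> s \<cdot> e = t \<cdot> e)"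
proof -
  have "G s x = G t y \<longleftrightarrow> ((s, x), (t, y)) \<in> germ_rel S X \<theta>"
    unfolding germ_def by (rule eq_equiv_class_iff[OF equiv_germ_rel]) (simp_all add: germ_domain_iff assms)
  then show ?thesis using assms by (auto simp: germ_rel_iff)
qed

lemma germ_mult_projection:
  assumes "s \<in> carrier S" "e \<in> projections S" "x \<in> dom (\<theta> s)" "x \<in> dom (\<theta> e)"
  shows "G (s \<cdot> e) x = G s x"
  using assms projection_idem[of e]
  by (subst germ_eq_iff)
    (auto simp: mult_closed projection_closed dom_action_mult_projection mult_assoc intro!: bexI[of _ e])

lemma germ_projection_eq:
  assumes "e \<in> projections S" "f \<in> projections S" "x \<in> dom (\<theta> e)" "x \<in> dom (\<theta> f)"
  shows "G e x = G f x"
  using assms germ_mult_projection[of e f x] germ_mult_projection[of f e x] projection_commute[of e f]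
  by (simp add: projection_closed)

lemma mem_germ:
  "\<lbrakk>s \<in> carrier S; x \<in> dom (\<theta> s)\<rbrakk> \<Longrightarrow>
    (t, y) \<in> G s x \<longleftrightarrow> t \<in> carrier S \<and> y = x \<and> x \<in> dom (\<theta> t) \<and> G t x = G s x"
  using germ_eq_iff[of s t x x] by (auto simp: germ_def germ_rel_iff)

lemma germ_self: "\<lbrakk>s \<in> carrier S; x \<in> dom (\<theta> s)\<rbrakk> \<Longrightarrow> (s, x) \<in> G s x"
  by (simp add: mem_germ)

section \<open>Structure maps of the category of germs\<close>

lemma arrows_germ: "arrows \<G> = {G s x | s x. s \<in> carrier S \<and> x \<in> dom (\<theta> s)}"
  unfolding germ_category_def germ_def quotient_def by (force simp: germ_domain_iff)

lemma units_germ: "units \<G> = {G e x | e x. e \<in> projections S \<and> x \<in> dom (\<theta> e)}"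
  by (simp add: germ_category_def)

lemma germ_arrow: "\<lbrakk>s \<in> carrier S; x \<in> dom (\<theta> s)\<rbrakk> \<Longrightarrow> G s x \<in> arrows \<G>"
  by (auto simp: arrows_germ)

lemma dmap_germ:
  assumes "s \<in> carrier S" "x \<in> dom (\<theta> s)"
  shows "dmap \<G> (G s x) = G (s\<star>) x"
proof -
  have "G (t\<star>) y = G (s\<star>) x" if "(t, y) \<in> G s x" for t y
  proof -
    have t: "t \<in> carrier S" "y = x" "x \<in> dom (\<theta> t)" using that assms by (simp_all add: mem_germ)
    then show ?thesis
      using assms germ_projection_eq[of "t\<star>" "s\<star>" x] by (simp add: dom_action_star star_projection)
  qed
  moreover have "G s x \<noteq> {}" using germ_self[OF assms] by blast
  ultimately show ?thesis
    unfolding germ_category_def top_category.simps by (intro SUP_eq_const) auto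
qed

lemma act_germ_cong:
  assumes "s \<in> carrier S" "t \<in> carrier S" "x \<in> dom (\<theta> s)" "x \<in> dom (\<theta> t)" "G s x = G t x"
  shows "act s x = act t x"
  using assms germ_eq_iff[of s t x x] by (metis act_mult_projection)

lemma rmap_germ:
  assumes s: "s \<in> carrier S" "x \<in> dom (\<theta> s)" and e: "e \<in> projections S" "act s x \<in> dom (\<theta> e)"
  shows "rmap \<G> (G s x) = G e (act s x)"
proof -
  have "G f z = G e (act s x)"
    if "(t, y) \<in> G s x" "\<theta> t y = Some z" "f \<in> projections S" "z \<in> dom (\<theta> f)" for t y f z
  proof -
    have t: "t \<in> carrier S" "y = x" "x \<in> dom (\<theta> t)" "G t x = G s x" using that s by (simp_all add: mem_germ)
    then have "z = act s x" using act_germ_cong[of t s x] s that by simp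
    then show ?thesis using that e germ_projection_eq[of f e z] by simp
  qed
  moreover have "\<theta> s x = Some (act s x)" using s by (auto simp: domIff)
  ultimately have "{G f z | t y f z. (t, y) \<in> G s x \<and> \<theta> t y = Some z \<and> f \<in> projections S \<and> z \<in> dom (\<theta> f)}
      = {G e (act s x)}"
    using germ_self[OF s] e by blast
  then show ?thesis by (simp add: germ_category_def)
qed

text \<open>The substance is independence of the representatives. The projection f equating t and t'
  lives at y, but e, equating s and s', lives at the image of y; pulling e back along t makes the
  two comparable.\<close>

lemma ccomp_germ:
  assumes s: "s \<in> carrier S" "act t y \<in> dom (\<theta> s)" and t: "t \<in> carrier S" "y \<in> dom (\<theta> t)"
  shows "ccomp \<G> (G s (act t y)) (G t y) = G (s \<cdot> t) y"
proof -
  let ?z = "act t y"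
  have "G (s' \<cdot> t') y' = G (s \<cdot> t) y"
    if "(s', z) \<in> G s ?z" "(t', y') \<in> G t y" for s' t' y' z
  proof -
    have s': "s' \<in> carrier S" "z = ?z" "?z \<in> dom (\<theta> s')" "G s' ?z = G s ?z"
      and t': "t' \<in> carrier S" "y' = y" "y \<in> dom (\<theta> t')" "G t' y = G t y"
      using that s t by (simp_all add: mem_germ)
    obtain e where e: "e \<in> projections S" "?z \<in> dom (\<theta> e)" "s' \<cdot> e = s \<cdot> e"
      using germ_eq_iff s s' by metis
    obtain f where f: "f \<in> projections S" "y \<in> dom (\<theta> f)" "t' \<cdot> f = t \<cdot> f"
      using germ_eq_iff t t' by metis
    have ec: "e \<in> carrier S" "f \<in> carrier S" using e f by (simp_all add: projection_closed)
    \<comment> \<open>The pullback of e along t. It is defined at y because t sends y into the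
      domain of e.\<close>
    define g where "g = (e \<cdot> t)\<star>"
    have g: "g \<in> projections S" "g \<in> carrier S"
      using ec t by (simp_all add: g_def star_projection star_closed mult_closed)
    have yg: "y \<in> dom (\<theta> g)" unfolding g_def
      using ec t e by (simp add: dom_action_star dom_action_mult mult_closed)
    have "s' \<cdot> t' \<cdot> (f \<cdot> g) = s' \<cdot> (t' \<cdot> f) \<cdot> g"
      using s' t' ec g by (simp add: mult_assoc mult_closed)
    also have "\<dots> = s' \<cdot> t \<cdot> g \<cdot> f"
      using s' t ec g f by (simp add: mult_assoc mult_closed projection_commute)
    also have "s' \<cdot> t \<cdot> g = s \<cdot> t \<cdot> g"
      using s s' t e by (simp add: g_def mult_projection_left_shift)
    also have "s \<cdot> t \<cdot> g \<cdot> f = s \<cdot> t \<cdot> (f \<cdot> g)"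
      using s t ec g f by (simp add: mult_assoc mult_closed projection_commute)
    finally have eq: "s' \<cdot> t' \<cdot> (f \<cdot> g) = s \<cdot> t \<cdot> (f \<cdot> g)" .
    have "y \<in> dom (\<theta> (f \<cdot> g))" using f g yg ec by (simp add: dom_action_mult_projection)
    moreover have "f \<cdot> g \<in> projections S" using f g by (simp add: projection_mult_closed)
    moreover have "act t' y = ?z" using act_germ_cong t t' by metis
    ultimately show ?thesis
      using s s' t t' eq germ_eq_iff[of "s' \<cdot> t'" "s \<cdot> t" y y]
      by (auto simp: dom_action_mult mult_closed)
  qed
  moreover have "\<theta> t y = Some ?z" using t by (auto simp: domIff)
  ultimately have "{G (s' \<cdot> t') y' | s' t' y' z. (s', z) \<in> G s ?z \<and> (t', y') \<in> G t y \<and> \<theta> t' y' = Some z}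
      = {G (s \<cdot> t) y}"
    using germ_self[OF s] germ_self[OF t] by blast
  then show ?thesis by (simp add: germ_category_def)
qed

text \<open>Units with different base points differ, and at one base point all projections have the
  same germ, so composability is a condition on points alone.\<close>

lemma rmap_eq_dmap_iff:
  assumes "s \<in> carrier S" "z \<in> dom (\<theta> s)" "t \<in> carrier S" "y \<in> dom (\<theta> t)"
  shows "rmap \<G> (G t y) = dmap \<G> (G s z) \<longleftrightarrow> act t y = z"
proof -
  obtain e where e: "e \<in> projections S" "act t y \<in> dom (\<theta> e)"
    using projection_at act_topspace assms by metis
  have "G e (act t y) = G (s\<star>) z \<longleftrightarrow> act t y = z"
  proof
    show "G e (act t y) = G (s\<star>) z \<Longrightarrow> act t y = z"
      using assms e by (subst (asm) germ_eq_iff) (auto simp: dom_action_star projection_closed star_closed)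
    assume "act t y = z"
    then show "G e (act t y) = G (s\<star>) z"
      using assms e germ_projection_eq[of e "s\<star>" z] by (simp add: dom_action_star star_projection)
  qed
  then show ?thesis using assms e by (simp add: dmap_germ rmap_germ)
qed

lemma dmap_germ_projection:
  "\<lbrakk>e \<in> projections S; x \<in> dom (\<theta> e)\<rbrakk> \<Longrightarrow> dmap \<G> (G e x) = G e x"
  by (simp add: dmap_germ projection_closed projection_star)

lemma rmap_germ_projection:
  "\<lbrakk>e \<in> projections S; x \<in> dom (\<theta> e)\<rbrakk> \<Longrightarrow> rmap \<G> (G e x) = G e x"
  using rmap_germ[of e x e] by (simp add: action_projection projection_closed)

lemma small_category_germ: "small_category \<G>"
proof
  show "units \<G> \<subseteq> arrows \<G>" by (auto simp: units_germ intro: germ_arrow projection_closed)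
next
  fix g assume "g \<in> arrows \<G>"
  then obtain s x where g: "g = G s x" "s \<in> carrier S" "x \<in> dom (\<theta> s)" by (auto simp: arrows_germ)
  obtain e where e: "e \<in> projections S" "act s x \<in> dom (\<theta> e)"
    using projection_at act_topspace g by metis
  have es: "e \<cdot> s \<in> carrier S" "act s x \<in> dom (\<theta> e)" using e g by (simp_all add: mult_closed projection_closed)
  show "dmap \<G> g \<in> units \<G>"
    using g star_projection[of s] unfolding g(1) units_germ dmap_germ[OF g(2,3)]
    by (metis (mono_tags, lifting) dom_action_star mem_Collect_eq)
  show "rmap \<G> g \<in> units \<G>" using g e by (auto simp: rmap_germ units_germ)
  show "ccomp \<G> g (dmap \<G> g) = g"
  proof -
    have x: "act (s\<star>) x = x" "x \<in> dom (\<theta> (s\<star>))"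
      using g action_projection[of "s\<star>" x] by (simp_all add: star_projection dom_action_star)
    then have "ccomp \<G> (G s (act (s\<star>) x)) (G (s\<star>) x) = G (s \<cdot> s\<star>) x"
      using g by (intro ccomp_germ) (simp_all add: star_closed)
    then show ?thesis using g x by (simp add: dmap_germ mult_star)
  qed
  show "ccomp \<G> (rmap \<G> g) g = g"
  proof -
    have "ccomp \<G> (rmap \<G> g) g = G (e \<cdot> s) x"
      using g e by (simp add: rmap_germ ccomp_germ projection_closed)
    \<comment> \<open>The projection coming from the range moves to the right of s, where it is
      defined at x and does not change the germ.\<close>
    also have "\<dots> = G (s \<cdot> (e \<cdot> s)\<star>) x" using g e projection_mult_shift by metis
    also have "\<dots> = G s x"
      using g e es
      by (intro germ_mult_projection)
        (simp_all add: star_projection dom_action_star dom_action_mult projection_closed)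
    finally show ?thesis using g by simp
  qed
next
  fix e assume "e \<in> units \<G>"
  then show "dmap \<G> e = e" "rmap \<G> e = e"
    by (auto simp: units_germ dmap_germ_projection rmap_germ_projection)
next
  fix g h assume gh: "g \<in> arrows \<G>" "h \<in> arrows \<G>" and comp: "rmap \<G> h = dmap \<G> g"
  then obtain s z t y where g: "g = G s z" "s \<in> carrier S" "z \<in> dom (\<theta> s)"
    and h: "h = G t y" "t \<in> carrier S" "y \<in> dom (\<theta> t)" by (auto simp: arrows_germ)
  then have z: "z = act t y" using comp rmap_eq_dmap_iff by metis
  have st: "s \<cdot> t \<in> carrier S" "y \<in> dom (\<theta> (s \<cdot> t))"
    using g h z by (simp_all add: mult_closed dom_action_mult)
  have gh_eq: "ccomp \<G> g h = G (s \<cdot> t) y" using g h z by (simp add: ccomp_germ)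
  show "ccomp \<G> g h \<in> arrows \<G>" using gh_eq st germ_arrow by simp
  show "dmap \<G> (ccomp \<G> g h) = dmap \<G> h"
    using gh_eq st g h
    by (simp add: dmap_germ star_projection dom_action_star dom_action_mult germ_projection_eq)
  obtain e where e: "e \<in> projections S" "act s z \<in> dom (\<theta> e)"
    using projection_at act_topspace g by metis
  moreover have "act (s \<cdot> t) y = act s z" using g h z by (simp add: act_mult)
  ultimately show "rmap \<G> (ccomp \<G> g h) = rmap \<G> g"
    using gh_eq st g by (simp add: rmap_germ[where e = e])
  fix k assume "k \<in> arrows \<G>" and comp': "rmap \<G> k = dmap \<G> h"
  then obtain u w where k: "k = G u w" "u \<in> carrier S" "w \<in> dom (\<theta> u)"
    by (auto simp: arrows_germ)
  then have y: "y = act u w" using comp' h rmap_eq_dmap_iff by metis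
  have tu: "t \<cdot> u \<in> carrier S" "w \<in> dom (\<theta> (t \<cdot> u))" "act (t \<cdot> u) w = z"
    using h k y z by (simp_all add: mult_closed dom_action_mult act_mult)
  have "ccomp \<G> (ccomp \<G> g h) k = G (s \<cdot> t \<cdot> u) w"
    using gh_eq k st y by (simp add: ccomp_germ)
  also have "\<dots> = G (s \<cdot> (t \<cdot> u)) w" using g h k by (simp add: mult_assoc)
  also have "\<dots> = ccomp \<G> g (G (t \<cdot> u) w)" using ccomp_germ[of s "t \<cdot> u" w] g tu by simp
  also have "G (t \<cdot> u) w = ccomp \<G> h k" using h k y by (simp add: ccomp_germ)
  finally show "ccomp \<G> (ccomp \<G> g h) k = ccomp \<G> g (ccomp \<G> h k)" .
qed

section \<open>The germ topology\<close>

lemma open_restrict: "\<lbrakk>openin X U; e \<in> projections S\<rbrakk> \<Longrightarrow> openin X {x \<in> U. x \<in> dom (\<theta> e)}"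
  using openin_Int[OF _ open_dom_action[OF projection_closed]] by (simp add: Int_def)

text \<open>If two basic sets share a germ, one projection e equates s and t there; on the open set
  \<open>dom (\<theta> e)\<close> the germs agree throughout, which gives a smaller basic
  set.\<close>

lemma istopology_germ:
  "istopology (arbitrary union_of (\<lambda>W. \<exists>s\<in>carrier S. \<exists>U.
     openin X U \<and> U \<subseteq> dom (\<theta> (s\<star>)) \<and> W = G s ` U))"
  unfolding istopology_base_eq arbitrary_union_of_alt
proof (intro allI impI ballI)
  fix A B g
  let ?P = "\<lambda>W. \<exists>s\<in>carrier S. \<exists>U. openin X U \<and> U \<subseteq> dom (\<theta> (s\<star>)) \<and> W = G s ` U"
  assume "?P A \<and> ?P B" "g \<in> A \<inter> B"
  then obtain s t U V x y where s: "s \<in> carrier S" "openin X U" "U \<subseteq> dom (\<theta> (s\<star>))" "x \<in> U"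
    and t: "t \<in> carrier S" "openin X V" "V \<subseteq> dom (\<theta> (t\<star>))" "y \<in> V"
    and A: "A = G s ` U" "B = G t ` V" and g: "g = G s x" "G s x = G t y"
    by auto
  have U: "U \<subseteq> dom (\<theta> s)" and V: "V \<subseteq> dom (\<theta> t)" using s t by (simp_all add: dom_action_star)
  then obtain e where e: "x = y" "e \<in> projections S" "x \<in> dom (\<theta> e)" "s \<cdot> e = t \<cdot> e"
    using g s t germ_eq_iff[of s t x y] by auto
  let ?W = "{z \<in> U \<inter> V. z \<in> dom (\<theta> e)}"
  have "G s z = G t z" if "z \<in> ?W" for z
    using that U V e s t germ_eq_iff[of s t z z] by auto
  then have "G s ` ?W \<subseteq> G s ` U \<inter> G t ` V" by auto
  moreover have "G s x \<in> G s ` ?W" using s t e by auto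
  moreover have "openin X ?W" using s t e by (intro open_restrict openin_Int)
  moreover have "?W \<subseteq> dom (\<theta> (s\<star>))" using s by auto
  ultimately show "\<exists>W. ?P W \<and> g \<in> W \<and> W \<subseteq> A \<inter> B"
    using s(1) g A by (intro exI[of _ "G s ` ?W"]) auto
qed

text \<open>Turns openness and continuity for germs into statements about X. The forward direction
  rests on the spreading of germ equality over a neighbourhood.\<close>

lemma openin_germ_iff:
  "openin (ctop \<G>) W \<longleftrightarrow>
     W \<subseteq> arrows \<G> \<and> (\<forall>s\<in>carrier S. openin X {x \<in> dom (\<theta> s). G s x \<in> W})"
proof -
  have op: "openin (ctop \<G>) W \<longleftrightarrow> (\<forall>g\<in>W. \<exists>V. (\<exists>s\<in>carrier S. \<exists>U.
     openin X U \<and> U \<subseteq> dom (\<theta> (s\<star>)) \<and> V = G s ` U) \<and> g \<in> V \<and> V \<subseteq> W)"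
    unfolding germ_category_def top_category.simps topology_inverse'[OF istopology_germ]
      arbitrary_union_of_alt ..
  show ?thesis
  proof (intro iffI conjI ballI)
    assume W: "openin (ctop \<G>) W"
    show "W \<subseteq> arrows \<G>"
    proof
      fix g assume "g \<in> W"
      then obtain s U where "s \<in> carrier S" "U \<subseteq> dom (\<theta> (s\<star>))" "g \<in> G s ` U" using W op by metis
      then show "g \<in> arrows \<G>" using germ_arrow by (auto simp: dom_action_star)
    qed
    fix s assume s: "s \<in> carrier S"
    show "openin X {x \<in> dom (\<theta> s). G s x \<in> W}"
    proof (subst openin_subopen, clarify)
      fix x assume x: "x \<in> dom (\<theta> s)" "G s x \<in> W"
      then obtain t U where t: "t \<in> carrier S" "openin X U" "U \<subseteq> dom (\<theta> (t\<star>))"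
        "G s x \<in> G t ` U" "G t ` U \<subseteq> W" using W op by metis
      then have U: "U \<subseteq> dom (\<theta> t)" by (simp add: dom_action_star)
      obtain y where y: "y \<in> U" "G s x = G t y" using t by blast
      then obtain e where e: "y = x" "e \<in> projections S" "x \<in> dom (\<theta> e)" "s \<cdot> e = t \<cdot> e"
        using s x t(1) subsetD[OF U y(1)] germ_eq_iff[of s t x y] by auto
      let ?V = "{z \<in> U \<inter> dom (\<theta> s). z \<in> dom (\<theta> e)}"
      have "G s z \<in> W" if "z \<in> ?V" for z
      proof -
        have "G s z = G t z" using that U e s t germ_eq_iff[of s t z z] by auto
        then show ?thesis using that t by auto
      qed
      moreover have "openin X ?V" using s t e by (intro open_restrict openin_Int open_dom_action)
      ultimately show "\<exists>T. openin X T \<and> x \<in> T \<and> T \<subseteq> {x \<in> dom (\<theta> s). G s x \<in> W}"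
        using x y e by (intro exI[of _ ?V]) auto
    qed
  next
    assume W: "W \<subseteq> arrows \<G> \<and> (\<forall>s\<in>carrier S. openin X {x \<in> dom (\<theta> s). G s x \<in> W})"
    show "openin (ctop \<G>) W"
      unfolding op
    proof
      fix g assume g: "g \<in> W"
      then obtain s x where s: "g = G s x" "s \<in> carrier S" "x \<in> dom (\<theta> s)" using W by (auto simp: arrows_germ)
      let ?U = "{x \<in> dom (\<theta> s). G s x \<in> W}"
      have "openin X ?U" "?U \<subseteq> dom (\<theta> (s\<star>))" "g \<in> G s ` ?U" "G s ` ?U \<subseteq> W"
        using W s g by (auto simp: dom_action_star)
      then show "\<exists>V. (\<exists>s\<in>carrier S. \<exists>U. openin X U \<and> U \<subseteq> dom (\<theta> (s\<star>)) \<and> V = G s ` U) \<and> g \<in> V \<and> V \<subseteq> W"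
        using s(2) by blast
    qed
  qed
qed

lemma open_germs:
  assumes s: "s \<in> carrier S" and U: "openin X U" "U \<subseteq> dom (\<theta> s)"
  shows "openin (ctop \<G>) (G s ` U)"
  unfolding germ_category_def top_category.simps topology_inverse'[OF istopology_germ]
  using assms by (intro union_of_inc) (auto simp: arbitrary_def dom_action_star)

lemma topspace_germ: "topspace (ctop \<G>) = arrows \<G>"
proof
  show "topspace (ctop \<G>) \<subseteq> arrows \<G>" using openin_germ_iff openin_topspace by blast
  show "arrows \<G> \<subseteq> topspace (ctop \<G>)"
  proof
    fix g assume "g \<in> arrows \<G>"
    then obtain s x where s: "g = G s x" "s \<in> carrier S" "x \<in> dom (\<theta> s)" by (auto simp: arrows_germ)
    then have "g \<in> G s ` dom (\<theta> s)" by blast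
    then show "g \<in> topspace (ctop \<G>)"
      using openin_subset[OF open_germs[of s "dom (\<theta> s)"]] s open_dom_action by blast
  qed
qed

lemma continuous_germ: "s \<in> carrier S \<Longrightarrow> continuous_map (subtopology X (dom (\<theta> s))) (ctop \<G>) (G s)"
  using dom_action_topspace[of s] germ_arrow[of s] open_dom_action[of s]
  by (auto simp: continuous_map_def topspace_germ Int_absorb1 openin_germ_iff openin_open_subtopology)

lemma continuous_dmap_germ: "continuous_map (ctop \<G>) (unit_space \<G>) (dmap \<G>)"
  unfolding unit_space_def
proof (rule continuous_map_into_subtopology)
  interpret small_category \<G> by (rule small_category_germ)
  show "dmap \<G> \<in> topspace (ctop \<G>) \<rightarrow> units \<G>" using dmap_closed by (auto simp: topspace_germ)
  show "continuous_map (ctop \<G>) (ctop \<G>) (dmap \<G>)"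
    unfolding continuous_map_def topspace_germ
  proof (intro conjI allI impI)
    show "dmap \<G> \<in> arrows \<G> \<rightarrow> arrows \<G>" using dmap_closed units_subset by auto
    fix W assume W: "openin (ctop \<G>) W"
    have "{x \<in> dom (\<theta> s). G s x \<in> {g \<in> arrows \<G>. dmap \<G> g \<in> W}} = {x \<in> dom (\<theta> (s\<star>)). G (s\<star>) x \<in> W}"
      if "s \<in> carrier S" for s
      using that by (auto simp: dom_action_star germ_arrow dmap_germ)
    then show "openin (ctop \<G>) {g \<in> arrows \<G>. dmap \<G> g \<in> W}"
      using W by (auto simp: openin_germ_iff star_closed)
  qed
qed

lemma continuous_rmap_germ: "continuous_map (ctop \<G>) (unit_space \<G>) (rmap \<G>)"
  unfolding unit_space_def
proof (rule continuous_map_into_subtopology)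
  interpret small_category \<G> by (rule small_category_germ)
  show "rmap \<G> \<in> topspace (ctop \<G>) \<rightarrow> units \<G>" using rmap_closed by (auto simp: topspace_germ)
  show "continuous_map (ctop \<G>) (ctop \<G>) (rmap \<G>)"
    unfolding continuous_map_def topspace_germ
  proof (intro conjI allI impI)
    show "rmap \<G> \<in> arrows \<G> \<rightarrow> arrows \<G>" using rmap_closed units_subset by auto
    fix W assume W: "openin (ctop \<G>) W"
    have "openin X {x \<in> dom (\<theta> s). G s x \<in> {g \<in> arrows \<G>. rmap \<G> g \<in> W}}"
      if s: "s \<in> carrier S" for s
    proof (subst openin_subopen, clarify)
      \<comment> \<open>With e chosen at the image of x, the range map is given by germs of the
        fixed e at all points that s sends into \<open>dom (\<theta> e)\<close>.\<close>
      fix x assume x: "x \<in> dom (\<theta> s)" "rmap \<G> (G s x) \<in> W"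
      obtain e where e: "e \<in> projections S" "act s x \<in> dom (\<theta> e)"
        using projection_at act_topspace s x by metis
      let ?V = "{y \<in> dom (\<theta> e). G e y \<in> W}"
      let ?T = "{y \<in> topspace (subtopology X (dom (\<theta> s))). act s y \<in> ?V}"
      have "openin X ?V" using W e by (simp add: openin_germ_iff projection_closed)
      then have "openin (subtopology X (dom (\<theta> s))) ?T"
        by (rule openin_continuous_map_preimage[OF continuous_action[OF s]])
      then have "openin X ?T" using open_dom_action[OF s] openin_trans_full by blast
      moreover have "x \<in> ?T"
        using x e s rmap_germ subsetD[OF dom_action_topspace[OF s] x(1)] by auto
      moreover have "?T \<subseteq> {x \<in> dom (\<theta> s). G s x \<in> {g \<in> arrows \<G>. rmap \<G> g \<in> W}}"
        using s e by (auto simp: germ_arrow rmap_germ)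
      ultimately show "\<exists>T. openin X T \<and> x \<in> T \<and>
          T \<subseteq> {x \<in> dom (\<theta> s). G s x \<in> {g \<in> arrows \<G>. rmap \<G> g \<in> W}}" by blast
    qed
    then show "openin (ctop \<G>) {g \<in> arrows \<G>. rmap \<G> g \<in> W}" by (auto simp: openin_germ_iff)
  qed
qed

lemma composable_germE:
  assumes "(g, h) \<in> composable \<G>"
  obtains s t y where "s \<in> carrier S" "t \<in> carrier S" "y \<in> dom (\<theta> t)" "act t y \<in> dom (\<theta> s)"
    "g = G s (act t y)" "h = G t y"
proof -
  obtain s z t y where "g = G s z" "s \<in> carrier S" "z \<in> dom (\<theta> s)" "h = G t y" "t \<in> carrier S" "y \<in> dom (\<theta> t)"
    and "rmap \<G> h = dmap \<G> g"
    using assms by (auto simp: composable_def arrows_germ)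
  then show ?thesis using that rmap_eq_dmap_iff by metis
qed

text \<open>A rectangle of basic sets around a composable pair suffices: composability forces the
  first base point to be the image of the second under t, so every composite in it is a germ of the
  same element \<open>s \<cdot> t\<close>.\<close>

lemma continuous_comp_germ:
  "continuous_map (subtopology (prod_topology (ctop \<G>) (ctop \<G>)) (composable \<G>)) (ctop \<G>)
     (\<lambda>(x, y). ccomp \<G> x y)"
proof -
  interpret small_category \<G> by (rule small_category_germ)
  let ?Y = "subtopology (prod_topology (ctop \<G>) (ctop \<G>)) (composable \<G>)"
  have top: "topspace ?Y = composable \<G>" by (auto simp: topspace_germ composable_def)
  show ?thesis
    unfolding continuous_map_def top topspace_germ
  proof (intro conjI allI impI)
    show "(\<lambda>(x, y). ccomp \<G> x y) \<in> composable \<G> \<rightarrow> arrows \<G>"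
      using comp_closed by (auto simp: composable_def)
    fix W assume W: "openin (ctop \<G>) W"
    show "openin ?Y {p \<in> composable \<G>. (case p of (x, y) \<Rightarrow> ccomp \<G> x y) \<in> W}"
    proof (subst openin_subopen, clarify)
      fix g h assume gh: "(g, h) \<in> composable \<G>" "ccomp \<G> g h \<in> W"
      then obtain s t y where s: "s \<in> carrier S" "t \<in> carrier S" "y \<in> dom (\<theta> t)" "act t y \<in> dom (\<theta> s)"
        "g = G s (act t y)" "h = G t y" by (elim composable_germE) blast
      let ?U = "{z \<in> dom (\<theta> (s \<cdot> t)). G (s \<cdot> t) z \<in> W}"
      let ?A = "G s ` dom (\<theta> s)" and ?B = "G t ` ?U"
      have A: "openin (ctop \<G>) ?A" using s by (intro open_germs open_dom_action) auto
      have "openin X ?U" using W s mult_closed unfolding openin_germ_iff by blast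
      then have B: "openin (ctop \<G>) ?B"
        using s by (intro open_germs) (auto simp: dom_action_mult)
      have "openin ?Y ((?A \<times> ?B) \<inter> composable \<G>)"
        using A B by (intro openin_subtopology_Int) (simp add: openin_prod_Times_iff)
      moreover have "(g, h) \<in> (?A \<times> ?B) \<inter> composable \<G>"
        using gh s by (auto simp: dom_action_mult ccomp_germ)
      moreover have "ccomp \<G> g' h' \<in> W" if h': "(g', h') \<in> (?A \<times> ?B) \<inter> composable \<G>" for g' h'
      proof -
        obtain z y' where z: "z \<in> dom (\<theta> s)" "g' = G s z"
          and y': "y' \<in> dom (\<theta> (s \<cdot> t))" "G (s \<cdot> t) y' \<in> W" "h' = G t y'"
          using h' by auto
        have y't: "y' \<in> dom (\<theta> t)" "act t y' \<in> dom (\<theta> s)" using y' s by (simp_all add: dom_action_mult)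
        have "rmap \<G> h' = dmap \<G> g'" using h' by (simp add: composable_def)
        then have "z = act t y'" using rmap_eq_dmap_iff[of s z t y'] z y' y't s by simp
        then show ?thesis using z y' y't s by (simp add: ccomp_germ)
      qed
      ultimately show "\<exists>T. openin ?Y T \<and> (g, h) \<in> T \<and>
          T \<subseteq> {p \<in> composable \<G>. (case p of (x, y) \<Rightarrow> ccomp \<G> x y) \<in> W}"
        by (intro exI[of _ "(?A \<times> ?B) \<inter> composable \<G>"]) auto
    qed
  qed
qed

lemma topological_category_germ: "topological_category \<G>"
  by (intro topological_category.intro topological_category_axioms.intro small_category_germ
      topspace_germ continuous_dmap_germ continuous_rmap_germ continuous_comp_germ)

lemma open_dmap_germ:
  assumes V: "openin (ctop \<G>) V"
  shows "openin (unit_space \<G>) (dmap \<G> ` V)"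
proof -
  interpret small_category \<G> by (rule small_category_germ)
  have Va: "V \<subseteq> arrows \<G>" using V by (simp add: openin_germ_iff)
  have sub: "dmap \<G> ` V \<subseteq> units \<G>" using Va dmap_closed by auto
  have "openin X {x \<in> dom (\<theta> t). G t x \<in> dmap \<G> ` V}" if t: "t \<in> carrier S" for t
  proof (subst openin_subopen, clarify)
    fix x g assume x: "x \<in> dom (\<theta> t)" "G t x = dmap \<G> g" "g \<in> V"
    obtain s y where s: "g = G s y" "s \<in> carrier S" "y \<in> dom (\<theta> s)" using Va x(3) by (auto simp: arrows_germ)
    then obtain e where e: "x = y" "e \<in> projections S" "x \<in> dom (\<theta> e)" "t \<cdot> e = s\<star> \<cdot> e"
      using x t germ_eq_iff[of t "s\<star>" x y] by (auto simp: dmap_germ star_closed dom_action_star)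
    let ?T = "{z \<in> {z \<in> dom (\<theta> s). G s z \<in> V} \<inter> dom (\<theta> t). z \<in> dom (\<theta> e)}"
    have "openin X ?T" using V s(2) t e by (intro open_restrict openin_Int open_dom_action) (auto simp: openin_germ_iff)
    moreover have "x \<in> ?T" using x s e by simp
    moreover have "G t z \<in> dmap \<G> ` V" if "z \<in> ?T" for z
    proof -
      have "G t z = G (s\<star>) z"
        using that t s e germ_eq_iff[of t "s\<star>" z z] by (auto simp: star_closed dom_action_star)
      also have "\<dots> = dmap \<G> (G s z)" using that s by (simp add: dmap_germ)
      finally show ?thesis using that by auto
    qed
    ultimately show "\<exists>T. openin X T \<and> x \<in> T \<and> T \<subseteq> {x \<in> dom (\<theta> t). G t x \<in> dmap \<G> ` V}"
      by (intro exI[of _ ?T]) auto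
  qed
  then have "openin (ctop \<G>) (dmap \<G> ` V)" using sub units_subset by (auto simp: openin_germ_iff)
  then have "openin (unit_space \<G>) (dmap \<G> ` V \<inter> units \<G>)"
    unfolding unit_space_def by (rule openin_subtopology_Int)
  then show ?thesis using sub by (simp add: Int_absorb2)
qed

lemma inj_dmap_germs: "\<lbrakk>s \<in> carrier S; U \<subseteq> dom (\<theta> s)\<rbrakk> \<Longrightarrow> inj_on (dmap \<G>) (G s ` U)"
  by (auto simp: inj_on_def dmap_germ germ_eq_iff star_closed dom_action_star subset_iff)

text \<open>Transfers local compactness and the Hausdorff property from X to the units of the
  category.\<close>

lemma unit_space_homeomorphic: "X homeomorphic_space unit_space \<G>"
proof -
  interpret topological_category \<G> by (rule topological_category_germ)
  \<comment> \<open>The choice of e is harmless: all projections defined at x have the same germ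
    there.\<close>
  define unit_at where "unit_at x = G (SOME e. e \<in> projections S \<and> x \<in> dom (\<theta> e)) x" for x
  have unit_at: "unit_at x = G e x" if "e \<in> projections S" "x \<in> dom (\<theta> e)" for e x
  proof -
    have "\<exists>e. e \<in> projections S \<and> x \<in> dom (\<theta> e)" using that by blast
    from someI_ex[OF this] show ?thesis using that germ_projection_eq unfolding unit_at_def by blast
  qed
  have top: "topspace (unit_space \<G>) = units \<G>"
    using units_subset by (auto simp: unit_space_def topspace_germ)
  have im: "unit_at ` topspace X = units \<G>"
  proof (intro equalityI subsetI)
    fix g assume "g \<in> unit_at ` topspace X"
    then obtain x where x: "g = unit_at x" "x \<in> topspace X" by blast
    obtain e where "e \<in> projections S" "x \<in> dom (\<theta> e)" using projection_at[OF x(2)] by blast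
    then show "g \<in> units \<G>" using x unit_at by (auto simp: units_germ)
  next
    fix g assume "g \<in> units \<G>"
    then obtain e x where e: "g = G e x" "e \<in> projections S" "x \<in> dom (\<theta> e)" by (auto simp: units_germ)
    then have "x \<in> topspace X" using dom_action_topspace projection_closed by blast
    then show "g \<in> unit_at ` topspace X" using e unit_at by auto
  qed
  have "continuous_map X (ctop \<G>) unit_at"
    unfolding continuous_map_def topspace_germ
  proof (intro conjI allI impI)
    show "unit_at \<in> topspace X \<rightarrow> arrows \<G>" using im units_subset by auto
    fix W assume W: "openin (ctop \<G>) W"
    show "openin X {x \<in> topspace X. unit_at x \<in> W}"
    proof (subst openin_subopen, clarify)
      fix x assume x: "x \<in> topspace X" "unit_at x \<in> W"
      obtain e where e: "e \<in> projections S" "x \<in> dom (\<theta> e)" using projection_at[OF x(1)] by blast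
      let ?T = "{y \<in> dom (\<theta> e). G e y \<in> W}"
      have "openin X ?T" using W e by (simp add: openin_germ_iff projection_closed)
      moreover have "x \<in> ?T" using e x unit_at by simp
      moreover have "?T \<subseteq> {x \<in> topspace X. unit_at x \<in> W}"
        using e(1) unit_at dom_action_topspace[OF projection_closed[OF e(1)]] by auto
      ultimately show "\<exists>T. openin X T \<and> x \<in> T \<and> T \<subseteq> {x \<in> topspace X. unit_at x \<in> W}" by blast
    qed
  qed
  then have cont: "continuous_map X (unit_space \<G>) unit_at"
    unfolding unit_space_def by (rule continuous_map_into_subtopology) (use im in auto)
  have op: "openin (unit_space \<G>) (unit_at ` V)" if V: "openin X V" for V
  proof -
    have "openin (ctop \<G>) (unit_at ` V)"
    proof (subst openin_subopen, clarify)
      fix x assume x: "x \<in> V"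
      then have "x \<in> topspace X" using V openin_subset by blast
      then obtain e where e: "e \<in> projections S" "x \<in> dom (\<theta> e)" using projection_at by blast
      let ?T = "{y \<in> V. y \<in> dom (\<theta> e)}"
      have "openin (ctop \<G>) (G e ` ?T)" using V e by (intro open_germs open_restrict projection_closed) auto
      moreover have "unit_at x \<in> G e ` ?T" using x e unit_at by auto
      moreover have "G e y \<in> unit_at ` V" if "y \<in> ?T" for y
        using that unit_at[OF e(1), of y] by (auto simp flip: unit_at)
      ultimately show "\<exists>T. openin (ctop \<G>) T \<and> unit_at x \<in> T \<and> T \<subseteq> unit_at ` V"
        by (intro exI[of _ "G e ` ?T"]) auto
    qed
    then have "openin (unit_space \<G>) (unit_at ` V \<inter> units \<G>)"
      unfolding unit_space_def by (rule openin_subtopology_Int)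
    moreover have "unit_at ` V \<subseteq> units \<G>" using im openin_subset[OF V] by blast
    ultimately show ?thesis by (simp add: Int_absorb2)
  qed
  have inj: "inj_on unit_at (topspace X)"
  proof (rule inj_onI)
    fix x y assume xy: "x \<in> topspace X" "y \<in> topspace X" "unit_at x = unit_at y"
    obtain e f where "e \<in> projections S" "x \<in> dom (\<theta> e)" "f \<in> projections S" "y \<in> dom (\<theta> f)"
      using projection_at[OF xy(1)] projection_at[OF xy(2)] by metis
    then show "x = y" using xy(3) unit_at germ_eq_iff projection_closed by metis
  qed
  have "homeomorphic_map X (unit_space \<G>) unit_at"
    using cont op inj im top by (intro bijective_open_imp_homeomorphic_map) (simp_all add: open_map_def)
  then show ?thesis by (rule homeomorphic_map_imp_homeomorphic_space)
qed

theorem etale_category_germ: "etale_category \<G>"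
proof (intro etale_category.intro etale_category_axioms.intro topological_category_germ)
  interpret topological_category \<G> by (rule topological_category_germ)
  show "locally_compact_space (unit_space \<G>)"
    using locally_compact homeomorphic_locally_compact_space[OF unit_space_homeomorphic] by blast
  show "Hausdorff_space (unit_space \<G>)"
    using Hausdorff homeomorphic_Hausdorff_space[OF unit_space_homeomorphic] by blast
  have "dmap \<G> ` arrows \<G> = units \<G>"
    using dmap_closed dmap_unit units_subset by force
  moreover have "topspace (unit_space \<G>) = units \<G>"
    using units_subset by (auto simp: unit_space_def topspace_germ)
  ultimately have eq: "subtopology (unit_space \<G>) (dmap \<G> ` arrows \<G>) = unit_space \<G>"
    by (metis subtopology_topspace)
  show "local_homeomorphism (ctop \<G>) (subtopology (unit_space \<G>) (dmap \<G> ` arrows \<G>)) (dmap \<G>)"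
    unfolding eq local_homeomorphism_def topspace_germ
  proof
    fix g assume "g \<in> arrows \<G>"
    then obtain s x where s: "g = G s x" "s \<in> carrier S" "x \<in> dom (\<theta> s)" by (auto simp: arrows_germ)
    let ?U = "G s ` dom (\<theta> s)"
    have U: "openin (ctop \<G>) ?U" using s by (intro open_germs open_dom_action) auto
    moreover have "homeomorphic_map (subtopology (ctop \<G>) ?U) (subtopology (unit_space \<G>) (dmap \<G> ` ?U)) (dmap \<G>)"
      using U s by (intro homeomorphic_map_open_inj continuous_dmap_germ open_dmap_germ inj_dmap_germs) auto
    ultimately show "\<exists>U. openin (ctop \<G>) U \<and> g \<in> U \<and> openin (unit_space \<G>) (dmap \<G> ` U) \<and>
        homeomorphic_map (subtopology (ctop \<G>) U) (subtopology (unit_space \<G>) (dmap \<G> ` U)) (dmap \<G>)"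
      using s open_dmap_germ by blast
  qed
qed

sublocale etale_category \<G>
  by (rule etale_category_germ)

lemma compact_slice_germs:
  assumes s: "s \<in> carrier S" and K: "openin X K" "compactin X K" "K \<subseteq> dom (\<theta> s)"
  shows "compact_slice \<G> (G s ` K)"
proof -
  have "compactin (ctop \<G>) (G s ` K)"
    using continuous_germ[OF s] K
    by (intro image_compactin[where X = "subtopology X (dom (\<theta> s))"]) (simp_all add: compactin_subtopology)
  then show ?thesis using assms by (simp add: compact_slice_iff open_germs inj_dmap_germs)
qed

text \<open>A base of compact open sets lifts from X: the continuous map \<open>G s\<close> carries
  such a set inside \<open>dom (\<theta> s)\<close> to a compact slice.\<close>

lemma ample_category_germ:
  assumes base: "\<And>U x. \<lbrakk>openin X U; x \<in> U\<rbrakk> \<Longrightarrow> \<exists>K. openin X K \<and> compactin X K \<and> x \<in> K \<and> K \<subseteq> U"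
  shows "ample_category \<G>"
proof (intro ample_category.intro ample_category_axioms.intro etale_category_germ)
  have "\<exists>V. compact_slice \<G> V \<and> g \<in> V \<and> V \<subseteq> W" if W: "openin (ctop \<G>) W" "g \<in> W" for W g
  proof -
    obtain s x where s: "g = G s x" "s \<in> carrier S" "x \<in> dom (\<theta> s)"
      using W by (auto simp: openin_germ_iff arrows_germ)
    have "openin X {x \<in> dom (\<theta> s). G s x \<in> W}" using W s by (simp add: openin_germ_iff)
    then obtain K where "openin X K" "compactin X K" "x \<in> K" "K \<subseteq> {x \<in> dom (\<theta> s). G s x \<in> W}"
      using base s W by (metis (mono_tags, lifting) mem_Collect_eq)
    then show ?thesis using s by (intro exI[of _ "G s ` K"]) (auto intro!: compact_slice_germs)
  qed
  then show "openin (ctop \<G>) = arbitrary union_of (compact_slice \<G>)"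
    unfolding openin_topology_base_unique by (auto simp: compact_slice_iff)
qed

lemma germs_mult:
  assumes s: "s \<in> carrier S" "U \<subseteq> dom (\<theta> s)" and t: "t \<in> carrier S" "V \<subseteq> dom (\<theta> t)"
  shows "(G s ` U) \<cdot>\<^bsub>compact_slices \<G>\<^esub> (G t ` V) = G (s \<cdot> t) ` {y \<in> V. act t y \<in> U}"
proof (rule Set.set_eqI)
  fix g
  have comp: "rmap \<G> (G t y) = dmap \<G> (G s z) \<longleftrightarrow> z = act t y" if "z \<in> U" "y \<in> V" for z y
    using that s t rmap_eq_dmap_iff[of s z t y] by auto
  have eq: "ccomp \<G> (G s (act t y)) (G t y) = G (s \<cdot> t) y" if "act t y \<in> U" "y \<in> V" for y
    using that s t by (intro ccomp_germ) auto
  have "g \<in> (G s ` U) \<cdot>\<^bsub>compact_slices \<G>\<^esub> (G t ` V) \<longleftrightarrow>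
      (\<exists>z\<in>U. \<exists>y\<in>V. rmap \<G> (G t y) = dmap \<G> (G s z) \<and> g = ccomp \<G> (G s z) (G t y))"
    by (auto simp: compact_slices_simps)
  also have "\<dots> \<longleftrightarrow> (\<exists>y\<in>V. act t y \<in> U \<and> g = ccomp \<G> (G s (act t y)) (G t y))"
    using comp by blast
  also have "\<dots> \<longleftrightarrow> g \<in> G (s \<cdot> t) ` {y \<in> V. act t y \<in> U}" using eq by auto
  finally show "g \<in> (G s ` U) \<cdot>\<^bsub>compact_slices \<G>\<^esub> (G t ` V) \<longleftrightarrow> g \<in> G (s \<cdot> t) ` {y \<in> V. act t y \<in> U}" .
qed

lemma germs_star:
  "\<lbrakk>s \<in> carrier S; U \<subseteq> dom (\<theta> s)\<rbrakk> \<Longrightarrow> (G s ` U)\<star>\<^bsub>compact_slices \<G>\<^esub> = G (s\<star>) ` U"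
  by (auto simp: compact_slices_simps image_image dmap_germ subset_iff cong: image_cong_simp)

end

section \<open>The character space of the projections\<close>

context restriction_semigroup
begin

abbreviation E where "E \<equiv> projections S"
abbreviation D where "D \<equiv> projection_char_set S"

section \<open>Topology of the character space\<close>

lemma mem_D: "\<phi> \<in> D e \<longleftrightarrow> \<phi> \<in> characters E (rmult S) \<and> \<phi> e"
  by (simp add: projection_char_set_def char_set_def)

lemma char_mult:
  "\<lbrakk>\<phi> \<in> characters E (rmult S); e \<in> E; f \<in> E\<rbrakk> \<Longrightarrow> \<phi> (e \<cdot> f) \<longleftrightarrow> \<phi> e \<and> \<phi> f"
  by (rule charactersD(2))

text \<open>The given base only allows removing sets of projections below e. Inside
  \<open>D e\<close> removing \<open>D f\<close> and removing \<open>D (f \<cdot> e)\<close> have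
  the same effect, so arbitrary finite F may be used from here on.\<close>

lemma D_basic_absorb:
  assumes "e \<in> E" "F \<subseteq> E"
  shows "D e - (\<Union>f\<in>F. D f) = D e - (\<Union>f\<in>(\<lambda>f. f \<cdot> e) ` F. D f)"
  using assms by (auto simp: mem_D char_mult subset_iff)

lemma D_basic:
  assumes "e \<in> E" "finite F" "F \<subseteq> E"
  shows "\<exists>e'\<in>E. \<exists>F'. finite F' \<and> F' \<subseteq> {f \<in> E. f = f \<cdot> e'} \<and>
    D e - (\<Union>f\<in>F. D f) = char_set E (rmult S) e' - (\<Union>f\<in>F'. char_set E (rmult S) f)"
  using assms D_basic_absorb[OF assms(1,3)]
  by (intro bexI[of _ e] exI[of _ "(\<lambda>f. f \<cdot> e) ` F"])
    (auto simp: projection_char_set_def projection_mult_closed projection_assoc projection_idem)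

lemma istopology_chars:
  "istopology (arbitrary union_of (\<lambda>W. \<exists>e\<in>E. \<exists>F. finite F \<and> F \<subseteq> {f \<in> E. f = f \<cdot> e} \<and>
     W = char_set E (rmult S) e - (\<Union>f\<in>F. char_set E (rmult S) f)))"
proof (rule istopology_base)
  let ?P = "\<lambda>W. \<exists>e\<in>E. \<exists>F. finite F \<and> F \<subseteq> {f \<in> E. f = f \<cdot> e} \<and>
     W = char_set E (rmult S) e - (\<Union>f\<in>F. char_set E (rmult S) f)"
  fix A B assume "?P A" "?P B"
  then obtain e F e' F' where e: "e \<in> E" "finite F" "F \<subseteq> E" and A: "A = D e - (\<Union>f\<in>F. D f)"
    and e': "e' \<in> E" "finite F'" "F' \<subseteq> E" and B: "B = D e' - (\<Union>f\<in>F'. D f)"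
    unfolding projection_char_set_def by blast
  have "A \<inter> B = D (e \<cdot> e') - (\<Union>f\<in>F \<union> F'. D f)"
    using e e' by (auto simp: A B mem_D char_mult)
  then show "?P (A \<inter> B)" using D_basic[of "e \<cdot> e'" "F \<union> F'"] e e' by (simp add: projection_mult_closed)
qed

lemma openin_chars_basic:
  "\<lbrakk>e \<in> E; finite F; F \<subseteq> E\<rbrakk> \<Longrightarrow> openin (projection_space S) (D e - (\<Union>f\<in>F. D f))"
  unfolding projection_space_def char_topology_def topology_inverse'[OF istopology_chars]
  by (rule union_of_inc) (use D_basic in \<open>simp_all add: arbitrary_def\<close>)

lemma openin_D: "e \<in> E \<Longrightarrow> openin (projection_space S) (D e)"
  using openin_chars_basic[of e "{}"] by simp

lemma openin_charsE:
  assumes "openin (projection_space S) W" "\<phi> \<in> W"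
  obtains e F where "e \<in> E" "finite F" "F \<subseteq> E" "\<phi> \<in> D e - (\<Union>f\<in>F. D f)"
    "D e - (\<Union>f\<in>F. D f) \<subseteq> W" "\<And>f. f \<in> F \<Longrightarrow> f = f \<cdot> e"
proof -
  have "\<exists>V. (\<exists>e\<in>E. \<exists>F. finite F \<and> F \<subseteq> {f \<in> E. f = f \<cdot> e} \<and>
     V = char_set E (rmult S) e - (\<Union>f\<in>F. char_set E (rmult S) f)) \<and> \<phi> \<in> V \<and> V \<subseteq> W"
    using assms unfolding projection_space_def char_topology_def topology_inverse'[OF istopology_chars]
      arbitrary_union_of_alt by (rule bspec)
  then obtain e F where "e \<in> E" "finite F" "F \<subseteq> {f \<in> E. f = f \<cdot> e}"
    "\<phi> \<in> D e - (\<Union>f\<in>F. D f)" "D e - (\<Union>f\<in>F. D f) \<subseteq> W"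
    unfolding projection_char_set_def by (elim exE bexE conjE) simp
  then show ?thesis by (intro that) auto
qed

lemma topspace_chars: "topspace (projection_space S) = characters E (rmult S)"
proof
  show "topspace (projection_space S) \<subseteq> characters E (rmult S)"
  proof
    fix \<phi> assume "\<phi> \<in> topspace (projection_space S)"
    then obtain e F where "\<phi> \<in> D e - (\<Union>f\<in>F. D f)"
      using openin_charsE[OF openin_topspace] by metis
    then show "\<phi> \<in> characters E (rmult S)" by (simp add: mem_D)
  qed
  show "characters E (rmult S) \<subseteq> topspace (projection_space S)"
  proof
    fix \<phi> assume \<phi>: "\<phi> \<in> characters E (rmult S)"
    then obtain e where "e \<in> E" "\<phi> \<in> D e" using charactersD(3)[OF \<phi>] by (auto simp: mem_D)
    then show "\<phi> \<in> topspace (projection_space S)" using openin_subset[OF openin_D] by blast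
  qed
qed

lemma open_cylinder:
  assumes "finite A"
  shows "openin (product_topology (\<lambda>_. discrete_topology UNIV) UNIV) {\<psi> :: 'x \<Rightarrow> bool. \<forall>a\<in>A. \<psi> a = \<phi> a}"
proof -
  let ?Y = "product_topology (\<lambda>_ :: 'x. discrete_topology (UNIV :: bool set)) UNIV"
  have top: "topspace ?Y = UNIV" by simp
  have "openin ?Y {\<psi> \<in> topspace ?Y. \<psi> a \<in> {\<phi> a}}" for a
    by (rule openin_continuous_map_preimage[OF continuous_map_product_projection]) simp_all
  then have "openin ?Y ((\<Inter>a\<in>A. {\<psi> \<in> topspace ?Y. \<psi> a \<in> {\<phi> a}}) \<inter> topspace ?Y)"
    using assms by (intro openin_INT) auto
  moreover have "(\<Inter>a\<in>A. {\<psi> \<in> topspace ?Y. \<psi> a \<in> {\<phi> a}}) \<inter> topspace ?Y = {\<psi>. \<forall>a\<in>A. \<psi> a = \<phi> a}"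
    unfolding top by auto
  ultimately show ?thesis by simp
qed

text \<open>As a subset of the cube of all maps to \<open>bool\<close>, \<open>D e\<close> is
  closed, hence compact; the identity from there to the character space is continuous, since
  membership in a basic set depends on finitely many values.\<close>

lemma compactin_D:
  assumes e: "e \<in> E"
  shows "compactin (projection_space S) (D e)"
proof -
  let ?Y = "product_topology (\<lambda>_ :: 'a. discrete_topology (UNIV :: bool set)) UNIV"
  let ?cyl = "\<lambda>A \<phi>. {\<psi> :: 'a \<Rightarrow> bool. \<forall>a\<in>A. \<psi> a = \<phi> a}"
  have "compact_space ?Y"
    by (simp add: compact_space_product_topology compact_space_discrete_topology)
  moreover have "closedin ?Y (D e)"
    unfolding closedin_def
  proof (intro conjI)
    show "openin ?Y (topspace ?Y - D e)"
    proof (subst openin_subopen, intro ballI)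
      fix \<phi> assume "\<phi> \<in> topspace ?Y - D e"
      then have "\<phi> \<notin> D e" by simp
      \<comment> \<open>Each way of failing is witnessed by finitely many coordinates. The existence
        clause in \<open>characters\<close> is not of this kind, but it follows from the value at
        e.\<close>
      then have "\<not> \<phi> e \<or> (\<exists>a. a \<notin> E \<and> \<phi> a) \<or> (\<exists>a\<in>E. \<exists>b\<in>E. \<phi> (a \<cdot> b) \<noteq> (\<phi> a \<and> \<phi> b))"
        using e by (auto simp: mem_D characters_def)
      then have "\<exists>A. finite A \<and> ?cyl A \<phi> \<inter> D e = {}"
      proof (elim disjE exE conjE bexE)
        assume "\<not> \<phi> e" then show ?thesis by (intro exI[of _ "{e}"]) (auto simp: mem_D)
      next
        fix a assume "a \<notin> E" "\<phi> a"
        then show ?thesis by (intro exI[of _ "{a}"]) (auto simp: mem_D characters_def)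
      next
        fix a b assume "a \<in> E" "b \<in> E" "\<phi> (a \<cdot> b) \<noteq> (\<phi> a \<and> \<phi> b)"
        then show ?thesis by (intro exI[of _ "{a \<cdot> b, a, b}"]) (auto simp: mem_D char_mult)
      qed
      then obtain A where "finite A" "?cyl A \<phi> \<inter> D e = {}" by blast
      then show "\<exists>T. openin ?Y T \<and> \<phi> \<in> T \<and> T \<subseteq> topspace ?Y - D e"
        by (intro exI[of _ "?cyl A \<phi>"]) (auto intro: open_cylinder)
    qed
  qed simp
  ultimately have "compactin ?Y (D e)" by (rule closedin_compact_space)
  then have "compactin (subtopology ?Y (D e)) (D e)" by (simp add: compactin_subtopology)
  moreover have "continuous_map (subtopology ?Y (D e)) (projection_space S) id"
    unfolding continuous_map_def
  proof (intro conjI allI impI)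
    show "id \<in> topspace (subtopology ?Y (D e)) \<rightarrow> topspace (projection_space S)"
      by (auto simp: topspace_chars mem_D)
    fix W assume W: "openin (projection_space S) W"
    show "openin (subtopology ?Y (D e)) {\<phi> \<in> topspace (subtopology ?Y (D e)). id \<phi> \<in> W}"
    proof (subst openin_subopen, intro ballI)
      fix \<phi> assume \<phi>: "\<phi> \<in> {\<phi> \<in> topspace (subtopology ?Y (D e)). id \<phi> \<in> W}"
      then have "\<phi> \<in> W" by simp
      with W obtain f F where f: "f \<in> E" "finite F" "F \<subseteq> E" "\<phi> \<in> D f - (\<Union>f\<in>F. D f)"
        "D f - (\<Union>f\<in>F. D f) \<subseteq> W" by (rule openin_charsE) blast
      let ?T = "?cyl (insert f F) \<phi> \<inter> D e"
      have "openin (subtopology ?Y (D e)) ?T"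
        using f by (intro openin_subtopology_Int open_cylinder) simp
      moreover have "\<phi> \<in> ?T" using \<phi> by simp
      moreover have "?T \<subseteq> D f - (\<Union>f\<in>F. D f)" using f(4) by (auto simp: mem_D)
      then have "?T \<subseteq> W" using f(5) by (rule subset_trans)
      then have "?T \<subseteq> {\<phi> \<in> topspace (subtopology ?Y (D e)). id \<phi> \<in> W}" by auto
      ultimately show "\<exists>T. openin (subtopology ?Y (D e)) T \<and> \<phi> \<in> T \<and>
          T \<subseteq> {\<phi> \<in> topspace (subtopology ?Y (D e)). id \<phi> \<in> W}" by (intro exI conjI)
    qed
  qed
  ultimately have "compactin (projection_space S) (id ` D e)" by (rule image_compactin)
  then show ?thesis by simp
qed

text \<open>If e distinguishes the two characters, \<open>D e\<close> contains one of them. A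
  neighbourhood of the other must lie under some projection f at which it is 1, hence
  \<open>D f - D e\<close>.\<close>

lemma Hausdorff_chars: "Hausdorff_space (projection_space S)"
proof -
  have sep: "\<exists>U V. openin (projection_space S) U \<and> openin (projection_space S) V \<and> \<phi> \<in> U \<and> \<psi> \<in> V \<and> disjnt U V"
    if \<phi>: "\<phi> \<in> characters E (rmult S)" and \<psi>: "\<psi> \<in> characters E (rmult S)" and e: "\<phi> e" "\<not> \<psi> e"
    for \<phi> \<psi> e
  proof -
    have eE: "e \<in> E" using charactersD(1)[OF \<phi>] e by blast
    obtain f where f: "f \<in> E" "\<psi> f" using charactersD(3)[OF \<psi>] by blast
    have "openin (projection_space S) (D f - (\<Union>f\<in>{e}. D f))"
      using eE f by (intro openin_chars_basic) auto
    then show ?thesis using openin_D[OF eE] \<phi> \<psi> e f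
      by (intro exI[of _ "D e"] exI[of _ "D f - D e"]) (auto simp: mem_D disjnt_def)
  qed
  show ?thesis unfolding Hausdorff_space_def topspace_chars
  proof (intro allI impI)
    fix \<phi> \<psi> assume *: "\<phi> \<in> characters E (rmult S) \<and> \<psi> \<in> characters E (rmult S) \<and> \<phi> \<noteq> \<psi>"
    then have ch: "\<phi> \<in> characters E (rmult S)" "\<psi> \<in> characters E (rmult S)" by blast+
    from * obtain e where "\<phi> e \<noteq> \<psi> e" by blast
    then consider "\<phi> e" "\<not> \<psi> e" | "\<psi> e" "\<not> \<phi> e" by blast
    then show "\<exists>U V. openin (projection_space S) U \<and> openin (projection_space S) V \<and> \<phi> \<in> U \<and> \<psi> \<in> V \<and> disjnt U V"
    proof cases
      case 1 then show ?thesis by (rule sep[OF ch])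
    next
      case 2
      from sep[OF ch(2,1) this] show ?thesis using disjnt_sym by (elim exE conjE) (intro exI conjI)
    qed
  qed
qed

lemma compactin_chars_basic:
  assumes "e \<in> E" "finite F" "F \<subseteq> E"
  shows "compactin (projection_space S) (D e - (\<Union>f\<in>F. D f))"
proof -
  let ?C = "topspace (projection_space S) - (\<Union>f\<in>F. D f)"
  have "closedin (projection_space S) ?C" using assms openin_D by (intro closedin_diff) auto
  then have "compactin (projection_space S) (D e \<inter> ?C)"
    using compactin_D[OF assms(1)] by (intro compact_Int_closedin)
  moreover have "D e \<inter> ?C = D e - (\<Union>f\<in>F. D f)" by (auto simp: topspace_chars mem_D)
  ultimately show ?thesis by simp
qed

lemma compact_open_base_chars:
  "\<lbrakk>openin (projection_space S) U; \<phi> \<in> U\<rbrakk> \<Longrightarrow>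
    \<exists>K. openin (projection_space S) K \<and> compactin (projection_space S) K \<and> \<phi> \<in> K \<and> K \<subseteq> U"
  by (erule (1) openin_charsE) (metis openin_chars_basic compactin_chars_basic)

lemma locally_compact_chars: "locally_compact_space (projection_space S)"
  unfolding locally_compact_space_def
  using compact_open_base_chars[OF openin_topspace] by (metis subset_refl)

section \<open>The action on characters\<close>

lemma dom_char_action: "dom (char_action S s) = D (s\<star>)"
  by (auto simp: char_action_def split: if_splits)

lemma char_action_apply:
  "\<phi> \<in> D (s\<star>) \<Longrightarrow> char_action S s \<phi> = Some (\<lambda>e. e \<in> E \<and> \<phi> ((e \<cdot> s)\<star>))"
  by (simp add: char_action_def)

lemma char_action_character:
  assumes units: "has_local_units S" and s: "s \<in> carrier S" and \<phi>: "\<phi> \<in> D (s\<star>)"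
  shows "(\<lambda>e. e \<in> E \<and> \<phi> ((e \<cdot> s)\<star>)) \<in> characters E (rmult S)"
proof -
  have "\<exists>e\<in>E. \<phi> ((e \<cdot> s)\<star>)" using units s \<phi> unfolding has_local_units_def mem_D by metis
  then show ?thesis
    using \<phi> s by (auto simp: characters_def mem_D star_mult_mult star_mult_in projection_mult_closed)
qed

lemma rsgrp_action_chars:
  assumes units: "has_local_units S"
  shows "rsgrp_action S (projection_space S) (char_action S)"
proof (intro rsgrp_action.intro rsgrp_action_axioms.intro restriction_semigroup_axioms
    locally_compact_chars Hausdorff_chars)
  have D: "D e \<subseteq> characters E (rmult S)" for e by (auto simp: mem_D)
  have cont: "continuous_map (subtopology (projection_space S) (D (s\<star>))) (projection_space S)
      (\<lambda>\<phi>. the (char_action S s \<phi>))" if s: "s \<in> carrier S" for s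
    unfolding continuous_map_def
  proof (intro conjI allI impI)
    have top: "topspace (subtopology (projection_space S) (D (s\<star>))) = D (s\<star>)"
      using D by (auto simp: topspace_chars)
    show "(\<lambda>\<phi>. the (char_action S s \<phi>)) \<in> topspace (subtopology (projection_space S) (D (s\<star>))) \<rightarrow> topspace (projection_space S)"
      unfolding top topspace_chars using char_action_character[OF units s] by (auto simp: char_action_apply)
    fix W assume W: "openin (projection_space S) W"
    show "openin (subtopology (projection_space S) (D (s\<star>)))
      {\<phi> \<in> topspace (subtopology (projection_space S) (D (s\<star>))). the (char_action S s \<phi>) \<in> W}"
    proof (subst openin_subopen, intro ballI)
      fix \<phi> assume "\<phi> \<in> {\<phi> \<in> topspace (subtopology (projection_space S) (D (s\<star>))). the (char_action S s \<phi>) \<in> W}"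
      then have \<phi>: "\<phi> \<in> D (s\<star>)" "the (char_action S s \<phi>) \<in> W" using top by auto
      then obtain e F where e: "e \<in> E" "finite F" "F \<subseteq> E" "the (char_action S s \<phi>) \<in> D e - (\<Union>f\<in>F. D f)"
        "D e - (\<Union>f\<in>F. D f) \<subseteq> W" using openin_charsE[OF W] by metis
      \<comment> \<open>The translate takes the value of \<psi> at
        \<open>(e \<cdot> s)\<star>\<close>, so the preimage of a basic set is again basic.\<close>
      let ?T = "D ((e \<cdot> s)\<star>) - (\<Union>f\<in>(\<lambda>f. (f \<cdot> s)\<star>) ` F. D f)"
      have ess: "(e \<cdot> s)\<star> \<cdot> s\<star> = (e \<cdot> s)\<star>" using e s by (simp add: star_mult_le projection_closed)
      then have sub: "\<psi> \<in> D (s\<star>)" if "\<psi> \<in> D ((e \<cdot> s)\<star>)" for \<psi>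
        using that e s by (metis char_mult mem_D star_mult_in star_projection)
      have iff: "\<psi> \<in> ?T \<longleftrightarrow> \<psi> \<in> D (s\<star>) \<and> the (char_action S s \<psi>) \<in> D e - (\<Union>f\<in>F. D f)" for \<psi>
        using e sub char_action_character[OF units s]
        by (cases "\<psi> \<in> D (s\<star>)") (auto simp: char_action_apply mem_D)
      have "openin (projection_space S) ?T"
        using e s star_mult_in by (intro openin_chars_basic) auto
      then have "openin (subtopology (projection_space S) (D (s\<star>))) (?T \<inter> D (s\<star>))"
        by (rule openin_subtopology_Int)
      moreover have "\<phi> \<in> ?T \<inter> D (s\<star>)" using iff \<phi> e by blast
      moreover have "?T \<inter> D (s\<star>) \<subseteq> {\<phi> \<in> topspace (subtopology (projection_space S) (D (s\<star>))). the (char_action S s \<phi>) \<in> W}"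
      proof
        fix \<psi> assume "\<psi> \<in> ?T \<inter> D (s\<star>)"
        then have "\<psi> \<in> D (s\<star>)" "the (char_action S s \<psi>) \<in> W" using iff[of \<psi>] e(5) by blast+
        then show "\<psi> \<in> {\<phi> \<in> topspace (subtopology (projection_space S) (D (s\<star>))). the (char_action S s \<phi>) \<in> W}"
          unfolding top by blast
      qed
      ultimately show "\<exists>T. openin (subtopology (projection_space S) (D (s\<star>))) T \<and> \<phi> \<in> T \<and>
        T \<subseteq> {\<phi> \<in> topspace (subtopology (projection_space S) (D (s\<star>))). the (char_action S s \<phi>) \<in> W}"
        by blast
    qed
  qed
  have mult: "char_action S (s \<cdot> t) = char_action S s \<circ>\<^sub>m char_action S t"
    if s: "s \<in> carrier S" and t: "t \<in> carrier S" for s t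
  proof
    fix \<phi>
    have st: "(s \<cdot> t)\<star> = (s\<star> \<cdot> t)\<star>" using s t by (rule star_mult)
    show "char_action S (s \<cdot> t) \<phi> = (char_action S s \<circ>\<^sub>m char_action S t) \<phi>"
    proof (cases "\<phi> \<in> D (t\<star>)")
      case False
      \<comment> \<open>The star of a product lies below that of its right factor, so both sides are
        undefined here.\<close>
      have "(s \<cdot> t)\<star> \<cdot> t\<star> = (s \<cdot> t)\<star>" using s t by (rule star_mult_le)
      then have "\<phi> \<notin> D ((s \<cdot> t)\<star>)"
        using False s t by (metis char_mult mem_D mult_closed star_projection)
      then show ?thesis using False by (simp add: char_action_def)
    next
      case True
      define \<psi> where "\<psi> e \<longleftrightarrow> e \<in> E \<and> \<phi> ((e \<cdot> t)\<star>)" for e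
      have t\<phi>: "char_action S t \<phi> = Some \<psi>" using True by (simp add: char_action_apply \<psi>_def[abs_def])
      have \<psi>: "\<psi> \<in> characters E (rmult S)"
        using char_action_character[OF units t True] by (simp add: \<psi>_def[abs_def])
      have "\<phi> \<in> D ((s \<cdot> t)\<star>) \<longleftrightarrow> \<psi> \<in> D (s\<star>)"
        using True \<psi> s by (simp add: mem_D st \<psi>_def star_projection)
      moreover have "(\<lambda>e. e \<in> E \<and> \<phi> ((e \<cdot> (s \<cdot> t))\<star>)) = (\<lambda>e. e \<in> E \<and> \<psi> ((e \<cdot> s)\<star>))"
      proof
        fix e
        have "(e \<cdot> (s \<cdot> t))\<star> = ((e \<cdot> s)\<star> \<cdot> t)\<star>" if "e \<in> E"
          using that s t by (metis mult_assoc mult_closed projection_closed star_mult)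
        then show "(e \<in> E \<and> \<phi> ((e \<cdot> (s \<cdot> t))\<star>)) = (e \<in> E \<and> \<psi> ((e \<cdot> s)\<star>))"
          using s by (auto simp: \<psi>_def star_mult_in)
      qed
      ultimately show ?thesis using t\<phi> by (simp add: char_action_def)
    qed
  qed
  have star: "char_action S (s\<star>) = Some |` D (s\<star>)" if s: "s \<in> carrier S" for s
  proof
    fix \<phi>
    have "(\<lambda>e. e \<in> E \<and> \<phi> ((e \<cdot> s\<star>)\<star>)) = \<phi>" if \<phi>: "\<phi> \<in> D (s\<star>)"
    proof
      fix e
      have "\<phi> e \<Longrightarrow> e \<in> E" using \<phi> charactersD(1) by (auto simp: mem_D)
      moreover have "\<phi> ((e \<cdot> s\<star>)\<star>) \<longleftrightarrow> \<phi> e" if "e \<in> E"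
        using that \<phi> s by (simp add: projection_star projection_mult_closed star_projection mem_D char_mult)
      ultimately show "(e \<in> E \<and> \<phi> ((e \<cdot> s\<star>)\<star>)) = \<phi> e" by blast
    qed
    then show "char_action S (s\<star>) \<phi> = (Some |` D (s\<star>)) \<phi>"
      using s by (auto simp: char_action_def star_star restrict_map_def)
  qed
  show "char_action S \<in> rsgrp_hom S (partial_maps (projection_space S))"
    unfolding rsgrp_hom_def partial_maps_def
    using cont openin_D mult star by (auto simp: dom_char_action star_projection simp del: domIff)
  show "(\<Union>e\<in>E. dom (char_action S e)) = topspace (projection_space S)"
  proof -
    have "dom (char_action S e) = D e" if "e \<in> E" for e
      using that by (simp add: dom_char_action projection_star)
    then have "(\<Union>e\<in>E. dom (char_action S e)) = (\<Union>e\<in>E. D e)" by auto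
    also have "\<dots> = characters E (rmult S)" using charactersD(3) by (fastforce simp: mem_D)
    finally show ?thesis by (simp add: topspace_chars)
  qed
qed

text \<open>The filter of projections above p, the least character with value 1 at p; agreement of
  germs there is therefore the strongest available.\<close>

lemma principal_character:
  assumes "p \<in> E"
  shows "(\<lambda>e. e \<in> E \<and> p \<cdot> e = p) \<in> D p"
proof -
  have "p \<cdot> (e \<cdot> f) = p \<longleftrightarrow> p \<cdot> e = p \<and> p \<cdot> f = p" if "e \<in> E" "f \<in> E" for e f
  proof
    assume eq: "p \<cdot> (e \<cdot> f) = p"
    have "p \<cdot> e = p \<cdot> (e \<cdot> f) \<cdot> e" "p \<cdot> f = p \<cdot> (e \<cdot> f) \<cdot> f" using eq by simp_all
    moreover have "p \<cdot> (e \<cdot> f) \<cdot> e = p \<cdot> (e \<cdot> f)" "p \<cdot> (e \<cdot> f) \<cdot> f = p \<cdot> (e \<cdot> f)"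
      using assms that by (simp_all add: projection_aci)
    ultimately show "p \<cdot> e = p \<and> p \<cdot> f = p" using eq by simp
  next
    assume "p \<cdot> e = p \<and> p \<cdot> f = p"
    then show "p \<cdot> (e \<cdot> f) = p" using assms that by (simp flip: projection_assoc)
  qed
  then show ?thesis using assms by 
    (auto simp: mem_D characters_def projection_mult_closed projection_idem intro!: bexI[of _ p])
qed

end

text \<open>Local units ensure that translated characters are non-zero. Bundling them lets the
  results on germs be inherited for \<open>char_action\<close>.\<close>

locale restriction_semigroup_local_units = restriction_semigroup S for S :: "'a rsgrp" (structure) +
  assumes local_units: "has_local_units S"
begin

sublocale rsgrp_action S "projection_space S" "char_action S"
  by (rule rsgrp_action_chars[OF local_units])

declare domIff [iff del]

section \<open>The canonical embedding\<close>

lemma slice_embedding_eq: "slice_embedding S s = germ S (projection_space S) (char_action S) s ` dom (char_action S s)"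
  by (simp add: slice_embedding_def dom_char_action)

lemma ample_category_chars: "ample_category (char_category S)"
  unfolding char_category_def by (rule ample_category_germ[OF compact_open_base_chars])

lemma slice_embedding_compact: "s \<in> carrier S \<Longrightarrow> compact_slice (char_category S) (slice_embedding S s)"
  unfolding char_category_def slice_embedding_eq
  by (rule compact_slice_germs) (auto simp: dom_char_action openin_D compactin_D star_projection)

lemma slice_embedding_hom: "slice_embedding S \<in> rsgrp_hom S (compact_slices (char_category S))"
proof -
  have "{y \<in> dom (char_action S t). the (char_action S t y) \<in> dom (char_action S s)} = dom (char_action S (s \<cdot> t))"
    if "s \<in> carrier S" "t \<in> carrier S" for s t
    using that by (auto simp: dom_action_mult)
  then show ?thesis
    using slice_embedding_compact
    by (auto simp: rsgrp_hom_def compact_slices_simps(1))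
      (simp_all add: slice_embedding_eq char_category_def germs_mult germs_star dom_action_star)
qed

lemma slice_embedding_inj: "inj_on (slice_embedding S) (carrier S)"
proof (rule inj_onI)
  have le: "s = t \<cdot> s\<star>"
    if s: "s \<in> carrier S" and t: "t \<in> carrier S" and eq: "slice_embedding S s = slice_embedding S t" for s t
  proof -
    define \<phi> where "\<phi> e \<longleftrightarrow> e \<in> projections S \<and> s\<star> \<cdot> e = s\<star>" for e
    have "\<phi> \<in> D (s\<star>)" using principal_character[OF star_projection[OF s]] by (simp add: \<phi>_def[abs_def])
    then have \<phi>s: "\<phi> \<in> dom (char_action S s)" by (simp add: dom_char_action)
    then have "G s \<phi> \<in> slice_embedding S t" using eq by (auto simp: slice_embedding_eq)
    then obtain \<psi> where \<psi>: "\<psi> \<in> dom (char_action S t)" "G s \<phi> = G t \<psi>" by (auto simp: slice_embedding_eq)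
    then obtain e where e: "e \<in> projections S" "\<phi> \<in> dom (char_action S e)" "s \<cdot> e = t \<cdot> e"
      using germ_eq_iff[OF s t \<phi>s \<psi>(1)] by blast
    \<comment> \<open>The projection equating s and t at \<phi> must lie above
      \<open>s\<star>\<close>, which turns equality of germs into s being a restriction of t.
      Exchanging s and t gives equality.\<close>
    then have "\<phi> e" by (simp add: dom_char_action mem_D projection_star)
    then have "s\<star> \<cdot> e = s\<star>" by (simp add: \<phi>_def)
    then have "s = s \<cdot> e" using s e by (metis mult_assoc mult_star projection_closed star_closed)
    then show ?thesis using natural_orderI t e by metis
  qed
  fix s t assume "s \<in> carrier S" "t \<in> carrier S" "slice_embedding S s = slice_embedding S t"
  then show "s = t" using le[of s t] le[of t s] natural_order_antisym by simp
qed

end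

section \<open>The universal property\<close>

locale boolean_extension =
  S: restriction_semigroup_local_units S + T: boolean_restriction_semigroup T
  for S :: "'a rsgrp" and T :: "'b rsgrp" +
  fixes \<alpha> :: "'a \<Rightarrow> 'b"
  assumes T_units: "has_local_units T"
    and \<alpha>_hom: "\<alpha> \<in> rsgrp_hom S T"
    and \<alpha>_nondegenerate: "nondegenerate (projections S) (projection_order T) \<alpha>"
begin

declare domIff [iff del]

abbreviation Gm where "Gm \<equiv> germ S (projection_space S) (char_action S)"
abbreviation \<C> where "\<C> \<equiv> germ_category S (projection_space S) (char_action S)"
abbreviation CS where "CS \<equiv> compact_slices \<C>"
abbreviation mulS (infixl "\<odot>" 70) where "mulS \<equiv> rmult S"
abbreviation mulT (infixl "\<otimes>" 70) where "mulT \<equiv> rmult T"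
abbreviation starS ("_\<degree>" [1000] 999) where "starS \<equiv> rstar S"
abbreviation starT ("_\<bullet>" [1000] 999) where "starT \<equiv> rstar T"

text \<open>The composite of \<open>\<omega>\<close> and \<open>\<alpha>\<close>, cut off outside
  the projections because characters are normalised to be false there.\<close>

definition pullback :: "('b \<Rightarrow> bool) \<Rightarrow> 'a \<Rightarrow> bool" where
  "pullback \<omega> = (\<lambda>e. e \<in> projections S \<and> \<omega> (\<alpha> e))"

lemmas \<alpha>_closed = rsgrp_homD(1)[OF \<alpha>_hom]
lemmas \<alpha>_mult = rsgrp_homD(2)[OF \<alpha>_hom]
lemmas \<alpha>_star = rsgrp_homD(3)[OF \<alpha>_hom]

lemma \<alpha>_projection: "e \<in> projections S \<Longrightarrow> \<alpha> e \<in> projections T"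
  by (metis S.projection_closed S.projection_star T.star_projection \<alpha>_closed \<alpha>_star)

text \<open>Were \<open>\<omega>\<close> zero on the whole image of \<open>\<alpha>\<close>, its
  null set would be an ideal containing that image, hence everything by non-degeneracy, although
  \<open>\<omega>\<close> is not zero.\<close>

lemma pullback_character:
  assumes \<omega>: "\<omega> \<in> prime_characters T"
  shows "pullback \<omega> \<in> characters (projections S) mulS"
proof -
  note \<omega>D = T.prime_charactersD[OF \<omega>]
  have "\<exists>e\<in>projections S. \<omega> (\<alpha> e)"
  proof (rule ccontr)
    assume no: "\<not> (\<exists>e\<in>projections S. \<omega> (\<alpha> e))"
    let ?I = "{e \<in> projections T. \<not> \<omega> e}"
    have "order_ideal (projection_order T) ?I"
    proof -
      have down: "\<not> \<omega> y" if "\<not> \<omega> x" "x \<in> projections T" "y \<in> projections T" "y = y \<otimes> x" for x y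
        using \<omega>D(2)[OF that(3,2)] that(1,4) by simp
      show ?thesis using \<omega>D(4,5)
        by (simp add: order_ideal_def T.zero_projection T.pjoin_closed) (use down in blast)
    qed
    moreover have "\<alpha> ` projections S \<subseteq> ?I" using no \<alpha>_projection by auto
    ultimately have "ideal_generated (projection_order T) (\<alpha> ` projections S) \<subseteq> ?I"
      unfolding ideal_generated_def by blast
    then have "projections T \<subseteq> ?I" using \<alpha>_nondegenerate by (simp add: nondegenerate_def)
    then show False using \<omega>D(3) by blast
  qed
  then show ?thesis
    using \<omega>D(2) \<alpha>_projection
    by (auto simp: characters_def pullback_def S.projection_mult_closed \<alpha>_mult S.projection_closed)
qed

lemma dom_char: "s \<in> carrier S \<Longrightarrow> \<omega> \<in> prime_characters T \<Longrightarrow>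
  pullback \<omega> \<in> dom (char_action S s) \<longleftrightarrow> \<omega> ((\<alpha> s)\<bullet>)"
  using pullback_character[of \<omega>]
  by (auto simp: S.dom_char_action S.mem_D pullback_def S.star_projection \<alpha>_star)

definition meets :: "('b \<Rightarrow> bool) \<Rightarrow> 'a \<Rightarrow> ('a \<times> ('a \<Rightarrow> bool)) set set \<Rightarrow> bool" where
  "meets \<omega> s U \<longleftrightarrow> s \<in> carrier S \<and> pullback \<omega> \<in> dom (char_action S s) \<and> Gm s (pullback \<omega>) \<in> U"

text \<open>\<open>same_germ \<omega> s b\<close>: the germs of \<open>b\<close> and \<open>\<alpha> s\<close> at \<open>\<omega>\<close> coincide. For a prime character \<open>\<omega>\<close>,
  \<open>\<not> \<omega> (b\<bullet>)\<close> means that \<open>b\<close> is zero at \<open>\<omega>\<close>.\<close>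

definition same_germ :: "('b \<Rightarrow> bool) \<Rightarrow> 'a \<Rightarrow> 'b \<Rightarrow> bool" where
  "same_germ \<omega> s b \<longleftrightarrow> (\<exists>c. \<omega> c \<and> b \<otimes> c = \<alpha> s \<otimes> c)"

text \<open>A slice has at most one arrow over \<open>pullback \<omega>\<close>, but that arrow is
  the germ of many s; hence the quantifiers. The equivalence also prescribes where b
  vanishes.\<close>

definition represents :: "('a \<times> ('a \<Rightarrow> bool)) set set \<Rightarrow> 'b \<Rightarrow> bool" where
  "represents U b \<longleftrightarrow> b \<in> carrier T \<and> (\<forall>\<omega>\<in>prime_characters T.
     (\<omega> (b\<bullet>) \<longleftrightarrow> (\<exists>s. meets \<omega> s U)) \<and> (\<forall>s. meets \<omega> s U \<longrightarrow> same_germ \<omega> s b))"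

section \<open>Calculus of germs at a prime character\<close>

lemma prime_closed: "\<omega> \<in> prime_characters T \<Longrightarrow> \<omega> c \<Longrightarrow> c \<in> projections T"
  "\<omega> \<in> prime_characters T \<Longrightarrow> \<omega> c \<Longrightarrow> c \<in> carrier T"
  using T.prime_charactersD(1) T.projection_closed by blast+

lemma prime_mult: "\<omega> \<in> prime_characters T \<Longrightarrow> \<omega> c \<Longrightarrow> \<omega> d \<Longrightarrow> \<omega> (c \<otimes> d)"
  using T.prime_charactersD(2)[of \<omega> c d] T.prime_charactersD(1)[of \<omega>] by simp

lemma same_germ_star:
  assumes \<omega>: "\<omega> \<in> prime_characters T" and s: "s \<in> carrier S" "pullback \<omega> \<in> dom (char_action S s)"
    and b: "b \<in> carrier T" "same_germ \<omega> s b"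
  shows "\<omega> (b\<bullet>)" "same_germ \<omega> (s\<degree>) (b\<bullet>)"
proof -
  obtain c where c: "\<omega> c" "b \<otimes> c = \<alpha> s \<otimes> c" using b by (auto simp: same_germ_def)
  note cp = prime_closed[OF \<omega> c(1)]
  have eq: "b\<bullet> \<otimes> c = (\<alpha> s)\<bullet> \<otimes> c"
    using c b cp s by (metis T.star_mult_projection \<alpha>_closed)
  have "\<omega> ((\<alpha> s)\<bullet>)" using s \<omega> dom_char by simp
  then have "\<omega> (b\<bullet> \<otimes> c)" unfolding eq using c(1) prime_mult \<omega> by blast
  then show "\<omega> (b\<bullet>)" using T.prime_charactersD(2)[OF \<omega>] cp b T.star_projection by blast
  show "same_germ \<omega> (s\<degree>) (b\<bullet>)" using eq c(1) s by (auto simp: same_germ_def \<alpha>_star)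
qed

text \<open>A projection e equating s and t at the pulled back character is sent by
  \<open>\<alpha>\<close> to one equating their images, with value 1 at \<open>\<omega>\<close>; its
  product with the witness for s is a witness for t.\<close>

lemma same_germ_cong:
  assumes \<omega>: "\<omega> \<in> prime_characters T" and s: "s \<in> carrier S" "pullback \<omega> \<in> dom (char_action S s)"
    and t: "t \<in> carrier S" "pullback \<omega> \<in> dom (char_action S t)"
    and eq: "Gm s (pullback \<omega>) = Gm t (pullback \<omega>)"
    and b: "b \<in> carrier T" "same_germ \<omega> s b"
  shows "same_germ \<omega> t b"
proof -
  obtain c where c: "\<omega> c" "b \<otimes> c = \<alpha> s \<otimes> c" using b by (auto simp: same_germ_def)
  note cp = prime_closed[OF \<omega> c(1)]
  obtain e where e: "e \<in> projections S" "pullback \<omega> \<in> dom (char_action S e)" "s \<odot> e = t \<odot> e"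
    using eq S.germ_eq_iff[OF s(1) t(1) s(2) t(2)] by blast
  have \<omega>e: "\<omega> (\<alpha> e)" using e by (simp add: S.dom_char_action S.mem_D pullback_def S.projection_star)
  note ep = prime_closed[OF \<omega> \<omega>e]
  have st: "\<alpha> s \<otimes> \<alpha> e = \<alpha> t \<otimes> \<alpha> e" using s t e by (metis S.projection_closed \<alpha>_mult)
  note closed = cp ep s t b \<alpha>_closed
  have "b \<otimes> (c \<otimes> \<alpha> e) = \<alpha> s \<otimes> \<alpha> e \<otimes> c"
    using c(2) closed by (metis T.mult_assoc T.projection_commute)
  also have "\<dots> = \<alpha> t \<otimes> (c \<otimes> \<alpha> e)"
    using st closed by (metis T.mult_assoc T.projection_commute)
  finally show ?thesis using prime_mult[OF \<omega> c(1) \<omega>e] by (auto simp: same_germ_def)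
qed

lemma same_germ_eq:
  assumes \<omega>: "\<omega> \<in> prime_characters T" and s: "s \<in> carrier S"
    and b: "b \<in> carrier T" "same_germ \<omega> s b" and b': "b' \<in> carrier T" "same_germ \<omega> s b'"
  shows "\<exists>c. \<omega> c \<and> b \<otimes> c = b' \<otimes> c"
proof -
  obtain c where c: "\<omega> c" "b \<otimes> c = \<alpha> s \<otimes> c" using b by (auto simp: same_germ_def)
  obtain d where d: "\<omega> d" "b' \<otimes> d = \<alpha> s \<otimes> d" using b' by (auto simp: same_germ_def)
  note closed = prime_closed[OF \<omega> c(1)] prime_closed[OF \<omega> d(1)] b(1) b'(1) \<alpha>_closed[OF s]
  have "b \<otimes> (c \<otimes> d) = \<alpha> s \<otimes> d \<otimes> c" using c(2) closed by (metis T.mult_assoc T.projection_commute)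
  also have "\<dots> = b' \<otimes> (c \<otimes> d)" using d(2) closed by (metis T.mult_assoc T.projection_commute)
  finally show ?thesis using prime_mult[OF \<omega> c(1) d(1)] by blast
qed

text \<open>One half of the equivalence in \<open>represents\<close> comes for free: having the germ
  of \<open>\<alpha> s\<close> at \<open>\<omega>\<close> already forces b to be non-zero
  there.\<close>

lemma representsI:
  assumes "b \<in> carrier T"
    and "\<And>\<omega>. \<lbrakk>\<omega> \<in> prime_characters T; \<omega> (b\<bullet>)\<rbrakk> \<Longrightarrow> \<exists>s. meets \<omega> s U"
    and "\<And>\<omega> s. \<lbrakk>\<omega> \<in> prime_characters T; meets \<omega> s U\<rbrakk> \<Longrightarrow> same_germ \<omega> s b"
  shows "represents U b"
  using assms same_germ_star(1) unfolding represents_def meets_def by blast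

lemma representsD:
  assumes "represents U b"
  shows "b \<in> carrier T"
    and "\<lbrakk>\<omega> \<in> prime_characters T; \<omega> (b\<bullet>)\<rbrakk> \<Longrightarrow> \<exists>s. meets \<omega> s U"
    and "\<lbrakk>\<omega> \<in> prime_characters T; meets \<omega> s U\<rbrakk> \<Longrightarrow> \<omega> (b\<bullet>)"
    and "\<lbrakk>\<omega> \<in> prime_characters T; meets \<omega> s U\<rbrakk> \<Longrightarrow> same_germ \<omega> s b"
  using assms unfolding represents_def by blast+

lemma represents_unique:
  assumes "represents U b" "represents U b'"
  shows "b = b'"
proof (rule T.eq_if_prime_germs_eq)
  show "b \<in> carrier T" "b' \<in> carrier T" using assms representsD(1) by blast+
  fix \<omega> assume \<omega>: "\<omega> \<in> prime_characters T" "\<omega> (b\<bullet>) \<or> \<omega> (b'\<bullet>)"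
  then obtain s where s: "meets \<omega> s U" using assms representsD(2) by blast
  then have "s \<in> carrier S" by (simp add: meets_def)
  then show "\<exists>c. \<omega> c \<and> b \<otimes> c = b' \<otimes> c"
    using same_germ_eq[OF \<omega>(1)] representsD(1,4) assms s \<omega>(1) by meson
qed

text \<open>Only prime characters at which both elements are non-zero matter. There U and V each
  have an arrow over the same unit, and joint injectivity makes it one arrow, so the germs of b and
  b' agree.\<close>

lemma represents_compatible:
  assumes b: "represents U b" and b': "represents V b'" and inj: "inj_on (dmap \<C>) (U \<union> V)"
  shows "compatible T b b'"
proof -
  note bc = representsD(1)[OF b] representsD(1)[OF b']
  note closed = bc T.star_closed[OF bc(1)] T.star_closed[OF bc(2)]
    T.star_projection[OF bc(1)] T.star_projection[OF bc(2)]
  have "b \<otimes> b'\<bullet> = b' \<otimes> b\<bullet>"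
  proof (rule T.eq_if_prime_germs_eq)
    show "b \<otimes> b'\<bullet> \<in> carrier T" "b' \<otimes> b\<bullet> \<in> carrier T" using closed T.mult_closed by blast+
    fix \<omega> assume \<omega>: "\<omega> \<in> prime_characters T" "\<omega> ((b \<otimes> b'\<bullet>)\<bullet>) \<or> \<omega> ((b' \<otimes> b\<bullet>)\<bullet>)"
    then have \<omega>b: "\<omega> (b\<bullet>)" "\<omega> (b'\<bullet>)"
      using closed T.prime_charactersD(2)[OF \<omega>(1)] by (auto simp: T.star_mult_projection)
    obtain s where s: "meets \<omega> s U" using representsD(2)[OF b \<omega>(1) \<omega>b(1)] by blast
    obtain t where t: "meets \<omega> t V" using representsD(2)[OF b' \<omega>(1) \<omega>b(2)] by blast
    have st: "s \<in> carrier S" "pullback \<omega> \<in> dom (char_action S s)" "t \<in> carrier S" "pullback \<omega> \<in> dom (char_action S t)"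
      using s t by (simp_all add: meets_def)
    have "Gm (s\<degree>) (pullback \<omega>) = Gm (t\<degree>) (pullback \<omega>)"
      using st by (intro S.germ_projection_eq S.star_projection) (simp_all add: S.dom_action_star)
    then have "dmap \<C> (Gm s (pullback \<omega>)) = dmap \<C> (Gm t (pullback \<omega>))"
      using st by (simp add: S.dmap_germ)
    then have "Gm s (pullback \<omega>) = Gm t (pullback \<omega>)"
      using s t inj by (auto simp: meets_def dest: inj_onD)
    then have "same_germ \<omega> t b"
      using same_germ_cong[OF \<omega>(1) st _ bc(1)] representsD(4)[OF b \<omega>(1) s] by blast
    then obtain c where c: "\<omega> c" "b \<otimes> c = b' \<otimes> c"
      using same_germ_eq[OF \<omega>(1) st(3) bc(1) _ bc(2)] representsD(4)[OF b' \<omega>(1) t] by blast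
    note cp = prime_closed[OF \<omega>(1) c(1)]
    \<comment> \<open>Shrinking c below both stars makes the two factors in the compatibility
      equation invisible.\<close>
    define d where "d = b\<bullet> \<otimes> b'\<bullet> \<otimes> c"
    have d: "\<omega> d" unfolding d_def using \<omega>b c(1) prime_mult[OF \<omega>(1)] by blast
    have dp: "d \<in> projections T" "d \<in> carrier T" using prime_closed[OF \<omega>(1) d] by blast+
    have abs: "b'\<bullet> \<otimes> d = d" "b\<bullet> \<otimes> d = d" "c \<otimes> d = d"
      using closed cp by (simp_all add: d_def T.projection_aci)
    have "b \<otimes> b'\<bullet> \<otimes> d = b \<otimes> d" "b' \<otimes> b\<bullet> \<otimes> d = b' \<otimes> d"
      using closed dp abs by (simp_all add: T.mult_assoc)
    moreover have "b \<otimes> d = b' \<otimes> d" using c(2) abs(3) closed cp dp by (metis T.mult_assoc)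
    ultimately show "\<exists>c. \<omega> c \<and> b \<otimes> b'\<bullet> \<otimes> c = b' \<otimes> b\<bullet> \<otimes> c" using d by auto
  qed
  then show ?thesis by (simp add: compatible_def)
qed

lemma same_germ_above:
  assumes \<omega>: "\<omega> \<in> prime_characters T" "\<omega> (b\<bullet>)" and s: "s \<in> carrier S"
    and b: "b \<in> carrier T" "same_germ \<omega> s b" and j: "j \<in> carrier T" "b = j \<otimes> b\<bullet>"
  shows "same_germ \<omega> s j"
proof -
  obtain c where c: "\<omega> c" "b \<otimes> c = \<alpha> s \<otimes> c" using b by (auto simp: same_germ_def)
  note closed = prime_closed[OF \<omega>(1) c(1)] prime_closed[OF \<omega>] b(1) j(1) \<alpha>_closed[OF s]
  have "j \<otimes> (b\<bullet> \<otimes> c) = b \<otimes> c" using j closed by (metis T.mult_assoc)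
  also have "\<dots> = b \<otimes> c \<otimes> b\<bullet>" using closed by (metis T.mult_assoc T.mult_star T.projection_commute)
  also have "\<dots> = \<alpha> s \<otimes> (b\<bullet> \<otimes> c)" using c(2) closed by (metis T.mult_assoc T.projection_commute)
  finally show ?thesis using prime_mult[OF \<omega> c(1)] by (auto simp: same_germ_def)
qed

lemma represents_join:
  assumes b: "represents U b" and b': "represents V b'" and j: "is_join T b b' j"
  shows "represents (U \<union> V) j"
proof (rule representsI)
  note bc = representsD(1)[OF b] representsD(1)[OF b']
  have jc: "j \<in> carrier T" "b = j \<otimes> b\<bullet>" "b' = j \<otimes> b'\<bullet>" using j bc by (simp_all add: T.is_join_iff)
  show "j \<in> carrier T" by (rule jc)
  fix \<omega> assume \<omega>: "\<omega> \<in> prime_characters T"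
  have "\<omega> (j\<bullet>) \<longleftrightarrow> \<omega> (b\<bullet>) \<or> \<omega> (b'\<bullet>)"
    using T.is_join_star[OF bc j] T.prime_charactersD(5)[OF \<omega>] bc T.star_projection by simp
  then show "\<exists>s. meets \<omega> s (U \<union> V)" if "\<omega> (j\<bullet>)"
    using that representsD(2)[OF b \<omega>] representsD(2)[OF b' \<omega>] by (auto simp: meets_def)
  fix s assume "meets \<omega> s (U \<union> V)"
  then have "meets \<omega> s U \<or> meets \<omega> s V" and s: "s \<in> carrier S" by (auto simp: meets_def)
  then show "same_germ \<omega> s j"
    using same_germ_above[OF \<omega> _ s _ _ jc(1)] jc(2,3) bc
      representsD(3,4)[OF b \<omega>] representsD(3,4)[OF b' \<omega>] by metis
qed

text \<open>On prime characters c acts as the indicator of N, so multiplying by it cuts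
  \<open>\<alpha> s\<close> down to the part lying over N.\<close>

lemma represents_basic:
  assumes s: "s \<in> carrier S" and c: "c \<in> projections T" and N: "N \<subseteq> dom (char_action S s)"
    and cN: "\<And>\<omega>. \<omega> \<in> prime_characters T \<Longrightarrow> \<omega> c \<longleftrightarrow> pullback \<omega> \<in> N"
  shows "represents (Gm s ` N) (\<alpha> s \<otimes> c)"
proof (rule representsI)
  have cc: "c \<in> carrier T" "\<alpha> s \<in> carrier T" using c s by (simp_all add: T.projection_closed \<alpha>_closed)
  show b: "\<alpha> s \<otimes> c \<in> carrier T" using cc by (simp add: T.mult_closed)
  fix \<omega> assume \<omega>: "\<omega> \<in> prime_characters T"
  show "\<exists>t. meets \<omega> t (Gm s ` N)" if "\<omega> ((\<alpha> s \<otimes> c)\<bullet>)"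
  proof -
    have "\<omega> c" using that c cc T.prime_charactersD(2)[OF \<omega>] T.star_projection
      by (simp add: T.star_mult_projection)
    then show ?thesis using cN[OF \<omega>] N s by (auto simp: meets_def)
  qed
  fix t assume "meets \<omega> t (Gm s ` N)"
  then obtain \<phi> where t: "t \<in> carrier S" "pullback \<omega> \<in> dom (char_action S t)"
    and \<phi>: "\<phi> \<in> N" "Gm t (pullback \<omega>) = Gm s \<phi>" by (auto simp: meets_def)
  then have "pullback \<omega> = \<phi>" using S.germ_eq_iff[OF t(1) s t(2)] N by blast
  then have N\<omega>: "pullback \<omega> \<in> N" "Gm s (pullback \<omega>) = Gm t (pullback \<omega>)" using \<phi> by simp_all
  then have "\<omega> c" using cN[OF \<omega>] by simp
  moreover have "\<alpha> s \<otimes> c \<otimes> c = \<alpha> s \<otimes> c" using c cc by (simp add: T.mult_assoc T.projection_idem)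
  ultimately have "same_germ \<omega> s (\<alpha> s \<otimes> c)" by (auto simp: same_germ_def)
  then show "same_germ \<omega> t (\<alpha> s \<otimes> c)"
    using same_germ_cong[OF \<omega> s _ t N\<omega>(2) b] N N\<omega>(1) by blast
qed

text \<open>P(S) may lack relative complements; the difference of character sets is matched by one
  formed in P(T) from the images of e and F.\<close>

lemma represents_chars_basic:
  assumes s: "s \<in> carrier S" and e: "e \<in> projections S" and F: "finite F" "F \<subseteq> projections S"
    and N: "S.D e - (\<Union>f\<in>F. S.D f) \<subseteq> dom (char_action S s)"
  shows "\<exists>b. represents (Gm s ` (S.D e - (\<Union>f\<in>F. S.D f))) b"
proof -
  have "\<alpha> ` F \<subseteq> projections T" using F \<alpha>_projection by blast
  from T.relative_complement_prime[OF \<alpha>_projection[OF e] finite_imageI[OF F(1)] this]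
  obtain c where c: "c \<in> projections T"
    "\<forall>\<omega>\<in>prime_characters T. \<omega> c \<longleftrightarrow> \<omega> (\<alpha> e) \<and> (\<forall>f\<in>\<alpha> ` F. \<not> \<omega> f)" by (rule bexE)
  have "\<omega> c \<longleftrightarrow> pullback \<omega> \<in> S.D e - (\<Union>f\<in>F. S.D f)" if \<omega>: "\<omega> \<in> prime_characters T" for \<omega>
    using bspec[OF c(2) \<omega>] pullback_character[OF \<omega>] e F by (auto simp: S.mem_D pullback_def)
  then show ?thesis using represents_basic[OF s c(1) N] by blast
qed

lemma represents_exists:
  assumes W: "compact_slice \<C> W"
  shows "\<exists>b. represents W b"
proof -
  define \<B> where "\<B> = {Gm s ` (S.D e - (\<Union>f\<in>F. S.D f)) | s e F. s \<in> carrier S \<and> e \<in> projections S \<and>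
    finite F \<and> F \<subseteq> projections S \<and> S.D e - (\<Union>f\<in>F. S.D f) \<subseteq> dom (char_action S s) \<and>
    Gm s ` (S.D e - (\<Union>f\<in>F. S.D f)) \<subseteq> W}"
  have Wo: "openin (ctop \<C>) W" and Wc: "compactin (ctop \<C>) W" and inj: "inj_on (dmap \<C>) W"
    using W by (simp_all add: S.compact_slice_iff)
  have "W \<subseteq> \<Union>\<B>"
  proof
    fix g assume g: "g \<in> W"
    then have "g \<in> arrows \<C>" using S.compact_slice_subset[OF W] by blast
    then obtain s \<phi> where s: "g = Gm s \<phi>" "s \<in> carrier S" "\<phi> \<in> dom (char_action S s)"
      unfolding S.arrows_germ by blast
    have "openin (projection_space S) {x \<in> dom (char_action S s). Gm s x \<in> W}"
      using Wo s by (simp add: S.openin_germ_iff)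
    moreover have "\<phi> \<in> {x \<in> dom (char_action S s). Gm s x \<in> W}" using g s by simp
    ultimately obtain e F where e: "e \<in> projections S" "finite F" "F \<subseteq> projections S"
      "\<phi> \<in> S.D e - (\<Union>f\<in>F. S.D f)"
      "S.D e - (\<Union>f\<in>F. S.D f) \<subseteq> {x \<in> dom (char_action S s). Gm s x \<in> W}"
      by (rule S.openin_charsE) blast
    have "Gm s ` (S.D e - (\<Union>f\<in>F. S.D f)) \<in> \<B>"
      unfolding \<B>_def using s e by blast
    moreover have "g \<in> Gm s ` (S.D e - (\<Union>f\<in>F. S.D f))" using s(1) e(4) by (rule image_eqI)
    ultimately show "g \<in> \<Union>\<B>" by blast
  qed
  moreover have "openin (ctop \<C>) B" if "B \<in> \<B>" for B
    using that S.openin_chars_basic S.open_germs unfolding \<B>_def by blast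
  ultimately obtain \<F> where \<F>: "finite \<F>" "\<F> \<subseteq> \<B>" "W \<subseteq> \<Union>\<F>"
    using compactinD[OF Wc] by meson
  have "\<exists>b. represents (\<Union>\<F>) b" using \<F>(1,2)
  proof (induction \<F> rule: finite_induct)
    case empty
    have "represents {} (\<bottom>\<^bsub>projection_order T\<^esub>)"
      using T.prime_charactersD(4) T.zero_projection T.projection_closed T.projection_star
      by (intro representsI) (auto simp: meets_def)
    then show ?case by auto
  next
    case (insert B \<F>)
    then obtain b where b: "represents (\<Union>\<F>) b" by auto
    have "B \<in> \<B>" using insert by simp
    then obtain s e F where "B = Gm s ` (S.D e - (\<Union>f\<in>F. S.D f))" "s \<in> carrier S" "e \<in> projections S"
      "finite F" "F \<subseteq> projections S" "S.D e - (\<Union>f\<in>F. S.D f) \<subseteq> dom (char_action S s)"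
      unfolding \<B>_def by (elim CollectE exE conjE)
    then obtain b' where b': "represents B b'" using represents_chars_basic by metis
    have "B \<union> \<Union>\<F> \<subseteq> W" using insert by (auto simp: \<B>_def)
    then have "inj_on (dmap \<C>) (B \<union> \<Union>\<F>)" by (rule inj_on_subset[OF inj])
    then have "compatible T b' b" by (rule represents_compatible[OF b' b])
    then obtain j where "is_join T b' b j"
      using T.join_exists representsD(1)[OF b] representsD(1)[OF b'] by blast
    then show ?case using represents_join[OF b' b] by auto
  qed
  moreover have "\<Union>\<F> = W" using \<F> by (auto simp: \<B>_def)
  ultimately show ?thesis by simp
qed

text \<open>Translation in T by b corresponds to the action of t in S. With b and
  \<open>\<alpha> t\<close> equated by c, the projections
  \<open>(\<alpha> e \<otimes> b)\<bullet>\<close> and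
  \<open>\<alpha> ((e \<odot> t)\<degree>)\<close> agree below c, and c has value 1.\<close>

lemma pullback_translate:
  assumes \<omega>: "\<omega> \<in> prime_characters T" and t: "t \<in> carrier S" "pullback \<omega> \<in> dom (char_action S t)"
    and b: "b \<in> carrier T" "same_germ \<omega> t b"
  shows "pullback (\<lambda>e. e \<in> projections T \<and> \<omega> ((e \<otimes> b)\<bullet>)) = the (char_action S t (pullback \<omega>))"
proof
  obtain c where c: "\<omega> c" "b \<otimes> c = \<alpha> t \<otimes> c" using b by (auto simp: same_germ_def)
  note cp = prime_closed[OF \<omega> c(1)]
  have tc: "\<alpha> t \<in> carrier T" using t by (simp add: \<alpha>_closed)
  fix e
  have "\<omega> ((\<alpha> e \<otimes> b)\<bullet>) \<longleftrightarrow> \<omega> (\<alpha> ((e \<odot> t)\<degree>))" if e: "e \<in> projections S"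
  proof -
    have ec: "e \<in> carrier S" "\<alpha> e \<in> carrier T" using e by (simp_all add: S.projection_closed \<alpha>_closed)
    have "(\<alpha> e \<otimes> b)\<bullet> \<otimes> c = (\<alpha> e \<otimes> (b \<otimes> c))\<bullet>"
      using ec b cp by (metis T.mult_assoc T.mult_closed T.star_mult_projection)
    also have "\<dots> = (\<alpha> e \<otimes> \<alpha> t)\<bullet> \<otimes> c"
      unfolding c(2) using ec tc cp by (metis T.mult_assoc T.mult_closed T.star_mult_projection)
    also have "(\<alpha> e \<otimes> \<alpha> t)\<bullet> = \<alpha> ((e \<odot> t)\<degree>)" using ec t by (simp add: \<alpha>_mult \<alpha>_star S.mult_closed)
    finally have eq: "(\<alpha> e \<otimes> b)\<bullet> \<otimes> c = \<alpha> ((e \<odot> t)\<degree>) \<otimes> c" .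
    have "(\<alpha> e \<otimes> b)\<bullet> \<in> projections T" "\<alpha> ((e \<odot> t)\<degree>) \<in> projections T"
      using ec b t by (simp_all add: T.mult_closed T.star_projection \<alpha>_projection S.star_projection S.mult_closed)
    then show ?thesis using T.prime_charactersD(2)[OF \<omega> _ cp(1)] c(1) eq by metis
  qed
  moreover have "pullback \<omega> \<in> S.D (t\<degree>)" using t by (simp add: S.dom_char_action)
  ultimately show "pullback (\<lambda>e. e \<in> projections T \<and> \<omega> ((e \<otimes> b)\<bullet>)) e = the (char_action S t (pullback \<omega>)) e"
    using t \<alpha>_projection by (auto simp: S.char_action_apply pullback_def S.star_mult_in)
qed

text \<open>An arrow of V over \<open>pullback \<omega>\<close> is composed with an arrow of U over
  its range. By \<open>pullback_translate\<close> that range is the pullback of the translated prime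
  character, so b is examined there while b' is examined at \<open>\<omega>\<close>.\<close>

lemma represents_mult:
  assumes b: "represents U b" and b': "represents V b'"
    and UV: "U \<subseteq> arrows \<C>" "V \<subseteq> arrows \<C>"
  shows "represents (U \<cdot>\<^bsub>CS\<^esub> V) (b \<otimes> b')"
proof (rule representsI)
  note bc = representsD(1)[OF b] representsD(1)[OF b']
  note closed = bc T.star_closed[OF bc(1)] T.star_closed[OF bc(2)]
    T.star_projection[OF bc(1)] T.star_projection[OF bc(2)]
  show "b \<otimes> b' \<in> carrier T" using bc by (rule T.mult_closed)
  fix \<omega> assume \<omega>: "\<omega> \<in> prime_characters T"
  let ?\<omega>' = "\<lambda>e. e \<in> projections T \<and> \<omega> ((e \<otimes> b')\<bullet>)"
  show "\<exists>s. meets \<omega> s (U \<cdot>\<^bsub>CS\<^esub> V)" if bb': "\<omega> ((b \<otimes> b')\<bullet>)"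
  proof -
    have "(b \<otimes> b')\<bullet> \<otimes> b'\<bullet> = (b \<otimes> b')\<bullet>" using bc by (rule T.star_mult_le)
    then have \<omega>b': "\<omega> (b'\<bullet>)"
      using bb' T.prime_charactersD(2)[OF \<omega>] closed T.mult_closed T.star_projection by metis
    then obtain t where t: "meets \<omega> t V" using representsD(2)[OF b' \<omega>] by blast
    then have tc: "t \<in> carrier S" "pullback \<omega> \<in> dom (char_action S t)" "Gm t (pullback \<omega>) \<in> V"
      by (simp_all add: meets_def)
    have \<omega>': "?\<omega>' \<in> prime_characters T"
      using T.prime_character_translate[OF \<omega> bc(2) \<omega>b' T_units] .
    have pb: "pullback ?\<omega>' = the (char_action S t (pullback \<omega>))"
      using pullback_translate[OF \<omega> tc(1,2) bc(2)] representsD(4)[OF b' \<omega> t] by blast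
    have "?\<omega>' (b\<bullet>)" using bb' closed T.star_mult[OF bc] by simp
    then obtain s where "meets ?\<omega>' s U" using representsD(2)[OF b \<omega>'] by blast
    then have s: "s \<in> carrier S" "the (char_action S t (pullback \<omega>)) \<in> dom (char_action S s)"
      "Gm s (the (char_action S t (pullback \<omega>))) \<in> U" by (simp_all add: meets_def pb)
    have "rmap \<C> (Gm t (pullback \<omega>)) = dmap \<C> (Gm s (the (char_action S t (pullback \<omega>))))"
      using s tc by (simp add: S.rmap_eq_dmap_iff)
    then have "Gm (s \<odot> t) (pullback \<omega>) \<in> U \<cdot>\<^bsub>CS\<^esub> V"
      using s tc S.ccomp_germ[OF s(1,2) tc(1,2)] unfolding compact_slices_simps by force
    then show ?thesis
      using s tc by (intro exI[of _ "s \<odot> t"]) (simp add: meets_def S.mult_closed S.dom_action_mult)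
  qed
  fix w assume "meets \<omega> w (U \<cdot>\<^bsub>CS\<^esub> V)"
  then have w: "w \<in> carrier S" "pullback \<omega> \<in> dom (char_action S w)" "Gm w (pullback \<omega>) \<in> U \<cdot>\<^bsub>CS\<^esub> V"
    by (simp_all add: meets_def)
  then obtain g h where gh: "Gm w (pullback \<omega>) = ccomp \<C> g h" "g \<in> U" "h \<in> V" "rmap \<C> h = dmap \<C> g"
    by (auto simp: compact_slices_simps)
  then have "(g, h) \<in> composable \<C>" using UV by (auto simp: composable_def)
  then obtain s t y where st: "s \<in> carrier S" "t \<in> carrier S" "y \<in> dom (char_action S t)"
    "the (char_action S t y) \<in> dom (char_action S s)" "g = Gm s (the (char_action S t y))" "h = Gm t y"
    by (rule S.composable_germE)
  have "Gm w (pullback \<omega>) = Gm (s \<odot> t) y" using gh st by (simp add: S.ccomp_germ)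
  moreover have std: "s \<odot> t \<in> carrier S" "y \<in> dom (char_action S (s \<odot> t))"
    using st by (simp_all add: S.mult_closed S.dom_action_mult)
  ultimately have y: "y = pullback \<omega>" and weq: "Gm (s \<odot> t) (pullback \<omega>) = Gm w (pullback \<omega>)"
    using S.germ_eq_iff[OF w(1) std(1) w(2) std(2)] by auto
  have t: "meets \<omega> t V" using st gh y by (simp add: meets_def)
  then have same_t: "same_germ \<omega> t b'" and \<omega>b': "\<omega> (b'\<bullet>)"
    using representsD(3,4)[OF b' \<omega>] by blast+
  have \<omega>': "?\<omega>' \<in> prime_characters T"
    using T.prime_character_translate[OF \<omega> bc(2) \<omega>b' T_units] .
  have pb: "pullback ?\<omega>' = the (char_action S t (pullback \<omega>))"
    using pullback_translate[OF \<omega> st(2) _ bc(2) same_t] st(3) y by blast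
  have "meets ?\<omega>' s U" using st gh y by (simp add: meets_def pb)
  then have "same_germ ?\<omega>' s b" using representsD(4)[OF b \<omega>'] by blast
  then obtain d where d: "d \<in> projections T" "\<omega> ((d \<otimes> b')\<bullet>)" "b \<otimes> d = \<alpha> s \<otimes> d"
    by (auto simp: same_germ_def)
  obtain c where c: "\<omega> c" "b' \<otimes> c = \<alpha> t \<otimes> c" using same_t by (auto simp: same_germ_def)
  let ?d = "(d \<otimes> b')\<bullet>"
  note cl = closed prime_closed[OF \<omega> c(1)] prime_closed[OF \<omega> d(2)] d(1) T.projection_closed[OF d(1)]
    \<alpha>_closed[OF st(1)] \<alpha>_closed[OF st(2)] T.mult_closed
  \<comment> \<open>The projection d equates b and \<open>\<alpha> s\<close> at the translated
    character. Carried to the right of b' it becomes \<open>?d\<close>, which has value 1 at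
    \<open>\<omega>\<close> itself and can be combined with c.\<close>
  have shift: "u \<otimes> b' \<otimes> ?d = u \<otimes> d \<otimes> b'" if "u \<in> carrier T" for u
    using that d(1) bc(2) by (intro T.mult_projection_left_shift)
  have "b \<otimes> b' \<otimes> (?d \<otimes> c) = b \<otimes> b' \<otimes> ?d \<otimes> c" using cl by (simp add: T.mult_assoc)
  also have "\<dots> = \<alpha> s \<otimes> b' \<otimes> ?d \<otimes> c" using shift[OF bc(1)] shift[of "\<alpha> s"] cl d(3) by simp
  also have "\<dots> = \<alpha> s \<otimes> (b' \<otimes> c) \<otimes> ?d" using cl by (simp add: T.mult_assoc T.projection_commute)
  also have "\<dots> = \<alpha> s \<otimes> \<alpha> t \<otimes> (?d \<otimes> c)" unfolding c(2) using cl by (simp add: T.mult_assoc T.projection_commute)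
  also have "\<dots> = \<alpha> (s \<odot> t) \<otimes> (?d \<otimes> c)" using st by (simp add: \<alpha>_mult)
  finally have "same_germ \<omega> (s \<odot> t) (b \<otimes> b')"
    using prime_mult[OF \<omega> d(2) c(1)] by (auto simp: same_germ_def)
  then show "same_germ \<omega> w (b \<otimes> b')"
    using same_germ_cong[OF \<omega> std(1) _ w(1,2) weq T.mult_closed[OF bc]] std(2) y by blast
qed

lemma represents_star:
  assumes b: "represents U b" and U: "U \<subseteq> arrows \<C>"
  shows "represents (U\<star>\<^bsub>CS\<^esub>) (b\<bullet>)"
proof (rule representsI)
  note bc = representsD(1)[OF b]
  show "b\<bullet> \<in> carrier T" using bc by (rule T.star_closed)
  fix \<omega> assume \<omega>: "\<omega> \<in> prime_characters T"
  show "\<exists>s. meets \<omega> s (U\<star>\<^bsub>CS\<^esub>)" if "\<omega> ((b\<bullet>)\<bullet>)"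
  proof -
    have "\<omega> (b\<bullet>)" using that bc by (simp add: T.star_star)
    then obtain s where "meets \<omega> s U" using representsD(2)[OF b \<omega>] by blast
    then have "meets \<omega> (s\<degree>) (U\<star>\<^bsub>CS\<^esub>)"
      by (auto simp: meets_def compact_slices_simps S.star_closed S.dom_action_star S.dmap_germ[symmetric])
    then show ?thesis by blast
  qed
  fix w assume "meets \<omega> w (U\<star>\<^bsub>CS\<^esub>)"
  then obtain g where w: "w \<in> carrier S" "pullback \<omega> \<in> dom (char_action S w)"
    and g: "g \<in> U" "Gm w (pullback \<omega>) = dmap \<C> g"
    by (auto simp: meets_def compact_slices_simps)
  then obtain s y where s: "g = Gm s y" "s \<in> carrier S" "y \<in> dom (char_action S s)"
    using U unfolding S.arrows_germ by blast
  then have sd: "s\<degree> \<in> carrier S" "y \<in> dom (char_action S (s\<degree>))" by (simp_all add: S.star_closed S.dom_action_star)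
  have "Gm w (pullback \<omega>) = Gm (s\<degree>) y" using g s by (simp add: S.dmap_germ)
  then have y: "y = pullback \<omega>" and eq: "Gm (s\<degree>) (pullback \<omega>) = Gm w (pullback \<omega>)"
    using S.germ_eq_iff[OF w(1) sd(1) w(2) sd(2)] by auto
  have "meets \<omega> s U" using s g y by (simp add: meets_def)
  then have "same_germ \<omega> s b" using representsD(4)[OF b \<omega>] by blast
  then have "same_germ \<omega> (s\<degree>) (b\<bullet>)" using same_germ_star(2)[OF \<omega> s(2) _ bc] s(3) y by blast
  then show "same_germ \<omega> w (b\<bullet>)"
    using same_germ_cong[OF \<omega> sd(1) _ w eq T.star_closed[OF bc]] sd(2) y by blast
qed

lemma represents_slice_embedding:
  assumes s: "s \<in> carrier S"
  shows "represents (slice_embedding S s) (\<alpha> s)"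
proof -
  have "represents (Gm s ` dom (char_action S s)) (\<alpha> s \<otimes> (\<alpha> s)\<bullet>)"
    using s dom_char by (intro represents_basic) (auto simp: T.star_projection \<alpha>_closed)
  then show ?thesis using s by (simp add: T.mult_star \<alpha>_closed S.slice_embedding_eq)
qed

section \<open>The induced morphism\<close>

definition extension :: "('a \<times> ('a \<Rightarrow> bool)) set set \<Rightarrow> 'b" where
  "extension U = (SOME b. represents U b)"

lemma represents_extension: "compact_slice \<C> U \<Longrightarrow> represents U (extension U)"
  unfolding extension_def using represents_exists by (rule someI_ex)

lemma extension_eq: "represents U b \<Longrightarrow> extension U = b"
  unfolding extension_def by (metis represents_unique someI)

lemma extension_embedding: "s \<in> carrier S \<Longrightarrow> extension (slice_embedding S s) = \<alpha> s"
  by (rule extension_eq[OF represents_slice_embedding])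

lemma extension_rsgrp_hom: "extension \<in> rsgrp_hom CS T"
  using representsD(1)[OF represents_extension]
    extension_eq[OF represents_mult[OF represents_extension represents_extension]]
    extension_eq[OF represents_star[OF represents_extension]] S.compact_slice_subset
  unfolding rsgrp_hom_def compact_slices_simps(1) by (auto simp: compact_slices_simps(1))

lemma extension_hom: "extension \<in> boolean_rsgrp_hom CS T"
proof -
  interpret C: boolean_restriction_semigroup CS by (rule S.boolean_compact_slices)
  note h = rsgrp_homD[OF extension_rsgrp_hom]
  have proj: "extension K \<in> projections T" if "K \<in> projections CS" for K
    using h(1,3) S.CS.projection_closed[OF that] S.CS.projection_star[OF that] T.star_projection by metis
  have slice: "compact_slice \<C> K" if "K \<in> projections CS" for K
    using S.CS.projection_closed[OF that] by (simp add: compact_slices_simps(1))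
  have "C.zero = {}"
    using C.zero_mult(1)[of "{}"] S.compact_slice_empty by (simp add: compact_slices_simps)
  moreover have "represents {} T.zero"
    using T.prime_charactersD(4) T.zero_projection T.projection_closed T.projection_star
    by (intro representsI) (auto simp: meets_def)
  ultimately have zero: "extension C.zero = T.zero" by (simp add: extension_eq)
  have meet: "extension (K \<sqinter>\<^bsub>projection_order CS\<^esub> L) = extension K \<sqinter>\<^bsub>projection_order T\<^esub> extension L"
    if "K \<in> projections CS" "L \<in> projections CS" for K L
    using that proj h(2) S.CS.projection_closed by (simp add: C.pmeet_eq T.pmeet_eq)
  have join: "extension (K \<squnion>\<^bsub>projection_order CS\<^esub> L) = extension K \<squnion>\<^bsub>projection_order T\<^esub> extension L"
    if KL: "K \<in> projections CS" "L \<in> projections CS" for K L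
  proof -
    \<comment> \<open>The lattice join of projections is first identified with the union, the form
      in which \<open>represents_join\<close> applies.\<close>
    have "K \<union> L \<in> projections CS" using KL by (rule S.projections_Un_Int_Diff)
    then have "inj_on (dmap \<C>) (K \<union> L)" using slice by (simp add: S.compact_slice_iff)
    then have "is_join CS K L (K \<union> L)" using KL slice by (intro S.is_join_Un) auto
    then have "K \<squnion>\<^bsub>projection_order CS\<^esub> L = K \<union> L"
      using C.is_join_pjoin[OF KL] S.CS.is_join_unique KL S.CS.projection_closed by metis
    moreover have "represents (K \<union> L) (extension K \<squnion>\<^bsub>projection_order T\<^esub> extension L)"
      using KL by (intro represents_join[OF represents_extension[OF slice] represents_extension[OF slice]
        T.is_join_pjoin[OF proj proj]])
    ultimately show ?thesis by (simp add: extension_eq)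
  qed
  have "nondegenerate (projections CS) (projection_order T) extension"
    unfolding nondegenerate_def
  proof
    have "order_ideal (projection_order T) (projections T)"
      by (auto simp: order_ideal_def T.zero_projection T.pjoin_closed)
    then show "ideal_generated (projection_order T) (extension ` projections CS) \<subseteq> carrier (projection_order T)"
      using proj by (auto simp: ideal_generated_def)
    \<comment> \<open>Non-degeneracy is inherited: the image of the extension contains that of
      \<open>\<alpha>\<close>, hence generates at least as large an ideal.\<close>
    have "\<alpha> ` projections S \<subseteq> extension ` projections CS"
    proof
      fix x assume "x \<in> \<alpha> ` projections S"
      then obtain e where e: "e \<in> projections S" "x = \<alpha> e" by blast
      then have ec: "e \<in> carrier S" by (simp add: S.projection_closed)
      have hom: "slice_embedding S \<in> rsgrp_hom S CS"
        using S.slice_embedding_hom by (simp add: char_category_def)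
      have "slice_embedding S e \<in> projections CS"
        using rsgrp_homD(1,3)[OF hom ec] S.CS.star_projection S.projection_star[OF e(1)] by metis
      then show "x \<in> extension ` projections CS" 
        using extension_embedding[OF ec] e(2) by (intro image_eqI[of _ _ "slice_embedding S e"]) simp_all
    qed
    then have "ideal_generated (projection_order T) (\<alpha> ` projections S)
        \<subseteq> ideal_generated (projection_order T) (extension ` projections CS)"
      unfolding ideal_generated_def by (intro Inter_anti_mono Collect_mono) (metis order_trans)
    then show "carrier (projection_order T) \<subseteq> ideal_generated (projection_order T) (extension ` projections CS)"
      using \<alpha>_nondegenerate by (simp add: nondegenerate_def)
  qed
  then show ?thesis
    using extension_rsgrp_hom proj zero meet join
    by (auto simp: boolean_rsgrp_hom_def gba_hom_def)
qed

end

section \<open>Adjoining an identity\<close>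

lemma rsgrp_hom_comp:
  "\<lbrakk>f \<in> rsgrp_hom S T; g \<in> rsgrp_hom T U\<rbrakk> \<Longrightarrow> g \<circ> f \<in> rsgrp_hom S U"
  by (auto simp: rsgrp_hom_def image_subset_iff)

lemma rsgrp_iso_image:
  assumes "restriction_semigroup S" and h: "h \<in> rsgrp_hom S T" "inj_on h (carrier S)"
  shows "subalgebra (h ` carrier S) T" and "h \<in> rsgrp_iso S (T\<lparr>carrier := h ` carrier S\<rparr>)"
proof -
  interpret restriction_semigroup S by fact
  have "h x \<cdot>\<^bsub>T\<^esub> h y = h (x \<cdot>\<^bsub>S\<^esub> y)" "(h x)\<star>\<^bsub>T\<^esub> = h (x\<star>\<^bsub>S\<^esub>)"
    if "x \<in> carrier S" "y \<in> carrier S" for x y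
    using h(1) that by (simp_all add: rsgrp_hom_def)
  then show "subalgebra (h ` carrier S) T"
    using h(1) by (auto simp: subalgebra_def rsgrp_hom_def mult_closed star_closed)
  show "h \<in> rsgrp_iso S (T\<lparr>carrier := h ` carrier S\<rparr>)"
    using h by (auto simp: rsgrp_iso_def rsgrp_hom_def bij_betw_def)
qed

context restriction_semigroup
begin

abbreviation S1 where "S1 \<equiv> adjoin_identity S"

lemma adjoin_identity_simps:
  "Some a \<in> carrier (adjoin_identity S) \<longleftrightarrow> a \<in> carrier S"
  "None \<in> carrier (adjoin_identity S) \<longleftrightarrow> \<not> has_identity S"
  "None \<cdot>\<^bsub>S1\<^esub> y = y" "x \<cdot>\<^bsub>S1\<^esub> None = x"
  "Some a \<cdot>\<^bsub>S1\<^esub> Some b = Some (a \<cdot> b)"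
  "None\<star>\<^bsub>S1\<^esub> = None" "(Some a)\<star>\<^bsub>S1\<^esub> = Some (a\<star>)"
  by (auto simp: adjoin_identity_def split: option.split)

lemma restriction_semigroup_adjoin_identity: "restriction_semigroup (adjoin_identity S)"
proof
  fix x y z
  assume x: "x \<in> carrier (adjoin_identity S)"
  then show "x\<star>\<^bsub>S1\<^esub> \<in> carrier (adjoin_identity S)"
    "x \<cdot>\<^bsub>S1\<^esub> x\<star>\<^bsub>S1\<^esub> = x"
    by (cases x; simp add: adjoin_identity_simps star_closed mult_star)+
  assume y: "y \<in> carrier (adjoin_identity S)"
  from x y show "x \<cdot>\<^bsub>S1\<^esub> y \<in> carrier (adjoin_identity S)"
    by (cases x; cases y; simp add: adjoin_identity_simps mult_closed)
  from x y show "x\<star>\<^bsub>S1\<^esub> \<cdot>\<^bsub>S1\<^esub> y\<star>\<^bsub>S1\<^esub>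
      = y\<star>\<^bsub>S1\<^esub> \<cdot>\<^bsub>S1\<^esub> x\<star>\<^bsub>S1\<^esub>"
    by (cases x; cases y; simp add: adjoin_identity_simps star_commute)
  from x y show "(x\<star>\<^bsub>S1\<^esub> \<cdot>\<^bsub>S1\<^esub> y\<star>\<^bsub>S1\<^esub>)\<star>\<^bsub>S1\<^esub>
      = x\<star>\<^bsub>S1\<^esub> \<cdot>\<^bsub>S1\<^esub> y\<star>\<^bsub>S1\<^esub>"
    by (cases x; cases y; simp add: adjoin_identity_simps star_mult_star star_star)
  from x y show "(x \<cdot>\<^bsub>S1\<^esub> y)\<star>\<^bsub>S1\<^esub>
      = (x\<star>\<^bsub>S1\<^esub> \<cdot>\<^bsub>S1\<^esub> y)\<star>\<^bsub>S1\<^esub>"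
    by (cases x; cases y; simp add: adjoin_identity_simps star_mult[symmetric] star_star)
  from x y show "x\<star>\<^bsub>S1\<^esub> \<cdot>\<^bsub>S1\<^esub> y
      = y \<cdot>\<^bsub>S1\<^esub> (x \<cdot>\<^bsub>S1\<^esub> y)\<star>\<^bsub>S1\<^esub>"
    by (cases x; cases y; simp add: adjoin_identity_simps star_ample mult_star)
  assume z: "z \<in> carrier (adjoin_identity S)"
  from x y z show "x \<cdot>\<^bsub>S1\<^esub> y \<cdot>\<^bsub>S1\<^esub> z
      = x \<cdot>\<^bsub>S1\<^esub> (y \<cdot>\<^bsub>S1\<^esub> z)"
    by (cases x; cases y; cases z; simp add: adjoin_identity_simps mult_assoc)
qed

lemma adjoin_identity_hom: "Some \<in> rsgrp_hom S (adjoin_identity S)"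
  by (auto simp: rsgrp_hom_def adjoin_identity_simps)

text \<open>One two-sided unit serves every element. An identity i already in S is a projection
  because i equals \<open>i \<cdot> i\<star>\<close>, which equals \<open>i\<star>\<close>.\<close>

lemma local_units_adjoin_identity: "has_local_units (adjoin_identity S)"
proof -
  have "\<exists>e\<in>projections (adjoin_identity S). \<forall>s\<in>carrier (adjoin_identity S).
      e \<cdot>\<^bsub>S1\<^esub> s = s \<and> s \<cdot>\<^bsub>S1\<^esub> e = s"
  proof (cases "has_identity S")
    case True
    then obtain i where i: "i \<in> carrier S" "\<And>s. s \<in> carrier S \<Longrightarrow> i \<cdot> s = s \<and> s \<cdot> i = s"
      unfolding has_identity_def by blast
    then have "i\<star> = i" using mult_star star_closed by metis
    then have "(Some i)\<star>\<^bsub>S1\<^esub> = Some i" by (simp add: adjoin_identity_simps)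
    then have "Some i \<in> projections (adjoin_identity S)"
      using i(1) unfolding projections_def by (metis adjoin_identity_simps(1) image_eqI)
    moreover have "Some i \<cdot>\<^bsub>S1\<^esub> s = s \<and> s \<cdot>\<^bsub>S1\<^esub> Some i = s"
      if "s \<in> carrier (adjoin_identity S)" for s
      using that i(2) True by (cases s) (simp_all add: adjoin_identity_simps)
    ultimately show ?thesis by blast
  next
    case False
    then have "None \<in> projections (adjoin_identity S)"
      unfolding projections_def by (metis adjoin_identity_simps(2,6) image_eqI)
    then show ?thesis by (intro bexI[of _ None]) (simp_all add: adjoin_identity_simps)
  qed
  then show ?thesis unfolding has_local_units_def by blast
qed

end

theorem theorem1p1:
  fixes S :: "'a rsgrp"
  assumes "restriction_semigroup S"
  shows
    "(has_local_units S \<longrightarrow>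
        rsgrp_action S (projection_space S) (char_action S) \<and>
        ample_category (char_category S) \<and>
        boolean_restriction_semigroup (compact_slices (char_category S)) \<and>
        slice_embedding S \<in> rsgrp_hom S (compact_slices (char_category S)) \<and>
        inj_on (slice_embedding S) (carrier S) \<and>
        (\<forall>(T :: 'b rsgrp) \<alpha>.
           boolean_restriction_semigroup T \<and> has_local_units T \<and> \<alpha> \<in> rsgrp_hom S T \<and>
           nondegenerate (projections S) (projection_order T) \<alpha> \<longrightarrow>
           (\<exists>\<psi> \<in> boolean_rsgrp_hom (compact_slices (char_category S)) T.
              \<forall>s\<in>carrier S. \<alpha> s = \<psi> (slice_embedding S s)))) \<and>
     (boolean_restriction_semigroup (compact_slices (char_category (adjoin_identity S))) \<and>
      (\<exists>h \<in> rsgrp_hom S (compact_slices (char_category (adjoin_identity S))).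
         inj_on h (carrier S)) \<and>
      (\<exists>(C :: ('a option \<times> ('a option \<Rightarrow> bool)) set top_category) A h.
         ample_category C \<and> subalgebra A (compact_slices C) \<and>
         h \<in> rsgrp_iso S ((compact_slices C)\<lparr>carrier := A\<rparr>)))"
proof (intro conjI impI)
  interpret S: restriction_semigroup S by fact
  {
    assume "has_local_units S"
    then interpret S: restriction_semigroup_local_units S by unfold_locales
    show "rsgrp_action S (projection_space S) (char_action S)"
      by (rule S.rsgrp_action_chars[OF S.local_units])
    show "ample_category (char_category S)" by (rule S.ample_category_chars)
    show "boolean_restriction_semigroup (compact_slices (char_category S))"
      unfolding char_category_def by (rule S.boolean_compact_slices)
    show "slice_embedding S \<in> rsgrp_hom S (compact_slices (char_category S))"
      by (rule S.slice_embedding_hom)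
    show "inj_on (slice_embedding S) (carrier S)" by (rule S.slice_embedding_inj)
    show "\<forall>(T :: 'b rsgrp) \<alpha>.
       boolean_restriction_semigroup T \<and> has_local_units T \<and> \<alpha> \<in> rsgrp_hom S T \<and>
       nondegenerate (projections S) (projection_order T) \<alpha> \<longrightarrow>
       (\<exists>\<psi> \<in> boolean_rsgrp_hom (compact_slices (char_category S)) T.
          \<forall>s\<in>carrier S. \<alpha> s = \<psi> (slice_embedding S s))"
    proof (intro allI impI, elim conjE)
      fix T :: "'b rsgrp" and \<alpha>
      assume T: "boolean_restriction_semigroup T" "has_local_units T" "\<alpha> \<in> rsgrp_hom S T"
        "nondegenerate (projections S) (projection_order T) \<alpha>"
      then interpret boolean_extension S T \<alpha>
        by (intro boolean_extension.intro boolean_extension_axioms.intro S.restriction_semigroup_local_units_axioms)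
      show "\<exists>\<psi> \<in> boolean_rsgrp_hom (compact_slices (char_category S)) T.
          \<forall>s\<in>carrier S. \<alpha> s = \<psi> (slice_embedding S s)"
        using extension_hom extension_embedding unfolding char_category_def
        by (intro bexI[of _ extension]) simp_all
    qed
  next
    let ?A = "adjoin_identity S"
    interpret A: restriction_semigroup_local_units ?A
      by (intro restriction_semigroup_local_units.intro restriction_semigroup_local_units_axioms.intro
          S.restriction_semigroup_adjoin_identity S.local_units_adjoin_identity)
    \<comment> \<open>Adjoining an identity supplies the local units that S may lack;
      \<open>Some\<close> merely tags the elements of S and is injective.\<close>
    let ?h = "slice_embedding ?A \<circ> Some"
    show "boolean_restriction_semigroup (compact_slices (char_category ?A))"
      unfolding char_category_def by (rule A.boolean_compact_slices)
    have h: "?h \<in> rsgrp_hom S (compact_slices (char_category ?A))"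
      by (rule rsgrp_hom_comp[OF S.adjoin_identity_hom A.slice_embedding_hom])
    have inj: "inj_on ?h (carrier S)"
      using A.slice_embedding_inj
      by (intro comp_inj_on) (auto intro: inj_on_subset simp: S.adjoin_identity_simps)
    show "\<exists>h \<in> rsgrp_hom S (compact_slices (char_category ?A)). inj_on h (carrier S)"
      using h inj by blast
    \<comment> \<open>The witnesses are the germ category of the enlarged semigroup and the image of
      S under the embedding.\<close>
    show "\<exists>(C :: ('a option \<times> ('a option \<Rightarrow> bool)) set top_category) A h.
         ample_category C \<and> subalgebra A (compact_slices C) \<and>
         h \<in> rsgrp_iso S ((compact_slices C)\<lparr>carrier := A\<rparr>)"
      using A.ample_category_chars rsgrp_iso_image[OF assms h inj] by blast
  }
qed

end
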